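(* Let $0<\alpha<1$ and let $\theta(x,t)$, $x\in\mathbb{R}^d$, $t\ge 0$, be a smooth solution, periodic in $x$, of the active scalar equation $$\theta_t=(u\cdot\nabla)\theta-(-\Delta)^\alpha\theta,\qquad \theta(x,0)=\theta_0(x),$$ where $u=u[\theta]$ is determined from $\theta$ and $\omega\mapsto\Omega_\omega$ is an associated assignment of moduli of continuity for $u$ (see context). Suppose that $\omega(\xi,t)$ is continuous in $(\xi,t)$ and piecewise $C^1$ in $t$ for each fixed $\xi$, that for every fixed $t\ge 0$ the function $\omega(\cdot,t)$ is a modulus of continuity, and that $\partial^2_{\xi\xi}\omega(0,t)=-\infty$ for all $t\ge 0$. Assume that $\theta_0$ obeys $\omega(\cdot,0)$. Suppose further that $$\partial_t\omega(\xi,t)>\Omega_{\omega}(\xi,t)\,\partial_\xi\omega(\xi,t)+D_{\alpha,\omega}(\xi,t)$$ for all $\xi,t>0$ such that $\omega(\xi,t)\le 2\|\theta(\cdot,t)\|_{L^\infty}$, where at points at which $\partial_\xi\omega(\xi,t)$ does not exist the larger of the one-sided derivatives is taken, and at points at which $\partial_t\omega(\xi,t)$ does not exist the smaller of the one-sided derivatives is taken. Then $\theta(\cdot,t)$ obeys the modulus of continuity $\omega(\cdot,t)$ for all $t>0$.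
   Context: A modulus of continuity is a function $\omega:\mathbb{R}^+\to\mathbb{R}^+$ with $\omega(0)=0$ that is continuous, increasing, concave, and piecewise $C^1$ on $(0,\infty)$ (its derivative is continuous except perhaps at finitely many points, where one-sided derivatives exist but may differ). A function $f$ obeys $\omega$ if $|f(x)-f(y)|<\omega(|x-y|)$ for all $x\ne y$. The condition $\partial^2_{\xi\xi}\omega(0,t)=-\infty$ means that $\partial^2_{\xi\xi}\omega(\xi,t)\to-\infty$ as $\xi\to0^+$. Velocity: $u=u[\theta]$ is a (periodic, $\mathbb{R}^d$-valued) vector field determined by $\theta$ at the same time. $\Omega_\omega$ denotes a function, depending on $\omega$, such that whenever $\theta$ is a smooth periodic function with $|\theta(x)-\theta(y)|\le\omega(|x-y|)$ for all $x,y$, one has $|u(x)-u(y)|\le\Omega_\omega(|x-y|)$ for all $x,y$. For time dependent $\omega$, $\Omega_\omega(\xi,t)$ is $\Omega_{\omega(\cdot,t)}(\xi)$. Dissipation term: $D_{\alpha,\omega}(\xi,t)$ is, for $\omega=\omega(\cdot,t)$, $$D_{\alpha,\omega}(\xi)=c_\alpha\left(\int_0^{\xi/2}\frac{\omega(\xi+2\eta)+\omega(\xi-2\eta)-2\omega(\xi)}{\eta^{1+2\alpha}}\,d\eta+\int_{\xi/2}^\infty\frac{\omega(2\eta+\xi)-\omega(2\eta-\xi)-2\omega(\xi)}{\eta^{1+2\alpha}}\,d\eta\right),$$ where both integrands are nonpositive by concavity (the value $-\infty$ is allowed). Here $0<c_\alpha<1$ is a fixed constant such that the kernel $\Phi^\alpha_{1,t}$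 of $e^{-t(-\Delta)^\alpha}$ on $\mathbb{R}$ satisfies $c_\alpha\min\left(t^{-1/(2\alpha)},\,t|x|^{-1-2\alpha}\right)\le\Phi^\alpha_{1,t}(x)\le c_\alpha^{-1}\min\left(t^{-1/(2\alpha)},\,t|x|^{-1-2\alpha}\right)$ for all $x\in\mathbb{R}$, $t>0$. *)

theory Defs
  imports "HOL-Analysis.Analysis" "HOL-Probability.Essential_Supremum"
begin

section \<open>Smooth and periodic functions\<close>

text \<open>
  Derivatives are taken within \<open>S\<close>, so that on \<open>UNIV \<times> {0..}\<close> the
  predicate \<open>smooth_on\<close> means smoothness up to and including the boundary.
\<close>

primrec Ck_on :: "nat \<Rightarrow> 'a::euclidean_space set \<Rightarrow> ('a \<Rightarrow> 'b::real_normed_vector) \<Rightarrow> bool" where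
  "Ck_on 0 S f \<longleftrightarrow> continuous_on S f"
| "Ck_on (Suc k) S f \<longleftrightarrow>
     (\<exists>f'. (\<forall>x\<in>S. (f has_derivative f' x) (at x within S)) \<and> (\<forall>v. Ck_on k S (\<lambda>x. f' x v)))"

definition smooth_on :: "'a::euclidean_space set \<Rightarrow> ('a \<Rightarrow> 'b::real_normed_vector) \<Rightarrow> bool" where
  "smooth_on S f \<longleftrightarrow> (\<forall>k. Ck_on k S f)"

text \<open>The columns of the (invertible) matrix \<open>P\<close> generate the lattice of periods.\<close>

definition periodic :: "real^'n^'n \<Rightarrow> (real^'n \<Rightarrow> 'b) \<Rightarrow> bool" where
  "periodic P f \<longleftrightarrow> (\<forall>x i. f (x + column i P) = f x)"


section \<open>The fractional Laplacian as a Fourier multiplier\<close>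

definition wave_vectors :: "real^'n^'n \<Rightarrow> (real^'n) set" where
  "wave_vectors P = {k. \<forall>i. k \<bullet> column i P / (2 * pi) \<in> \<int>}"

text \<open>The mean value of \<open>f(x) exp (-i k \<cdot> x)\<close> over the period cell \<open>P [0,1]\<^sup>d\<close>.\<close>

definition fourier_coeff :: "real^'n^'n \<Rightarrow> (real^'n \<Rightarrow> real) \<Rightarrow> real^'n \<Rightarrow> complex" where
  "fourier_coeff P f k =
     (LINT y:cbox 0 1|lborel. complex_of_real (f (P *v y)) * cis (- (k \<bullet> (P *v y))))"

text \<open>
  For smooth periodic \<open>f\<close> this is the sum of the Fourier series with coefficients
  \<open>|k|\<^bsup>2\<alpha>\<^esup> f\<^sub>k\<close>, \<open>f\<^sub>k\<close> being the coefficients of \<open>f\<close>;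
  a continuous periodic function is determined by its Fourier coefficients.
\<close>

definition frac_laplacian :: "real^'n^'n \<Rightarrow> real \<Rightarrow> (real^'n \<Rightarrow> real) \<Rightarrow> real^'n \<Rightarrow> real" where
  "frac_laplacian P \<alpha> f =
     (THE g. continuous_on UNIV g \<and> periodic P g \<and>
        (\<forall>k\<in>wave_vectors P.
           fourier_coeff P g k = complex_of_real (norm k powr (2 * \<alpha>)) * fourier_coeff P f k))"

text \<open>
  The convolution kernel of \<open>exp (- t (-\<Delta>)\<^sup>\<alpha>)\<close> on the real line: the inverse
  Fourier transform of the even function \<open>exp (- t |k|\<^bsup>2\<alpha>\<^esup>)\<close>.
\<close>

definition frac_heat_kernel :: "real \<Rightarrow> real \<Rightarrow> real \<Rightarrow> real" where
  "frac_heat_kernel \<alpha> t x =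
     1 / (2 * pi) * (LINT k|lborel. exp (- t * \<bar>k\<bar> powr (2 * \<alpha>)) * cos (k * x))"

text \<open>
  At \<open>x = 0\<close> the term \<open>t |x|\<^bsup>-1-2\<alpha>\<^esup>\<close> is \<open>+\<infinity>\<close>, whereas
  \<open>0 powr a = 0\<close>; hence the case distinction.
\<close>

definition kernel_profile :: "real \<Rightarrow> real \<Rightarrow> real \<Rightarrow> real" where
  "kernel_profile \<alpha> t x =
     (if x = 0 then t powr (- 1 / (2 * \<alpha>))
      else min (t powr (- 1 / (2 * \<alpha>))) (t * \<bar>x\<bar> powr (- 1 - 2 * \<alpha>)))"

definition kernel_constant :: "real \<Rightarrow> real \<Rightarrow> bool" where
  "kernel_constant \<alpha> c \<longleftrightarrow> 0 < c \<and> c < 1 \<and>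
     (\<forall>t>0. \<forall>x. c * kernel_profile \<alpha> t x \<le> frac_heat_kernel \<alpha> t x \<and>
                 frac_heat_kernel \<alpha> t x \<le> inverse c * kernel_profile \<alpha> t x)"


section \<open>Moduli of continuity\<close>

definition piecewise_C1_pos :: "(real \<Rightarrow> real) \<Rightarrow> bool" where
  "piecewise_C1_pos f \<longleftrightarrow> f piecewise_C1_differentiable_on {0<..} \<and>
     (\<forall>x>0. f differentiable (at_left x) \<and> f differentiable (at_right x))"

text \<open>Functions on the half-line are total functions whose values at negative arguments are irrelevant.\<close>

definition modulus_of_continuity :: "(real \<Rightarrow> real) \<Rightarrow> bool" where
  "modulus_of_continuity w \<longleftrightarrow> w 0 = 0 \<and> (\<forall>\<xi>\<ge>0. 0 \<le> w \<xi>) \<and>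
     continuous_on {0..} w \<and> mono_on {0..} w \<and> concave_on {0..} w \<and> piecewise_C1_pos w"

definition obeys :: "('a::real_normed_vector \<Rightarrow> real) \<Rightarrow> (real \<Rightarrow> real) \<Rightarrow> bool" where
  "obeys f w \<longleftrightarrow> (\<forall>x y. x \<noteq> y \<longrightarrow> \<bar>f x - f y\<bar> < w (norm (x - y)))"

definition second_deriv_minus_infinity :: "(real \<Rightarrow> real) \<Rightarrow> bool" where
  "second_deriv_minus_infinity w \<longleftrightarrow>
     (\<forall>\<^sub>F \<xi> in at_right 0. w differentiable (at \<xi>) \<and> deriv w differentiable (at \<xi>)) \<and>
     filterlim (\<lambda>\<xi>. deriv (deriv w) \<xi>) at_bot (at_right 0)"

definition left_deriv :: "(real \<Rightarrow> real) \<Rightarrow> real \<Rightarrow> real" where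
  "left_deriv f x = (THE D. (f has_real_derivative D) (at_left x))"

definition right_deriv :: "(real \<Rightarrow> real) \<Rightarrow> real \<Rightarrow> real" where
  "right_deriv f x = (THE D. (f has_real_derivative D) (at_right x))"

text \<open>Both of the following are the ordinary derivative wherever that exists.\<close>

definition larger_deriv :: "(real \<Rightarrow> real) \<Rightarrow> real \<Rightarrow> real" where
  "larger_deriv f x = max (left_deriv f x) (right_deriv f x)"

definition smaller_deriv :: "(real \<Rightarrow> real) \<Rightarrow> real \<Rightarrow> real" where
  "smaller_deriv f x = min (left_deriv f x) (right_deriv f x)"

text \<open>\<open>\<Omega>\<close> controls the velocities \<open>U f\<close> of all \<open>f\<close> that satisfy the modulus \<open>w\<close> non-strictly.\<close>

definition velocity_modulus ::
  "real^'n^'n \<Rightarrow> ((real^'n \<Rightarrow> real) \<Rightarrow> real^'n \<Rightarrow> real^'n) \<Rightarrow> (real \<Rightarrow> real) \<Rightarrow> (real \<Rightarrow> real) \<Rightarrow> bool" where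
  "velocity_modulus P U w \<Omega> \<longleftrightarrow>
     (\<forall>f. smooth_on UNIV f \<longrightarrow> periodic P f \<longrightarrow>
        (\<forall>x y. \<bar>f x - f y\<bar> \<le> w (norm (x - y))) \<longrightarrow>
        (\<forall>x y. norm (U f x - U f y) \<le> \<Omega> (norm (x - y))))"

text \<open>
  For a modulus of continuity both integrands of the dissipation term are nonpositive, by concavity.
  Each integral is therefore minus the nonnegative Lebesgue integral of the negated integrand, and
  may be \<open>-\<infinity>\<close>.
\<close>

definition dissipation :: "real \<Rightarrow> real \<Rightarrow> (real \<Rightarrow> real) \<Rightarrow> real \<Rightarrow> ereal" where
  "dissipation \<alpha> c w \<xi> =
     - (ereal c * enn2ereal
         ((\<integral>\<^sup>+\<eta>\<in>{0..\<xi>/2}.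
             ennreal (- ((w (\<xi> + 2 * \<eta>) + w (\<xi> - 2 * \<eta>) - 2 * w \<xi>) / \<eta> powr (1 + 2 * \<alpha>))) \<partial>lborel) +
          (\<integral>\<^sup>+\<eta>\<in>{\<xi>/2..}.
             ennreal (- ((w (2 * \<eta> + \<xi>) - w (2 * \<eta> - \<xi>) - 2 * w \<xi>) / \<eta> powr (1 + 2 * \<alpha>))) \<partial>lborel)))"

end

theory Submission
  imports Defs "HOL-Probability.Probability" "HOL-Real_Asymp.Real_Asymp"
begin

text \<open>
  At the first time \<open>t\<^sub>1\<close> at which the modulus fails there are points \<open>x \<noteq> y\<close> with
  \<open>\<theta>(x) - \<theta>(y) = \<omega>(\<xi>)\<close>, \<open>\<xi> = |x - y|\<close>: large \<open>\<xi>\<close> is excluded by periodicity, and \<open>\<xi> \<rightarrow> 0\<close> because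
  \<open>\<omega>''(0) = -\<infinity>\<close> keeps \<open>|\<nabla>\<theta>|\<close> strictly below \<open>\<omega>'(0)\<close>. There the time derivative of
  \<open>\<theta>(x) - \<theta>(y)\<close> is at least \<open>\<partial>\<^sub>t\<omega>\<close>, while the advective part is at most \<open>\<Omega> \<partial>\<^sub>\<xi>\<omega>\<close> and the
  dissipative part at most \<open>D\<close>, which contradicts the hypothesis.

  For the dissipative part, \<open>(-\<Delta>)\<^sup>\<alpha>\<close> is written as the singular integral with the Levy kernel
  \<open>|z|\<^bsup>-d-2\<alpha>\<^esup>\<close>, normalised so that its one-dimensional marginal is \<open>|\<eta>|\<^bsup>-1-2\<alpha>\<^esup> / A\<close> with
  \<open>A = \<integral> (1 - cos x) |x|\<^bsup>-1-2\<alpha>\<^esup> dx\<close>. A coupling of the jumps from \<open>x\<close> and \<open>y\<close> bounds it by the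
  integrals in \<open>D\<close> with the constant \<open>1/A\<close>, and the lower bound on the heat kernel gives \<open>c \<le> 1/A\<close>.
\<close>

section \<open>The constant of the heat kernel bound\<close>

text \<open>The equation contains the exactly normalised operator, whereas
  \<open>dissipation\<close> contains a constant \<open>c\<close> known only through a heat kernel
  bound. The comparison \<open>c <= 1/A\<close> goes the useful way: both integrals in D are
  nonpositive, so a smaller constant only weakens the estimate. It arises because
  \<open>1 - cos x\<close> integrated against the heat kernel is formally
  \<open>1 - exp (-t)\<close>; after division by \<open>t\<close> the lower bound of the kernel
  becomes the one-dimensional jump density as \<open>t\<close> tends to 0. The normalisation of the
  kernel in dimension d is never computed. Its marginal constant \<open>B\<close> occurs both in the
  Fourier symbol and in the reduction of the coupling to one variable, and cancels. Since
  \<open>frac_laplacian\<close> is a definite description by Fourier coefficients, the passage to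
  the singular integral rests on uniqueness of Fourier coefficients for continuous functions with an
  arbitrary period lattice. Two further obstacles are that the integrals in D might diverge and that
  the modulus might be unbounded. The first is excluded by the coupling inequality itself, the
  second by truncating at the oscillation of the solution.\<close>

text \<open>Fatou's lemma with bounds that depend on the index; it serves limits in which only lower
  bounds of the integrands are under control.\<close>

lemma nn_integral_le_tendsto:
  fixes f :: "nat \<Rightarrow> 'a \<Rightarrow> ennreal"
  assumes [measurable]: "\<And>j. f j \<in> borel_measurable M"
    and lim: "AE x in M. (\<lambda>j. f j x) \<longlonglongrightarrow> g x"
    and le: "\<And>j. (\<integral>\<^sup>+x. f j x \<partial>M) \<le> b j" and b: "b \<longlonglongrightarrow> L"
  shows "(\<integral>\<^sup>+x. g x \<partial>M) \<le> L"
proof -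
  have "(\<integral>\<^sup>+x. g x \<partial>M) = (\<integral>\<^sup>+x. liminf (\<lambda>j. f j x) \<partial>M)"
    using lim by (intro nn_integral_cong_AE) (auto intro!: lim_imp_Liminf[symmetric])
  also have "\<dots> \<le> liminf (\<lambda>j. \<integral>\<^sup>+x. f j x \<partial>M)"
    by (rule nn_integral_liminf) measurable
  also have "\<dots> \<le> liminf b" using le by (intro Liminf_mono) auto
  also have "\<dots> = L" using b by (intro lim_imp_Liminf) auto
  finally show ?thesis .
qed

lemma integrable_gaussian: 
  assumes "0 < s" shows "integrable lborel (\<lambda>x::real. exp (- (s * x)\<^sup>2 / 2))"
proof -
  have "integrable lborel (\<lambda>x. sqrt (2 * pi) * std_normal_density x)"
    by (intro integrable_mult_right) simp
  then have "integrable lborel (\<lambda>x::real. exp (- x\<^sup>2 / 2))"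
    by (simp add: std_normal_density_def)
  from lborel_integrable_real_affine[OF this, of s 0] assms show ?thesis by simp
qed

text \<open>The Fourier transform of a Gaussian, read off from the characteristic function of the
  normal law. The result is kept as a normal density in \<open>k\<close>, since it will act as an
  approximate identity.\<close>

lemma gaussian_cos_integral:
  assumes "0 < s"
  shows "(LINT x|lborel. cos (k * x) * exp (- (s * x)\<^sup>2 / 2)) = 2 * pi / s * std_normal_density (k / s)"
proof -
  have std: "(LINT x|lborel. std_normal_density x * cos (u * x)) = exp (- u\<^sup>2 / 2)" for u
  proof -
    have "complex_of_real (exp (- (u^2) / 2)) = char std_normal_distribution u"
      by (simp add: char_std_normal_distribution)
    also have "\<dots> = (LINT x|lborel. std_normal_density x *\<^sub>R iexp (u * x))"
      unfolding char_def by (subst integral_density) (auto simp: normal_density_nonneg)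
    finally have "Re (complex_of_real (exp (- (u^2) / 2))) = Re (LINT x|lborel. std_normal_density x *\<^sub>R iexp (u * x))"
      by simp
    also have "\<dots> = (LINT x|lborel. Re (std_normal_density x *\<^sub>R iexp (u * x)))"
    proof (rule integral_Re[symmetric])
      show "integrable lborel (\<lambda>x. std_normal_density x *\<^sub>R iexp (u * x))"
        by (rule Bochner_Integration.integrable_bound[of _ std_normal_density])
           (auto simp: normal_density_nonneg)
    qed
    finally show ?thesis by (simp add: Re_exp)
  qed
  have "(LINT x|lborel. cos (k * x) * exp (- (s * x)\<^sup>2 / 2))
      = \<bar>1 / s\<bar> *\<^sub>R (LINT x|lborel. cos (k * (0 + 1 / s * x)) * exp (- (s * (0 + 1 / s * x))\<^sup>2 / 2))"
    using assms by (intro lborel_integral_real_affine) auto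
  also have "\<dots> = 1 / s * (LINT x|lborel. sqrt (2 * pi) * (std_normal_density x * cos (k / s * x)))"
    using assms by (simp add: std_normal_density_def mult_ac)
  also have "\<dots> = 1 / s * (sqrt (2 * pi) * exp (- (k / s)\<^sup>2 / 2))"
    by (subst integral_mult_right_zero) (simp only: std)
  also have "\<dots> = 2 * pi / s * std_normal_density (k / s)"
    using real_sqrt_mult_self[of "2 * pi"] assms
    by (simp add: std_normal_density_def field_simps del: real_sqrt_mult_self)
  finally show ?thesis .
qed

lemma integrable_gaussian_mult_bounded:
  fixes f :: "real \<Rightarrow> real"
  assumes "0 < s" and [measurable]: "f \<in> borel_measurable borel" and "\<And>x. \<bar>f x\<bar> \<le> C"
  shows "integrable lborel (\<lambda>x. f x * exp (- (s * x)\<^sup>2 / 2))"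
proof (rule Bochner_Integration.integrable_bound)
  show "integrable lborel (\<lambda>x. C * exp (- (s * x)\<^sup>2 / 2))"
    by (intro integrable_mult_right integrable_gaussian assms)
  show "AE x in lborel. norm (f x * exp (- (s * x)\<^sup>2 / 2)) \<le> norm (C * exp (- (s * x)\<^sup>2 / 2))"
  proof (intro always_eventually allI)
    fix x
    have "0 \<le> C" using assms(3)[of 0] by linarith
    then show "norm (f x * exp (- (s * x)\<^sup>2 / 2)) \<le> norm (C * exp (- (s * x)\<^sup>2 / 2))"
      using assms(3)[of x] by (simp add: abs_mult mult_right_mono)
  qed
qed measurable

text \<open>Formally, for \<open>s = 0\<close>, this is Fourier inversion: the right-hand side
  becomes the symbol at 0 minus half its values at 1 and -1. The Gaussian factor makes the double
  integral absolutely convergent, so that Fubini applies, and the point values turn into Gaussian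
  averages of width \<open>s\<close>.\<close>

lemma frac_heat_kernel_gaussian_identity:
  assumes t: "0 < t" and int: "integrable lborel (\<lambda>k. exp (- t * \<bar>k\<bar> powr (2 * \<alpha>)))" and s: "0 < s"
  defines "\<phi> k \<equiv> exp (- t * \<bar>k\<bar> powr (2 * \<alpha>))"
  shows "integrable lborel (\<lambda>x. (1 - cos x) * exp (- (s * x)\<^sup>2 / 2) * frac_heat_kernel \<alpha> t x)" (is ?I)
    and "(LINT x|lborel. (1 - cos x) * exp (- (s * x)\<^sup>2 / 2) * frac_heat_kernel \<alpha> t x)
       = (LINT u|lborel. std_normal_density u * \<phi> (s * u))
         - (LINT u|lborel. std_normal_density u * \<phi> (s * u - 1)) / 2
         - (LINT u|lborel. std_normal_density u * \<phi> (s * u + 1)) / 2" (is "?L = ?R")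
proof -
  let ?g = "\<lambda>x::real. exp (- (s * x)\<^sup>2 / 2)"
  let ?W = "\<lambda>x. (1 - cos x) * ?g x"
  let ?n = std_normal_density
  have \<phi>int: "integrable lborel \<phi>" using int by (simp add: \<phi>_def[abs_def])
  have [measurable]: "\<phi> \<in> borel_measurable borel" unfolding \<phi>_def[abs_def] by measurable
  have W: "integrable lborel ?W"
    by (rule integrable_gaussian_mult_bounded[OF s, of _ 2]) (auto simp: abs_le_iff cos_ge_minus_one intro: order_trans[OF _ cos_ge_minus_one])
  have \<phi>pos: "0 < \<phi> k" for k by (simp add: \<phi>_def)
  let ?F = "\<lambda>(x, k). ?W x * (\<phi> k * cos (k * x))"
  have F1: "integrable lborel (\<lambda>k. ?W x * (\<phi> k * cos (k * x)))" for x
    by (rule Bochner_Integration.integrable_bound[OF integrable_mult_right[OF \<phi>int, of "?W x"]])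
       (auto simp: abs_mult intro!: mult_left_mono mult_left_le)
  have F: "integrable (lborel \<Otimes>\<^sub>M lborel) ?F"
  proof (rule lborel_pair.Fubini_integrable)
    show "AE x in lborel. integrable lborel (\<lambda>y. ?F (x, y))" using F1 by simp
    show "integrable lborel (\<lambda>x. LINT y|lborel. norm (?F (x, y)))"
    proof (rule Bochner_Integration.integrable_bound[OF integrable_mult_left[OF W, of "LINT k|lborel. \<phi> k"]])
      show "AE x in lborel. norm (LINT y|lborel. norm (?F (x, y))) \<le> norm (?W x * (LINT k|lborel. \<phi> k))"
      proof (intro always_eventually allI)
        fix x
        have "(LINT y|lborel. norm (?F (x, y))) \<le> (LINT k|lborel. ?W x * \<phi> k)"
        proof (rule integral_mono)
          show "integrable lborel (\<lambda>y. norm (?F (x, y)))"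
            using F1[of x] by (intro integrable_norm) simp
          show "norm (?F (x, k)) \<le> ?W x * \<phi> k" for k
            using \<phi>pos[of k] by (auto simp: abs_mult intro!: mult_left_mono mult_left_le)
        qed (intro integrable_mult_right \<phi>int)
        then show "norm (LINT y|lborel. norm (?F (x, y))) \<le> norm (?W x * (LINT k|lborel. \<phi> k))"
          by (simp add: abs_of_nonneg integral_nonneg_AE less_imp_le[OF \<phi>pos])
      qed
    qed measurable
  qed measurable
  have K: "?W x * frac_heat_kernel \<alpha> t x = 1 / (2 * pi) * (LINT k|lborel. ?F (x, k))" for x
    unfolding frac_heat_kernel_def \<phi>_def[symmetric] by simp
  show ?I unfolding K
    by (intro integrable_mult_right) (rule lborel_pair.integrable_fst'[OF F])
  \<comment> \<open>The product \<open>(1 - cos x) * cos (k * x)\<close> splits into cosines of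
    frequency \<open>k\<close>, \<open>k + 1\<close> and \<open>k - 1\<close>; this is the origin of
    the three averages.\<close>
  have inner: "(LINT x|lborel. ?F (x, k)) = \<phi> k * (2 * pi / s * (?n (k / s) - ?n ((k + 1) / s) / 2 - ?n ((k - 1) / s) / 2))" for k
  proof -
    have c: "integrable lborel (\<lambda>x. cos (m * x) * ?g x)" for m
      by (rule integrable_gaussian_mult_bounded[OF s, of _ 1]) auto
    have "(LINT x|lborel. ?F (x, k)) = (LINT x|lborel. \<phi> k * (cos (k * x) * ?g x - 1/2 * (cos ((k + 1) * x) * ?g x) - 1/2 * (cos ((k - 1) * x) * ?g x)))"
      by (intro Bochner_Integration.integral_cong refl) (simp add: algebra_simps cos_add cos_diff)
    also have "\<dots> = \<phi> k * (2 * pi / s * ?n (k / s) - 1/2 * (2 * pi / s * ?n ((k + 1) / s)) - 1/2 * (2 * pi / s * ?n ((k - 1) / s)))"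
      using c by (subst integral_mult_right_zero) (simp only: Bochner_Integration.integral_diff Bochner_Integration.integrable_diff
         integrable_mult_right integral_mult_right_zero gaussian_cos_integral[OF s])
    finally show ?thesis by (simp add: algebra_simps)
  qed
  have n_int: "integrable lborel (\<lambda>u. ?n u * \<phi> (s * u + a))" for a
    by (rule Bochner_Integration.integrable_bound[of _ ?n])
       (use t in \<open>auto simp: \<phi>_def abs_mult normal_density_nonneg intro!: mult_left_le\<close>)
  have shift_int: "integrable lborel (\<lambda>k. \<phi> k * ?n ((k - a) / s))"
    and shift: "(LINT k|lborel. \<phi> k * ?n ((k - a) / s)) = s * (LINT u|lborel. ?n u * \<phi> (s * u + a))" for a
  proof -
    have eq: "(\<lambda>u. \<phi> (a + s * u) * ?n (((a + s * u) - a) / s)) = (\<lambda>u. ?n u * \<phi> (s * u + a))"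
      using s by (simp add: mult.commute add.commute)
    show "integrable lborel (\<lambda>k. \<phi> k * ?n ((k - a) / s))"
      using lborel_integrable_real_affine_iff[of s "\<lambda>k. \<phi> k * ?n ((k - a) / s)" a] n_int[of a] eq s by simp
    show "(LINT k|lborel. \<phi> k * ?n ((k - a) / s)) = s * (LINT u|lborel. ?n u * \<phi> (s * u + a))"
      using lborel_integral_real_affine[of s "\<lambda>k. \<phi> k * ?n ((k - a) / s)" a] eq s by simp
  qed
  have "?L = 1 / (2 * pi) * (LINT x|lborel. LINT k|lborel. ?F (x, k))"
    unfolding K by (rule integral_mult_right_zero)
  also have "(LINT x|lborel. LINT k|lborel. ?F (x, k)) = (LINT k|lborel. LINT x|lborel. ?F (x, k))"
    using lborel_pair.Fubini_integral[OF F] by simp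
  also have "\<dots> = (LINT k|lborel. 2 * pi / s * (\<phi> k * ?n ((k - 0) / s) - 1/2 * (\<phi> k * ?n ((k - -1) / s)) - 1/2 * (\<phi> k * ?n ((k - 1) / s))))"
    unfolding inner by (intro Bochner_Integration.integral_cong refl) (simp add: algebra_simps)
  also have "\<dots> = 2 * pi / s * (s * (LINT u|lborel. ?n u * \<phi> (s * u + 0)) - 1/2 * (s * (LINT u|lborel. ?n u * \<phi> (s * u + -1))) - 1/2 * (s * (LINT u|lborel. ?n u * \<phi> (s * u + 1))))"
    using shift_int by (subst integral_mult_right_zero) (simp only: Bochner_Integration.integral_diff Bochner_Integration.integrable_diff
         integrable_mult_right integral_mult_right_zero shift)
  also have "1 / (2 * pi) * (2 * pi / s * (s * p - 1/2 * (s * q) - 1/2 * (s * r))) = p - q / 2 - r / 2" for p q r :: real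
    using s by (simp add: field_simps)
  finally show "?L = ?R" by simp
qed

lemma kernel_profile_nonneg: "t > 0 \<Longrightarrow> 0 \<le> kernel_profile \<alpha> t x"
  by (simp add: kernel_profile_def)

lemma kernel_profile_measurable [measurable]: "kernel_profile \<alpha> t \<in> borel_measurable borel"
  unfolding kernel_profile_def[abs_def] by measurable

text \<open>The damping is removed by letting \<open>s\<close> tend to 0. Fatou suffices because the
  kernel is replaced by its nonnegative lower bound before the limit.\<close>

lemma kernel_profile_cos_bound:
  assumes c: "kernel_constant \<alpha> c" and t: "0 < t"
  shows "(\<integral>\<^sup>+x. ennreal ((1 - cos x) * (c * kernel_profile \<alpha> t x)) \<partial>lborel) \<le> ennreal (1 - exp (- t))"
proof -
  define \<phi> where "\<phi> k = exp (- t * \<bar>k\<bar> powr (2 * \<alpha>))" for k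
  let ?n = std_normal_density
  have [measurable]: "\<phi> \<in> borel_measurable borel" unfolding \<phi>_def[abs_def] by measurable
  have cpos: "0 < c" and low: "\<And>x. c * kernel_profile \<alpha> t x \<le> frac_heat_kernel \<alpha> t x"
    using c t by (auto simp: kernel_constant_def)
  \<comment> \<open>The integral of a non-integrable function is 0 by convention, so positivity of
    the heat kernel at 0 forces the symbol to be integrable.\<close>
  have "0 < c * kernel_profile \<alpha> t 0" using cpos t by (simp add: kernel_profile_def)
  also have "\<dots> \<le> frac_heat_kernel \<alpha> t 0" by (rule low)
  finally have "(LINT k|lborel. \<phi> k) \<noteq> 0" by (auto simp: frac_heat_kernel_def \<phi>_def)
  then have int: "integrable lborel (\<lambda>k. exp (- t * \<bar>k\<bar> powr (2 * \<alpha>)))"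
    unfolding \<phi>_def using not_integrable_integral_eq by blast
  define s where "s j = 1 / real (Suc j)" for j
  have s: "0 < s j" for j by (simp add: s_def)
  have s0: "s \<longlonglongrightarrow> 0" unfolding s_def by (rule LIMSEQ_Suc[OF lim_1_over_n])
  \<comment> \<open>The average of the symbol around 0 is replaced by its upper bound 1; limits are
    then taken only at 1 and -1, where the symbol is continuous.\<close>
  define b where "b j = 1 - (LINT u|lborel. ?n u * \<phi> (s j * u - 1)) / 2 - (LINT u|lborel. ?n u * \<phi> (s j * u + 1)) / 2" for j
  have \<phi>cont: "isCont \<phi> a" if "a \<noteq> 0" for a
    unfolding \<phi>_def[abs_def] using that by (intro continuous_intros) auto
  have lim: "(\<lambda>j. LINT u|lborel. ?n u * \<phi> (s j * u + a)) \<longlonglongrightarrow> \<phi> a" if a: "a \<noteq> 0" for a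
  proof -
    have "(\<lambda>j. LINT u|lborel. ?n u * \<phi> (s j * u + a)) \<longlonglongrightarrow> (LINT u|lborel. ?n u * \<phi> a)"
    proof (rule integral_dominated_convergence[where w = ?n])
      show "AE u in lborel. (\<lambda>j. ?n u * \<phi> (s j * u + a)) \<longlonglongrightarrow> ?n u * \<phi> a"
      proof (intro always_eventually allI tendsto_mult tendsto_const)
        fix u
        have "(\<lambda>j. s j * u + a) \<longlonglongrightarrow> 0 * u + a" by (intro tendsto_intros s0)
        then show "(\<lambda>j. \<phi> (s j * u + a)) \<longlonglongrightarrow> \<phi> a"
          using isCont_tendsto_compose[OF \<phi>cont[OF a]] by simp
      qed
      show "AE u in lborel. norm (?n u * \<phi> (s j * u + a)) \<le> ?n u" for j
        using t by (auto simp: \<phi>_def abs_mult normal_density_nonneg intro!: mult_left_le)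
    qed auto
    then show ?thesis by simp
  qed
  have \<phi>1: "\<phi> 1 = exp (- t)" "\<phi> (-1) = exp (- t)" by (auto simp: \<phi>_def)
  have "b \<longlonglongrightarrow> 1 - \<phi> (-1) / 2 - \<phi> 1 / 2"
    unfolding b_def using lim[of 1] lim[of "-1"] by (intro tendsto_intros) auto
  then have b: "b \<longlonglongrightarrow> 1 - exp (- t)" by (simp add: \<phi>1)
  show ?thesis
  proof (rule nn_integral_le_tendsto[where b = "\<lambda>j. ennreal (b j)"
        and f = "\<lambda>j x. ennreal ((1 - cos x) * exp (- (s j * x)\<^sup>2 / 2) * (c * kernel_profile \<alpha> t x))"])
    show "(\<lambda>j. ennreal (b j)) \<longlonglongrightarrow> ennreal (1 - exp (- t))" using b by (rule tendsto_ennrealI)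
    show "AE x in lborel. (\<lambda>j. ennreal ((1 - cos x) * exp (- (s j * x)\<^sup>2 / 2) * (c * kernel_profile \<alpha> t x)))
            \<longlonglongrightarrow> ennreal ((1 - cos x) * (c * kernel_profile \<alpha> t x))"
    proof (intro always_eventually allI tendsto_ennrealI)
      fix x
      have "(\<lambda>j. (1 - cos x) * exp (- (s j * x)\<^sup>2 / 2) * (c * kernel_profile \<alpha> t x))
           \<longlonglongrightarrow> (1 - cos x) * exp (- (0 * x)\<^sup>2 / 2) * (c * kernel_profile \<alpha> t x)"
        by (intro tendsto_intros s0) auto
      then show "(\<lambda>j. (1 - cos x) * exp (- (s j * x)\<^sup>2 / 2) * (c * kernel_profile \<alpha> t x))
           \<longlonglongrightarrow> (1 - cos x) * (c * kernel_profile \<alpha> t x)" by simp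
    qed
    fix j
    note id = frac_heat_kernel_gaussian_identity[OF t int s[of j], folded \<phi>_def]
    have Kpos: "0 \<le> frac_heat_kernel \<alpha> t x" for x
      using low[of x] kernel_profile_nonneg[OF t, of \<alpha> x] cpos by (meson mult_nonneg_nonneg less_imp_le order_trans)
    have "(\<integral>\<^sup>+x. ennreal ((1 - cos x) * exp (- (s j * x)\<^sup>2 / 2) * (c * kernel_profile \<alpha> t x)) \<partial>lborel)
        \<le> (\<integral>\<^sup>+x. ennreal ((1 - cos x) * exp (- (s j * x)\<^sup>2 / 2) * frac_heat_kernel \<alpha> t x) \<partial>lborel)"
      by (intro nn_integral_mono ennreal_leI mult_left_mono low) auto
    also have "\<dots> = ennreal (LINT x|lborel. (1 - cos x) * exp (- (s j * x)\<^sup>2 / 2) * frac_heat_kernel \<alpha> t x)"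
      using Kpos by (intro nn_integral_eq_integral id(1)) (auto intro!: mult_nonneg_nonneg)
    also have "\<dots> \<le> ennreal (b j)"
    proof (rule ennreal_leI)
      have "(LINT u|lborel. ?n u * \<phi> (s j * u)) \<le> (LINT u|lborel. ?n u)"
      proof (rule integral_mono)
        show "integrable lborel (\<lambda>u. ?n u * \<phi> (s j * u))"
          by (rule Bochner_Integration.integrable_bound[of _ ?n])
             (use t in \<open>auto simp: \<phi>_def abs_mult normal_density_nonneg intro!: mult_left_le\<close>)
      qed (use t in \<open>auto simp: \<phi>_def normal_density_nonneg intro!: mult_left_le\<close>)
      then show "(LINT x|lborel. (1 - cos x) * exp (- (s j * x)\<^sup>2 / 2) * frac_heat_kernel \<alpha> t x) \<le> b j"
        unfolding id(2) b_def by simp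
    qed
    finally show "(\<integral>\<^sup>+x. ennreal ((1 - cos x) * exp (- (s j * x)\<^sup>2 / 2) * (c * kernel_profile \<alpha> t x)) \<partial>lborel) \<le> ennreal (b j)" .
  qed auto
qed

text \<open>Divide the previous bound by \<open>t\<close> and let \<open>t\<close> tend to 0. At a
  fixed \<open>x\<close> other than 0 the branch \<open>t powr (- 1 / (2 * \<alpha>))\<close>
  eventually exceeds the other one, so the profile divided by \<open>t\<close> equals the jump
  density; on the right, \<open>(1 - exp (- t)) / t\<close> is at most 1.\<close>

proposition kernel_constant_le:
  assumes \<alpha>: "0 < \<alpha>" and c: "kernel_constant \<alpha> c"
  shows "ennreal c * (\<integral>\<^sup>+x. ennreal (1 - cos x) * ennreal (\<bar>x\<bar> powr (- (1 + 2 * \<alpha>))) \<partial>lborel) \<le> 1"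
proof -
  have cpos: "0 < c" using c by (simp add: kernel_constant_def)
  define t where "t j = 1 / real (Suc j)" for j
  have t: "0 < t j" for j by (simp add: t_def)
  have t0: "t \<longlonglongrightarrow> 0" unfolding t_def by (rule LIMSEQ_Suc[OF lim_1_over_n])
  have tr: "filterlim t (at_right 0) sequentially"
    using t0 t by (auto simp: filterlim_at intro!: always_eventually less_imp_neq[symmetric])
  have big: "filterlim (\<lambda>j. t j powr (- 1 / (2 * \<alpha>)) / t j) at_top sequentially"
  proof -
    define q where "q = 1 / (2 * \<alpha>) + 1"
    have "q > 0" using \<alpha> by (simp add: q_def add_pos_pos)
    then have "filterlim (\<lambda>s. s powr (- q)) at_top (at_right (0::real))"
      by real_asymp
    moreover have "t j powr (- 1 / (2 * \<alpha>)) / t j = t j powr (- q)" for j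
      using t[of j] powr_diff[of "t j" "- 1 / (2 * \<alpha>)" 1] by (simp add: q_def)
    ultimately show ?thesis using filterlim_compose[OF _ tr] by simp
  qed
  have "(\<integral>\<^sup>+x. ennreal ((1 - cos x) * (c * (\<bar>x\<bar> powr (- (1 + 2 * \<alpha>))))) \<partial>lborel) \<le> 1"
  proof (rule nn_integral_le_tendsto[where b = "\<lambda>j. 1"
        and f = "\<lambda>j x. ennreal (1 / t j) * ennreal ((1 - cos x) * (c * kernel_profile \<alpha> (t j) x))"])
    fix j
    have "(\<integral>\<^sup>+x. ennreal (1 / t j) * ennreal ((1 - cos x) * (c * kernel_profile \<alpha> (t j) x)) \<partial>lborel)
        = ennreal (1 / t j) * (\<integral>\<^sup>+x. ennreal ((1 - cos x) * (c * kernel_profile \<alpha> (t j) x)) \<partial>lborel)"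
      by (rule nn_integral_cmult) measurable
    also have "\<dots> \<le> ennreal (1 / t j) * ennreal (1 - exp (- t j))"
      by (intro mult_left_mono kernel_profile_cos_bound[OF c t]) auto
    also have "\<dots> = ennreal (1 / t j * (1 - exp (- t j)))" using t[of j] by (subst ennreal_mult) auto
    also have "\<dots> \<le> ennreal 1"
      using t[of j] exp_ge_add_one_self[of "- t j"] by (intro ennreal_leI) (simp add: field_simps)
    finally show "(\<integral>\<^sup>+x. ennreal (1 / t j) * ennreal ((1 - cos x) * (c * kernel_profile \<alpha> (t j) x)) \<partial>lborel) \<le> 1" by simp
  next
    show "AE x in lborel. (\<lambda>j. ennreal (1 / t j) * ennreal ((1 - cos x) * (c * kernel_profile \<alpha> (t j) x)))
            \<longlonglongrightarrow> ennreal ((1 - cos x) * (c * (\<bar>x\<bar> powr (- (1 + 2 * \<alpha>)))))"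
    proof (rule AE_mp[OF AE_lborel_singleton[of 0]], intro AE_I2 impI)
      fix x :: real assume x: "x \<noteq> 0"
      have "eventually (\<lambda>j. \<bar>x\<bar> powr (- (1 + 2 * \<alpha>)) \<le> t j powr (- 1 / (2 * \<alpha>)) / t j) sequentially"
        using big unfolding filterlim_at_top by blast
      then have "eventually (\<lambda>j. ennreal (1 / t j) * ennreal ((1 - cos x) * (c * kernel_profile \<alpha> (t j) x))
          = ennreal ((1 - cos x) * (c * (\<bar>x\<bar> powr (- (1 + 2 * \<alpha>)))))) sequentially"
      proof eventually_elim
        case (elim j)
        then have "kernel_profile \<alpha> (t j) x = t j * \<bar>x\<bar> powr (- (1 + 2 * \<alpha>))"
          using x t[of j] by (simp add: kernel_profile_def min_def field_simps)
        then show ?case using t[of j] by (simp add: ennreal_mult'[symmetric])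
      qed
      then show "(\<lambda>j. ennreal (1 / t j) * ennreal ((1 - cos x) * (c * kernel_profile \<alpha> (t j) x)))
            \<longlonglongrightarrow> ennreal ((1 - cos x) * (c * (\<bar>x\<bar> powr (- (1 + 2 * \<alpha>)))))"
        by (rule tendsto_eventually)
    qed
  qed auto
  also have "(\<integral>\<^sup>+x. ennreal ((1 - cos x) * (c * (\<bar>x\<bar> powr (- (1 + 2 * \<alpha>))))) \<partial>lborel)
     = (\<integral>\<^sup>+x. ennreal c * (ennreal (1 - cos x) * ennreal (\<bar>x\<bar> powr (- (1 + 2 * \<alpha>)))) \<partial>lborel)"
    using cpos by (intro nn_integral_cong) (simp add: ennreal_mult'[symmetric] mult_ac)
  also have "\<dots> = ennreal c * (\<integral>\<^sup>+x. ennreal (1 - cos x) * ennreal (\<bar>x\<bar> powr (- (1 + 2 * \<alpha>))) \<partial>lborel)"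
    by (rule nn_integral_cmult) measurable
  finally show ?thesis .
qed

section \<open>The Levy kernel\<close>

text \<open>The uniqueness argument for Haar measure. With \<open>C\<close> the unit ball, the
  double integral of \<open>indicator C x * indicator B (x + y)\<close> is
  \<open>lborel C * M B\<close> in one order and \<open>M C * lborel B\<close> in the other; the
  symmetry of the ball absorbs the sign in \<open>x - y\<close>.\<close>

lemma translation_invariant_eq_lborel:
  fixes M :: "'a::euclidean_space measure"
  assumes sets[measurable_cong, simp]: "sets M = sets borel"
    and sf: "sigma_finite_measure M"
    and trans: "\<And>a. distr M borel (\<lambda>x. a + x) = M"
    and ball: "emeasure M (ball 0 1) = emeasure lborel (ball (0::'a) 1)"
  shows "M = lborel"
proof (rule measure_eqI)
  note Fubini = pair_sigma_finite.Fubini'[OF pair_sigma_finite.intro[OF sigma_finite_lborel sf]]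
  fix B assume "B \<in> sets M"
  then have [measurable]: "B \<in> sets borel" by simp
  define C where "C = (ball 0 1 :: 'a set)"
  have [measurable]: "C \<in> sets borel" by (simp add: C_def)
  have 1: "emeasure M B = (\<integral>\<^sup>+y. indicator B (x + y) \<partial>M)" for x
  proof -
    have "emeasure M B = (\<integral>\<^sup>+y. indicator B y \<partial>distr M borel (\<lambda>y. x + y))"
      by (simp add: trans)
    also have "\<dots> = (\<integral>\<^sup>+y. indicator B (x + y) \<partial>M)"
      by (rule nn_integral_distr) auto
    finally show ?thesis .
  qed
  have 2: "(\<integral>\<^sup>+x. f (y + x) \<partial>lborel) = (\<integral>\<^sup>+x. f x \<partial>lborel)"
    if [measurable]: "f \<in> borel_measurable borel" for f and y :: 'a
  proof -
    have "(\<integral>\<^sup>+x. f x \<partial>lborel) = (\<integral>\<^sup>+x. f x \<partial>distr lborel borel ((+) y))"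
      by (simp add: lborel_distr_plus)
    also have "\<dots> = (\<integral>\<^sup>+x. f (y + x) \<partial>lborel)"
      by (rule nn_integral_distr) auto
    finally show ?thesis ..
  qed
  have 3: "(\<integral>\<^sup>+y. indicator C (x - y) \<partial>M) = emeasure M C" for x
  proof -
    have "emeasure M C = (\<integral>\<^sup>+y. indicator C y \<partial>distr M borel (\<lambda>y. - x + y))"
      unfolding trans by simp
    also have "\<dots> = (\<integral>\<^sup>+y. indicator C (- x + y) \<partial>M)"
      by (rule nn_integral_distr) measurable
    also have "\<dots> = (\<integral>\<^sup>+y. indicator C (x - y) \<partial>M)"
      by (intro nn_integral_cong) (simp add: C_def indicator_def norm_minus_commute)
    finally show ?thesis ..
  qed
  have "emeasure lborel C * emeasure M B = (\<integral>\<^sup>+x. indicator C x * emeasure M B \<partial>lborel)"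
    by (simp add: nn_integral_multc)
  also have "\<dots> = (\<integral>\<^sup>+x. (\<integral>\<^sup>+y. indicator C x * indicator B (x + y) \<partial>M) \<partial>lborel)"
    by (rule nn_integral_cong, subst nn_integral_cmult) (auto simp flip: 1)
  also have "\<dots> = (\<integral>\<^sup>+y. (\<integral>\<^sup>+x. indicator C x * indicator B (x + y) \<partial>lborel) \<partial>M)"
    by (rule Fubini[symmetric]) measurable
  also have "\<dots> = (\<integral>\<^sup>+y. (\<integral>\<^sup>+x. indicator C (x - y) * indicator B x \<partial>lborel) \<partial>M)"
  proof (rule nn_integral_cong)
    fix y
    show "(\<integral>\<^sup>+x. indicator C x * indicator B (x + y) \<partial>lborel)
        = (\<integral>\<^sup>+x. indicator C (x - y) * indicator B x \<partial>lborel)"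
      using 2[of "\<lambda>x. indicator C (x - y) * indicator B x" y] by (simp add: add.commute[of y])
  qed
  also have "\<dots> = (\<integral>\<^sup>+x. (\<integral>\<^sup>+y. indicator C (x - y) * indicator B x \<partial>M) \<partial>lborel)"
    by (rule Fubini) measurable
  also have "\<dots> = emeasure M C * emeasure lborel B"
    by (simp add: nn_integral_multc 3 nn_integral_cmult)
  finally have "emeasure lborel C * emeasure M B = emeasure lborel C * emeasure lborel B"
    by (simp add: ball C_def)
  moreover have "emeasure lborel C \<noteq> 0" "emeasure lborel C \<noteq> \<infinity>"
    using emeasure_lborel_ball_finite[of "0::'a" 1]
      content_ball_pos[of 1 "0::'a"] by (auto simp: measure_def C_def)
  ultimately show "emeasure M B = emeasure lborel B"
    by (simp add: ennreal_mult_cancel_left)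
qed simp

text \<open>The image measure is translation invariant because
  \<open>a + T x = T (T' a + x)\<close>, and it has the right mass on the unit ball because
  \<open>T\<close> preserves that ball.\<close>

lemma lborel_distr_orthogonal:
  fixes T :: "'a::euclidean_space \<Rightarrow> 'a"
  assumes T: "orthogonal_transformation T"
  shows "distr lborel borel T = lborel"
proof (rule translation_invariant_eq_lborel)
  have lin: "linear T" and nT: "norm (T x) = norm x" for x
    using T by (auto simp: orthogonal_transformation)
  have [measurable]: "T \<in> borel_measurable borel"
    using lin by (simp add: borel_measurable_continuous_onI linear_continuous_on linear_linear)
  obtain T' where T': "orthogonal_transformation T'" "\<And>x. T (T' x) = x" "\<And>x. T' (T x) = x"
    using T orthogonal_transformation_bij[OF T] orthogonal_transformation_inv[OF T]
    by (metis bij_inv_eq_iff)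
  have linT': "linear T'" and [measurable]: "T' \<in> borel_measurable borel"
    using T'(1) by (auto simp: orthogonal_transformation borel_measurable_continuous_onI linear_continuous_on linear_linear)
  show "sets (distr lborel borel T) = sets borel" by simp
  show "sigma_finite_measure (distr lborel borel T)"
  proof (rule sigma_finite_measure_distr[of _ borel T'])
    have "distr (distr lborel borel T) borel T' = lborel"
      by (subst distr_distr) (auto simp: comp_def T' lborel_def intro!: distr_id2)
    then show "sigma_finite_measure (distr (distr lborel borel T) borel T')"
      by (simp add: sigma_finite_lborel)
  qed auto
  show "distr (distr lborel borel T) borel ((+) a) = distr lborel borel T" for a
  proof -
    have "distr (distr lborel borel T) borel ((+) a) = distr lborel borel (\<lambda>x. a + T x)"
      by (subst distr_distr) (auto simp: comp_def)
    also have "\<dots> = distr (distr lborel borel ((+) (T' a))) borel T"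
      by (subst distr_distr) (auto simp: comp_def T' linear_add[OF lin])
    finally show ?thesis by (simp add: lborel_distr_plus)
  qed
  have "T -` ball 0 1 = ball 0 1" by (auto simp: nT)
  then show "emeasure (distr lborel borel T) (ball 0 1) = emeasure lborel (ball (0::'a) 1)"
    by (subst emeasure_distr) auto
qed

section \<open>Scaling and rotation of the Levy kernel\<close>

text \<open>The jump density of the isotropic stable process of index \<open>2 * \<alpha>\<close>,
  up to a constant. Because \<open>0 powr a = 0\<close> it vanishes at the origin, so radial
  monotonicity has to exclude \<open>z = 0\<close>.\<close>

definition levy_kernel :: "real \<Rightarrow> 'a::euclidean_space \<Rightarrow> real" where
  "levy_kernel \<alpha> z = norm z powr (- (real DIM('a) + 2 * \<alpha>))"

lemma levy_kernel_nonneg [simp]: "0 \<le> levy_kernel \<alpha> z"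
  by (simp add: levy_kernel_def)

lemma levy_kernel_measurable [measurable]: "levy_kernel \<alpha> \<in> borel_measurable borel"
  unfolding levy_kernel_def by measurable

lemma levy_kernel_antimono:
  fixes z w :: "'a::euclidean_space"
  assumes "0 < \<alpha>" "z \<noteq> 0" "norm z \<le> norm w"
  shows "levy_kernel \<alpha> w \<le> levy_kernel \<alpha> z"
  using assms by (auto simp: levy_kernel_def intro!: powr_mono2')

lemma levy_kernel_scaleR:
  fixes z :: "'a::euclidean_space"
  assumes "0 < r"
  shows "levy_kernel \<alpha> (r *\<^sub>R z) = r powr (- (real DIM('a) + 2 * \<alpha>)) * levy_kernel \<alpha> z"
  using assms by (simp add: levy_kernel_def powr_mult)

lemma nn_integral_lborel_scaleR:
  fixes f :: "'a::euclidean_space \<Rightarrow> ennreal"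
  assumes [measurable]: "f \<in> borel_measurable borel" and r: "0 < r"
  shows "(\<integral>\<^sup>+z. f z \<partial>lborel) = ennreal (r powr real DIM('a)) * (\<integral>\<^sup>+z. f (r *\<^sub>R z) \<partial>lborel)"
  using r by (subst lborel_affine[of r 0])
     (simp_all add: nn_integral_density nn_integral_distr nn_integral_cmult powr_realpow)

text \<open>The Jacobian contributes the power d and the kernel is homogeneous of degree -d - 2
  \<alpha>; the excess is the factor \<open>r powr (2 * \<alpha>)\<close>.\<close>

lemma nn_integral_levy_scaleR:
  fixes f :: "'a::euclidean_space \<Rightarrow> ennreal"
  assumes [measurable]: "f \<in> borel_measurable borel" and r: "0 < r"
  shows "(\<integral>\<^sup>+z. f (r *\<^sub>R z) * ennreal (levy_kernel \<alpha> z) \<partial>lborel)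
       = ennreal (r powr (2 * \<alpha>)) * (\<integral>\<^sup>+z. f z * ennreal (levy_kernel \<alpha> z) \<partial>lborel)"
proof -
  have "ennreal (r powr (2 * \<alpha>)) * (\<integral>\<^sup>+z. f z * ennreal (levy_kernel \<alpha> z) \<partial>lborel)
      = ennreal (r powr (2 * \<alpha>)) * (ennreal (r powr real DIM('a)) *
          (\<integral>\<^sup>+z. f (r *\<^sub>R z) * ennreal (levy_kernel \<alpha> (r *\<^sub>R z)) \<partial>lborel))"
    by (subst nn_integral_lborel_scaleR[OF _ r]) auto
  also have "\<dots> = (\<integral>\<^sup>+z. ennreal (r powr (2 * \<alpha>)) * (ennreal (r powr real DIM('a)) *
           (f (r *\<^sub>R z) * ennreal (levy_kernel \<alpha> (r *\<^sub>R z)))) \<partial>lborel)"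
    by (simp add: nn_integral_cmult)
  also have "\<dots> = (\<integral>\<^sup>+z. f (r *\<^sub>R z) * ennreal (levy_kernel \<alpha> z) \<partial>lborel)"
  proof (intro nn_integral_cong)
    fix z :: 'a
    have "r powr (2 * \<alpha>) * r powr real DIM('a) * levy_kernel \<alpha> (r *\<^sub>R z) = levy_kernel \<alpha> z"
      unfolding levy_kernel_scaleR[OF r] mult.assoc[symmetric] powr_add[symmetric]
      using r by (simp add: powr_add[symmetric])
    then show "ennreal (r powr (2 * \<alpha>)) * (ennreal (r powr real DIM('a)) *
           (f (r *\<^sub>R z) * ennreal (levy_kernel \<alpha> (r *\<^sub>R z)))) = f (r *\<^sub>R z) * ennreal (levy_kernel \<alpha> z)"
      by (metis (no_types, lifting) ennreal_mult levy_kernel_nonneg mult.left_commute mult.assoc powr_ge_zero mult_nonneg_nonneg)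
  qed
  finally show ?thesis ..
qed

lemma nn_integral_lborel_orthogonal:
  fixes T :: "'a::euclidean_space \<Rightarrow> 'a" and f :: "'a \<Rightarrow> ennreal"
  assumes T: "orthogonal_transformation T" and [measurable]: "f \<in> borel_measurable borel"
  shows "(\<integral>\<^sup>+z. f (T z) \<partial>lborel) = (\<integral>\<^sup>+z. f z \<partial>lborel)"
proof -
  have [measurable]: "T \<in> borel_measurable borel"
    using T by (simp add: borel_measurable_continuous_onI linear_continuous_on linear_linear orthogonal_transformation)
  have "(\<integral>\<^sup>+z. f z \<partial>lborel) = (\<integral>\<^sup>+z. f z \<partial>distr lborel borel T)"
    by (simp add: lborel_distr_orthogonal[OF T])
  then show ?thesis by (simp add: nn_integral_distr)
qed

lemma nn_integral_levy_orthogonal: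
  fixes T :: "'a::euclidean_space \<Rightarrow> 'a" and f :: "'a \<Rightarrow> ennreal"
  assumes T: "orthogonal_transformation T" and [measurable]: "f \<in> borel_measurable borel"
  shows "(\<integral>\<^sup>+z. f (T z) * ennreal (levy_kernel \<alpha> z) \<partial>lborel)
       = (\<integral>\<^sup>+z. f z * ennreal (levy_kernel \<alpha> z) \<partial>lborel)"
  using nn_integral_lborel_orthogonal[OF T, of "\<lambda>z. f z * ennreal (levy_kernel \<alpha> z)"] T
  by (simp add: levy_kernel_def orthogonal_transformation)

text \<open>For a unit vector \<open>e\<close>, the Householder reflection in the hyperplane
  orthogonal to \<open>e\<close>.\<close>

definition reflection :: "'a::euclidean_space \<Rightarrow> 'a \<Rightarrow> 'a" where
  "reflection e z = z - (2 * (z \<bullet> e)) *\<^sub>R e"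

lemma orthogonal_transformation_reflection:
  assumes "norm e = 1"
  shows "orthogonal_transformation (reflection e)"
proof -
  have "e \<bullet> e = 1" using assms by (simp add: norm_eq_1)
  then show ?thesis
    unfolding orthogonal_transformation_def reflection_def
    by (auto simp: linear_iff inner_simps algebra_simps inner_commute)
qed

lemma reflection_swaps:
  fixes a b :: "'a::euclidean_space"
  assumes "norm a = norm b" "a \<noteq> b"
  shows "reflection ((a - b) /\<^sub>R norm (a - b)) a = b"
proof -
  have n: "(norm (a - b))\<^sup>2 = 2 * (a \<bullet> (a - b))"
    using assms(1) by (simp add: power2_norm_eq_inner inner_simps inner_commute norm_eq)
  have "a \<bullet> ((a - b) /\<^sub>R norm (a - b)) = (norm (a - b)) / 2"
    using n assms(2) by (simp add: inner_simps field_simps power2_eq_square)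
  then have "2 * (a \<bullet> ((a - b) /\<^sub>R norm (a - b))) = norm (a - b)" by simp
  then show ?thesis using assms(2) unfolding reflection_def by simp
qed

lemma exists_orthogonal_transformation:
  fixes a b :: "'a::euclidean_space"
  assumes "norm a = norm b"
  obtains T where "orthogonal_transformation T" "T a = b"
proof (cases "a = b")
  case True
  then show ?thesis using that[of "\<lambda>x. x"] by (simp add: orthogonal_transformation_id)
next
  case False
  then show ?thesis
    using that orthogonal_transformation_reflection reflection_swaps[OF assms]
    by (metis norm_sgn right_minus_eq sgn_div_norm)
qed

section \<open>Dyadic shells and the truncated second moment\<close>

lemma nn_integral_levy_annulus:
  fixes a :: real
  assumes a: "0 < a"
  shows "(\<integral>\<^sup>+z. indicator {z. a < norm z \<and> norm z \<le> 2 * a} z * ennreal (levy_kernel \<alpha> (z::'a::euclidean_space)) \<partial>lborel)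
       = ennreal (a powr (- (2 * \<alpha>))) *
         (\<integral>\<^sup>+z. indicator {z. 1 < norm z \<and> norm z \<le> 2} z * ennreal (levy_kernel \<alpha> (z::'a)) \<partial>lborel)"
    (is "?L = _ * ?Q")
proof -
  have "?Q = (\<integral>\<^sup>+z. indicator {z. a < norm z \<and> norm z \<le> 2 * a} (a *\<^sub>R z) * ennreal (levy_kernel \<alpha> (z::'a)) \<partial>lborel)"
    using a by (intro nn_integral_cong) (auto simp: indicator_def)
  also have "\<dots> = ennreal (a powr (2 * \<alpha>)) * ?L"
    by (rule nn_integral_levy_scaleR[OF _ a]) measurable
  finally have "ennreal (a powr (- (2 * \<alpha>))) * ?Q = ennreal (a powr (- (2 * \<alpha>)) * a powr (2 * \<alpha>)) * ?L"
    by (simp add: ennreal_mult mult.assoc)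
  then show ?thesis using a by (simp add: powr_add[symmetric])
qed

lemma nn_integral_levy_annulus_finite:
  assumes "0 < \<alpha>"
  shows "(\<integral>\<^sup>+z. indicator {z. 1 < norm z \<and> norm z \<le> 2} z * ennreal (levy_kernel \<alpha> (z::'a::euclidean_space)) \<partial>lborel) < \<infinity>"
proof -
  have "(\<integral>\<^sup>+z. indicator {z. 1 < norm z \<and> norm z \<le> 2} z * ennreal (levy_kernel \<alpha> (z::'a)) \<partial>lborel)
      \<le> (\<integral>\<^sup>+z. indicator (cball (0::'a) 2) z \<partial>lborel)"
  proof (intro nn_integral_mono)
    fix z :: 'a
    have "1 < norm z \<Longrightarrow> levy_kernel \<alpha> z \<le> 1"
      unfolding levy_kernel_def using assms powr_mono[of "- (real DIM('a) + 2 * \<alpha>)" 0 "norm z"] by (auto split: if_splits)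
    then show "indicator {z. 1 < norm z \<and> norm z \<le> 2} z * ennreal (levy_kernel \<alpha> z) \<le> indicator (cball 0 2) z"
      by (auto simp: indicator_def ennreal_le_1)
  qed
  also have "\<dots> < \<infinity>" using emeasure_lborel_cball_finite[of "0::'a" 2] by simp
  finally show ?thesis .
qed

text \<open>Exponents from 0 upwards and from -1 downwards are numbered separately, so that each
  family of shells leads to a geometric series over the naturals. The shells are half-open and
  \<open>r = 1\<close> falls into the second family.\<close>

lemma dyadic_scale:
  fixes r :: real
  assumes "0 < r"
  obtains (large) j :: nat where "1 < r" "2 powr real j < r" "r \<le> 2 * 2 powr real j"
        | (small) j :: nat where "r \<le> 1" "2 powr (- real j - 1) < r" "r \<le> 2 * 2 powr (- real j - 1)"
proof -
  define k where "k = \<lceil>log 2 r\<rceil> - 1"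
  have k: "real_of_int k < log 2 r" "log 2 r \<le> real_of_int k + 1" unfolding k_def by linarith+
  have 1: "2 powr real_of_int k < r"
    using k(1) assms by (simp add: less_log_iff)
  have 2: "r \<le> 2 * 2 powr real_of_int k"
    using k(2) assms by (simp add: log_le_iff powr_add)
  show ?thesis
  proof (cases "r > 1")
    case True
    then have "k \<ge> 0" unfolding k_def by (simp add: less_log_iff)
    then show ?thesis using large[of "nat k"] 1 2 True by simp
  next
    case False
    then have "log 2 r \<le> 0" using assms by simp
    then have "k \<le> -1" unfolding k_def by simp
    then show ?thesis using small[of "nat (- k - 1)"] 1 2 False by (simp add: of_nat_nat)
  qed
qed

lemma suminf_ennreal_geometric_finite:
  fixes x :: real and Q :: ennreal
  assumes "0 \<le> x" "x < 1" "Q < \<infinity>"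
  shows "(\<Sum>j. ennreal (x ^ j) * Q) < \<infinity>"
proof -
  have "(\<Sum>j. ennreal (x ^ j)) < \<infinity>"
    using assms by (subst suminf_ennreal2) auto
  then show ?thesis using assms(3) by (simp add: ennreal_mult_less_top)
qed

text \<open>By scaling, the shell masses are geometric. The outer shells have ratio
  \<open>2 powr (- (2 * \<alpha>))\<close>, below 1 as \<alpha> > 0. On the inner shell of index
  \<open>j\<close> the squared norm is at most \<open>4 powr (- real j)\<close>, which gives the
  ratio \<open>4 powr (\<alpha> - 1)\<close>, below 1 as \<alpha> < 1.\<close>

lemma nn_integral_levy_moment_finite:
  assumes "0 < \<alpha>" "\<alpha> < 1"
  shows "(\<integral>\<^sup>+z. ennreal (min 1 ((norm z)\<^sup>2) * levy_kernel \<alpha> (z::'a::euclidean_space)) \<partial>lborel) < \<infinity>"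
proof -
  define A where "A s = {z::'a. 2 powr s < norm z \<and> norm z \<le> 2 * 2 powr s}" for s
  define Q where "Q = (\<integral>\<^sup>+z. indicator {z. 1 < norm z \<and> norm z \<le> 2} z * ennreal (levy_kernel \<alpha> (z::'a)) \<partial>lborel)"
  have Q: "Q < \<infinity>" unfolding Q_def by (rule nn_integral_levy_annulus_finite) fact
  have [measurable]: "A s \<in> sets borel" for s unfolding A_def by measurable
  have IA: "(\<integral>\<^sup>+z. indicator (A s) z * ennreal (levy_kernel \<alpha> z) \<partial>lborel) = ennreal (2 powr (- (2 * \<alpha> * s))) * Q" for s
    unfolding A_def Q_def using nn_integral_levy_annulus[of "2 powr s" \<alpha>, where 'a='a]
    by (simp add: powr_powr mult_ac)
  define F where "F j z = indicator (A (real j)) z * ennreal (levy_kernel \<alpha> z)" for j :: nat and z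
  define G where "G j z = ennreal (4 powr - real j) * (indicator (A (- real j - 1)) z * ennreal (levy_kernel \<alpha> z))" for j :: nat and z
  have [measurable]: "F j \<in> borel_measurable borel" "G j \<in> borel_measurable borel" for j
    unfolding F_def G_def by measurable
  have "(\<integral>\<^sup>+z. ennreal (min 1 ((norm z)\<^sup>2) * levy_kernel \<alpha> (z::'a)) \<partial>lborel)
      \<le> (\<integral>\<^sup>+z. (\<Sum>j. F j z) + (\<Sum>j. G j z) \<partial>lborel)"
  proof (intro nn_integral_mono)
    fix z :: 'a
    show "ennreal (min 1 ((norm z)\<^sup>2) * levy_kernel \<alpha> z) \<le> (\<Sum>j. F j z) + (\<Sum>j. G j z)"
    proof (cases "z = 0")
      case False
      then have "0 < norm z" by simp
      then show ?thesis
      proof (cases rule: dyadic_scale)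
        case (large j)
        then have "ennreal (min 1 ((norm z)\<^sup>2) * levy_kernel \<alpha> z) \<le> F j z"
          unfolding F_def A_def by (auto intro!: ennreal_leI mult_left_le_one_le)
        also have "\<dots> \<le> (\<Sum>j. F j z)" using sum_le_suminf[of "\<lambda>j. F j z" "{j}"] by simp
        finally show ?thesis by (simp add: add_increasing2)
      next
        case (small j)
        have "(norm z)\<^sup>2 \<le> (2 powr (- real j))\<^sup>2"
          using small(3) by (intro power_mono) (auto simp: powr_diff)
        also have "(2 powr (- real j))\<^sup>2 = 4 powr (- real j)"
          by (simp add: power2_eq_square powr_mult[symmetric])
        finally have "ennreal (min 1 ((norm z)\<^sup>2) * levy_kernel \<alpha> z) \<le> ennreal (4 powr (- real j) * levy_kernel \<alpha> z)"
          by (intro ennreal_leI mult_right_mono) auto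
        also have "\<dots> = G j z" using small unfolding G_def A_def by (simp add: ennreal_mult)
        also have "\<dots> \<le> (\<Sum>j. G j z)" using sum_le_suminf[of "\<lambda>j. G j z" "{j}"] by simp
        finally show ?thesis by (simp add: add_increasing)
      qed
    qed (simp add: levy_kernel_def)
  qed
  also have "\<dots> = (\<Sum>j. \<integral>\<^sup>+z. F j z \<partial>lborel) + (\<Sum>j. \<integral>\<^sup>+z. G j z \<partial>lborel)"
    by (simp add: nn_integral_add nn_integral_suminf)
  also have "(\<Sum>j. \<integral>\<^sup>+z. F j z \<partial>lborel) = (\<Sum>j. ennreal ((2 powr (- (2 * \<alpha>))) ^ j) * Q)"
    unfolding F_def IA by (simp add: powr_power mult_ac)
  also have "(\<Sum>j. \<integral>\<^sup>+z. G j z \<partial>lborel) = (\<Sum>j. ennreal ((4 powr (\<alpha> - 1)) ^ j) * (ennreal (4 powr \<alpha>) * Q))"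
  proof (intro suminf_cong)
    fix j :: nat
    have "(2::real) powr (- (2 * \<alpha> * (- real j - 1))) = 4 powr (\<alpha> * (real j + 1))"
      using powr_powr[of "2::real" 2 "\<alpha> * (real j + 1)"] by (simp add: algebra_simps)
    then have "4 powr - real j * 2 powr (- (2 * \<alpha> * (- real j - 1))) = (4 powr (\<alpha> - 1)) ^ j * 4 powr \<alpha>"
      by (simp add: powr_power powr_add[symmetric] algebra_simps)
    then show "(\<integral>\<^sup>+z. G j z \<partial>lborel) = ennreal ((4 powr (\<alpha> - 1)) ^ j) * (ennreal (4 powr \<alpha>) * Q)"
      unfolding G_def
      by (subst nn_integral_cmult, measurable, subst IA)
         (metis ennreal_mult mult.assoc powr_ge_zero zero_le_power)
  qed
  also have "(\<Sum>j. ennreal ((2 powr (- (2 * \<alpha>))) ^ j) * Q) + \<dots> < \<infinity>"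
  proof -
    have "2 powr (- (2 * \<alpha>)) < 2 powr (0::real)" "4 powr (\<alpha> - 1) < 4 powr (0::real)"
      by (rule powr_less_mono; use assms in simp)+
    moreover have "ennreal (4 powr \<alpha>) * Q < \<infinity>"
      using Q by (simp add: ennreal_mult_less_top)
    ultimately show ?thesis
      using suminf_ennreal_geometric_finite[of "2 powr (- (2 * \<alpha>))" Q, OF _ _ Q]
        suminf_ennreal_geometric_finite[of "4 powr (\<alpha> - 1)" "ennreal (4 powr \<alpha>) * Q"]
      by (metis ennreal_add_eq_top infinity_ennreal_def powr_ge_zero powr_zero_eq_one top.not_eq_extremum zero_neq_numeral)
  qed
  finally show ?thesis .
qed

section \<open>The one-dimensional marginal of the Levy kernel\<close>

lemma nn_integral_powr_tail:
  fixes a :: real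
  assumes "0 < \<alpha>" "0 < a"
  shows "(\<integral>\<^sup>+x. indicator {a<..} x * ennreal (x powr (- (1 + 2 * \<alpha>))) \<partial>lborel) = ennreal (a powr (- (2 * \<alpha>)) / (2 * \<alpha>))"
proof -
  have "(\<integral>\<^sup>+x. indicator {a<..} x * ennreal (x powr (- (1 + 2 * \<alpha>))) \<partial>lborel)
      = (\<integral>\<^sup>+x. ennreal (x powr (- (1 + 2 * \<alpha>))) * indicator {a..} x \<partial>lborel)"
    using AE_lborel_singleton[of a]
    by (intro nn_integral_cong_AE) (auto simp: indicator_def)
  also have "\<dots> = ennreal (0 - (- (a powr (- (2 * \<alpha>)) / (2 * \<alpha>))))"
  proof (rule nn_integral_FTC_atLeast)
    fix x assume "a \<le> x"
    then show "((\<lambda>x. - (x powr (- (2 * \<alpha>)) / (2 * \<alpha>))) has_real_derivative x powr (- (1 + 2 * \<alpha>))) (at x)"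
      using assms by (auto intro!: derivative_eq_intros simp: algebra_simps minus_diff_commute)
  next
    have "((\<lambda>x. x powr (- (2 * \<alpha>))) \<longlongrightarrow> 0) at_top"
      using assms by (intro tendsto_neg_powr filterlim_ident) auto
    from tendsto_minus[OF tendsto_divide[OF this tendsto_const[of "2 * \<alpha>"]]] assms
    show "((\<lambda>x. - (x powr (- (2 * \<alpha>)) / (2 * \<alpha>))) \<longlongrightarrow> 0) at_top" by simp
  qed auto
  finally show ?thesis by simp
qed

lemma levy_half_space_tail:
  fixes e :: "'a::euclidean_space"
  assumes a: "0 < a"
  shows "(\<integral>\<^sup>+z. indicator {a<..} (z \<bullet> e) * ennreal (levy_kernel \<alpha> z) \<partial>lborel)
       = ennreal (a powr (- (2 * \<alpha>))) * (\<integral>\<^sup>+z. indicator {1<..} (z \<bullet> e) * ennreal (levy_kernel \<alpha> z) \<partial>lborel)"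
    (is "?L = _ * ?Q")
proof -
  have "?Q = (\<integral>\<^sup>+z. indicator {a<..} ((a *\<^sub>R z) \<bullet> e) * ennreal (levy_kernel \<alpha> z) \<partial>lborel)"
    using a by (intro nn_integral_cong) (auto simp: indicator_def)
  also have "\<dots> = ennreal (a powr (2 * \<alpha>)) * ?L"
    by (rule nn_integral_levy_scaleR[OF _ a]) measurable
  finally have "ennreal (a powr (- (2 * \<alpha>))) * ?Q = ennreal (a powr (- (2 * \<alpha>)) * a powr (2 * \<alpha>)) * ?L"
    by (simp add: ennreal_mult mult.assoc)
  then show ?thesis using a by (simp add: powr_add[symmetric])
qed

lemma levy_half_space_finite_pos:
  fixes e :: "'a::euclidean_space"
  assumes \<alpha>: "0 < \<alpha>" "\<alpha> < 1" and e: "norm e = 1"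
  shows "(\<integral>\<^sup>+z. indicator {1<..} (z \<bullet> e) * ennreal (levy_kernel \<alpha> z) \<partial>lborel) < \<infinity>"
    and "(\<integral>\<^sup>+z. indicator {1<..} (z \<bullet> e) * ennreal (levy_kernel \<alpha> z) \<partial>lborel) > 0"
proof -
  have "(\<integral>\<^sup>+z. indicator {1<..} (z \<bullet> e) * ennreal (levy_kernel \<alpha> z) \<partial>lborel)
      \<le> (\<integral>\<^sup>+z. ennreal (min 1 ((norm z)\<^sup>2) * levy_kernel \<alpha> (z::'a)) \<partial>lborel)"
  proof (intro nn_integral_mono)
    fix z :: 'a
    have "1 < z \<bullet> e \<Longrightarrow> 1 < norm z"
      using norm_cauchy_schwarz[of z e] e by simp
    then have "1 < z \<bullet> e \<Longrightarrow> min 1 ((norm z)\<^sup>2) = 1" by (simp add: min_absorb1 one_le_power)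
    then show "indicator {1<..} (z \<bullet> e) * ennreal (levy_kernel \<alpha> z) \<le> ennreal (min 1 ((norm z)\<^sup>2) * levy_kernel \<alpha> z)"
      by (auto simp: indicator_def)
  qed
  also have "\<dots> < \<infinity>" by (rule nn_integral_levy_moment_finite[OF \<alpha>])
  finally show "(\<integral>\<^sup>+z. indicator {1<..} (z \<bullet> e) * ennreal (levy_kernel \<alpha> z) \<partial>lborel) < \<infinity>" .
next
  let ?S = "{z. 1 < z \<bullet> e}"
  have S: "open ?S" "2 *\<^sub>R e \<in> ?S"
    using e by (auto intro!: open_Collect_less continuous_intros simp: norm_eq_1)
  show "(\<integral>\<^sup>+z. indicator {1<..} (z \<bullet> e) * ennreal (levy_kernel \<alpha> z) \<partial>lborel) > 0"
  proof (rule ccontr)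
    assume "\<not> ?thesis"
    then have "AE z in lborel. indicator {1<..} (z \<bullet> e) * ennreal (levy_kernel \<alpha> z) = 0"
      by (subst (asm) not_gr_zero, subst (asm) nn_integral_0_iff_AE) auto
    then have "AE z in lborel. z \<notin> ?S"
      by eventually_elim (auto simp: indicator_def levy_kernel_def split: if_splits)
    then have "?S \<in> null_sets lborel"
      using S by (subst (asm) AE_iff_null_sets[symmetric]) auto
    then have "negligible ?S"
      by (simp add: negligible_iff_null_sets null_sets_completionI)
    then show False using S open_not_negligible by blast
  qed
qed

text \<open>By scaling, the mass of the half-space \<open>z \<bullet> e > a\<close> is a multiple of
  \<open>a powr (- (2 * \<alpha>))\<close>, just like the tail of the one-dimensional density. The
  value of \<open>B\<close> makes the tails agree at \<open>a = 1\<close>, hence at every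
  \<open>a > 0\<close>, and tails determine the measure.\<close>

lemma nn_integral_levy_marginal_half:
  fixes e :: "'a::euclidean_space"
  assumes \<alpha>: "0 < \<alpha>" "\<alpha> < 1" and e: "norm e = 1"
    and B: "ennreal B = ennreal (2 * \<alpha>) * (\<integral>\<^sup>+z. indicator {1<..} (z \<bullet> e) * ennreal (levy_kernel \<alpha> z) \<partial>lborel)" "B > 0"
    and [measurable]: "f \<in> borel_measurable borel"
  shows "(\<integral>\<^sup>+z. indicator {0<..} (z \<bullet> e) * f (z \<bullet> e) * ennreal (levy_kernel \<alpha> z) \<partial>lborel)
       = ennreal B * (\<integral>\<^sup>+x. indicator {0<..} x * f x * ennreal (\<bar>x\<bar> powr (- (1 + 2 * \<alpha>))) \<partial>lborel)"
proof -
  \<comment> \<open>The cut-off at \<open>d > 0\<close> makes all tails finite, as the comparison of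
    measures by tails requires; it is removed by monotone convergence along
    \<open>1 / real (Suc n)\<close>.\<close>
  define M where "M d = distr (density lborel (\<lambda>z. indicator {d<..} (z \<bullet> e) * ennreal (levy_kernel \<alpha> z))) borel (\<lambda>z. z \<bullet> e)" for d
  define N where "N d = density lborel (\<lambda>x::real. indicator {d<..} x * (ennreal B * ennreal (\<bar>x\<bar> powr (- (1 + 2 * \<alpha>)))))" for d
  let ?H = "\<integral>\<^sup>+z. indicator {1<..} (z \<bullet> e) * ennreal (levy_kernel \<alpha> z) \<partial>lborel"
  have MN: "M d = N d" if d: "d > 0" for d
  proof (rule measure_eqI_lessThan)
    show "sets (M d) = sets borel" "sets (N d) = sets borel" by (auto simp: M_def N_def)
    fix x
    have m: "max x d > 0" using d by simp
    have 1: "emeasure (M d) {x<..} = ennreal ((max x d) powr (- (2 * \<alpha>))) * ?H"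
    proof -
      have "emeasure (M d) {x<..} = (\<integral>\<^sup>+z. indicator {max x d<..} (z \<bullet> e) * ennreal (levy_kernel \<alpha> z) \<partial>lborel)"
        unfolding M_def
        by (subst emeasure_distr, measurable, subst emeasure_density, measurable)
           (auto simp: indicator_def intro!: nn_integral_cong)
      then show ?thesis using levy_half_space_tail[OF m] by simp
    qed
    have "emeasure (N d) {x<..} = (\<integral>\<^sup>+y. ennreal B * (indicator {max x d<..} y * ennreal (y powr (- (1 + 2 * \<alpha>)))) \<partial>lborel)"
      unfolding N_def using d
      by (subst emeasure_density) (auto simp: indicator_def intro!: nn_integral_cong)
    also have "\<dots> = ennreal B * ennreal ((max x d) powr (- (2 * \<alpha>)) / (2 * \<alpha>))"
      using nn_integral_powr_tail[OF \<alpha>(1) m] by (simp add: nn_integral_cmult)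
    also have "\<dots> = ennreal (2 * \<alpha> * ((max x d) powr (- (2 * \<alpha>)) / (2 * \<alpha>))) * ?H"
      unfolding B(1) by (subst ennreal_mult) (use \<alpha> in \<open>auto simp: mult_ac\<close>)
    also have "\<dots> = ennreal ((max x d) powr (- (2 * \<alpha>))) * ?H" using \<alpha> by simp
    finally show "emeasure (M d) {x<..} = emeasure (N d) {x<..}" using 1 by simp
    show "emeasure (M d) {x<..} < \<infinity>"
      unfolding 1 using levy_half_space_finite_pos(1)[OF \<alpha> e] by (simp add: ennreal_mult_less_top)
  qed
  have tr: "(\<integral>\<^sup>+z. indicator {d<..} (z \<bullet> e) * f (z \<bullet> e) * ennreal (levy_kernel \<alpha> z) \<partial>lborel)
       = (\<integral>\<^sup>+x. indicator {d<..} x * f x * (ennreal B * ennreal (\<bar>x\<bar> powr (- (1 + 2 * \<alpha>)))) \<partial>lborel)"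
    if "d > 0" for d
  proof -
    have "(\<integral>\<^sup>+x. f x \<partial>M d) = (\<integral>\<^sup>+z. indicator {d<..} (z \<bullet> e) * f (z \<bullet> e) * ennreal (levy_kernel \<alpha> z) \<partial>lborel)"
      unfolding M_def by (subst nn_integral_distr) (auto simp: nn_integral_density mult_ac)
    moreover have "(\<integral>\<^sup>+x. f x \<partial>N d) = (\<integral>\<^sup>+x. indicator {d<..} x * f x * (ennreal B * ennreal (\<bar>x\<bar> powr (- (1 + 2 * \<alpha>)))) \<partial>lborel)"
      unfolding N_def by (auto simp: nn_integral_density mult_ac)
    ultimately show ?thesis using MN[OF that] by simp
  qed
  have sup: "(\<integral>\<^sup>+z. (indicator {0<..} (g z) :: ennreal) * h z \<partial>lborel)
      = (SUP n. \<integral>\<^sup>+z. indicator {1 / real (Suc n)<..} (g z) * h z \<partial>lborel)"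
    if [measurable]: "g \<in> borel_measurable borel" "h \<in> borel_measurable borel"
    for g :: "'b::euclidean_space \<Rightarrow> real" and h
  proof -
    have inc: "incseq (\<lambda>n z. indicator {1 / real (Suc n)<..} (g z) * h z)"
    proof (intro monoI le_funI mult_right_mono)
      fix m n :: nat and z assume "m \<le> n"
      then have "1 / real (Suc n) \<le> 1 / real (Suc m)" by (auto simp: field_simps)
      then show "indicator {1 / real (Suc m)<..} (g z) \<le> (indicator {1 / real (Suc n)<..} (g z) :: ennreal)"
        by (auto simp: indicator_def)
    qed simp
    have "(SUP n. indicator {1 / real (Suc n)<..} (g z) * h z) = indicator {0<..} (g z) * h z" for z
    proof (rule antisym)
      show "(SUP n. indicator {1 / real (Suc n)<..} (g z) * h z) \<le> indicator {0<..} (g z) * h z"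
      proof (rule SUP_least)
        fix n
        have "0 < 1 / real (Suc n)" by simp
        then have "1 / real (Suc n) < g z \<Longrightarrow> 0 < g z" by linarith
        then show "indicator {1 / real (Suc n)<..} (g z) * h z \<le> indicator {0<..} (g z) * h z"
          by (auto simp: indicator_def)
      qed
      show "indicator {0<..} (g z) * h z \<le> (SUP n. indicator {1 / real (Suc n)<..} (g z) * h z)"
      proof (cases "g z > 0")
        case True
        then obtain n where "1 / real (Suc n) < g z"
          using reals_Archimedean[of "g z"] by (auto simp: inverse_eq_divide)
        then have "indicator {0<..} (g z) * h z \<le> indicator {1 / real (Suc n)<..} (g z) * h z"
          by (auto simp: indicator_def)
        then show ?thesis by (rule SUP_upper2[rotated]) simp
      qed simp
    qed
    then show ?thesis
      using nn_integral_monotone_convergence_SUP[OF inc, of lborel] by simp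
  qed
  have "(\<integral>\<^sup>+z. indicator {0<..} (z \<bullet> e) * (f (z \<bullet> e) * ennreal (levy_kernel \<alpha> z)) \<partial>lborel)
     = (\<integral>\<^sup>+x. indicator {0<..} x * (f x * (ennreal B * ennreal (\<bar>x\<bar> powr (- (1 + 2 * \<alpha>))))) \<partial>lborel)"
    using tr by (subst (1 2) sup) (auto simp: mult.assoc)
  also have "\<dots> = (\<integral>\<^sup>+x. ennreal B * (indicator {0<..} x * f x * ennreal (\<bar>x\<bar> powr (- (1 + 2 * \<alpha>)))) \<partial>lborel)"
    by (simp add: mult_ac)
  finally show ?thesis by (simp add: nn_integral_cmult mult.assoc)
qed

lemma nn_integral_split_sign:
  fixes g :: "'a::euclidean_space \<Rightarrow> real" and h :: "'a \<Rightarrow> ennreal"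
  assumes [measurable]: "g \<in> borel_measurable borel" "h \<in> borel_measurable borel"
    and "AE z in lborel. g z \<noteq> 0"
  shows "(\<integral>\<^sup>+z. h z \<partial>lborel) = (\<integral>\<^sup>+z. indicator {0<..} (g z) * h z \<partial>lborel) + (\<integral>\<^sup>+z. indicator {0<..} (- g z) * h z \<partial>lborel)"
proof -
  have "(\<integral>\<^sup>+z. h z \<partial>lborel) = (\<integral>\<^sup>+z. indicator {0<..} (g z) * h z + indicator {0<..} (- g z) * h z \<partial>lborel)"
    using assms(3) by (intro nn_integral_cong_AE) (auto simp: indicator_def)
  then show ?thesis by (simp add: nn_integral_add)
qed

lemma AE_lborel_inner_nonzero:
  fixes e :: "'a::euclidean_space"
  assumes "e \<noteq> 0"
  shows "AE z in lborel. z \<bullet> e \<noteq> 0"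
proof -
  have "negligible {z. e \<bullet> z = 0}" using assms by (intro negligible_hyperplane) auto
  then have "{z. e \<bullet> z = 0} \<in> null_sets lebesgue" by (simp add: negligible_iff_null_sets)
  moreover have "{z. e \<bullet> z = 0} \<in> sets borel" by measurable
  ultimately have "{z. e \<bullet> z = 0} \<in> null_sets lborel"
    by (auto simp: null_sets_def)
  then show ?thesis by (rule AE_I') (auto simp: inner_commute)
qed

text \<open>Rotation invariance makes the constant independent of the direction, and negative values
  of \<open>z \<bullet> e\<close> are treated as positive values for \<open>- e\<close>. The size of
  \<open>B\<close> is immaterial, because it cancels against the normalisation of the
  operator.\<close>

proposition levy_kernel_marginal:
  assumes \<alpha>: "0 < \<alpha>" "\<alpha> < 1"
  obtains B where "B > 0"
    "\<And>(e::'a::euclidean_space) f. norm e = 1 \<Longrightarrow> f \<in> borel_measurable borel \<Longrightarrow>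
       (\<integral>\<^sup>+z. f (z \<bullet> e) * ennreal (levy_kernel \<alpha> z) \<partial>lborel)
       = ennreal B * (\<integral>\<^sup>+x. f x * ennreal (\<bar>x\<bar> powr (- (1 + 2 * \<alpha>))) \<partial>lborel)"
proof -
  let ?H = "\<lambda>e::'a. \<integral>\<^sup>+z. indicator {1<..} (z \<bullet> e) * ennreal (levy_kernel \<alpha> z) \<partial>lborel"
  obtain e0 :: 'a where e0: "norm e0 = 1" using nonempty_Basis norm_Basis by blast
  define B where "B = 2 * \<alpha> * enn2real (?H e0)"
  have "?H e0 < \<infinity>" "?H e0 > 0" using levy_half_space_finite_pos[OF \<alpha> e0] by auto
  then have Bpos: "B > 0" and Be0: "ennreal B = ennreal (2 * \<alpha>) * ?H e0"
    unfolding B_def using \<alpha> by (auto simp: ennreal_mult enn2real_positive_iff)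
  have HH: "?H e = ?H e0" if e: "norm e = 1" for e
  proof -
    obtain T where T: "orthogonal_transformation T" "T e0 = e"
      using exists_orthogonal_transformation[of e0 e] e0 e by auto
    have "?H e = (\<integral>\<^sup>+z. indicator {1<..} (T z \<bullet> e) * ennreal (levy_kernel \<alpha> z) \<partial>lborel)"
      by (rule nn_integral_levy_orthogonal[OF T(1), symmetric]) measurable
    also have "\<dots> = ?H e0"
      using T(1) unfolding T(2)[symmetric] orthogonal_transformation_def by simp
    finally show ?thesis .
  qed
  have half: "(\<integral>\<^sup>+z. indicator {0<..} (z \<bullet> e) * f (z \<bullet> e) * ennreal (levy_kernel \<alpha> z) \<partial>lborel)
       = ennreal B * (\<integral>\<^sup>+x. indicator {0<..} x * f x * ennreal (\<bar>x\<bar> powr (- (1 + 2 * \<alpha>))) \<partial>lborel)"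
    if "norm e = 1" "f \<in> borel_measurable borel" for e :: 'a and f
    using that HH Be0 Bpos by (intro nn_integral_levy_marginal_half[OF \<alpha>]) auto
  have "(\<integral>\<^sup>+z. f (z \<bullet> e) * ennreal (levy_kernel \<alpha> z) \<partial>lborel)
       = ennreal B * (\<integral>\<^sup>+x. f x * ennreal (\<bar>x\<bar> powr (- (1 + 2 * \<alpha>))) \<partial>lborel)"
    if e: "norm e = 1" and [measurable]: "f \<in> borel_measurable borel" for e :: 'a and f
  proof -
    have e': "norm (- e) = 1" using e by simp
    have "(\<integral>\<^sup>+z. f (z \<bullet> e) * ennreal (levy_kernel \<alpha> z) \<partial>lborel)
        = (\<integral>\<^sup>+z. indicator {0<..} (z \<bullet> e) * (f (z \<bullet> e) * ennreal (levy_kernel \<alpha> z)) \<partial>lborel)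
        + (\<integral>\<^sup>+z. indicator {0<..} (- (z \<bullet> e)) * (f (z \<bullet> e) * ennreal (levy_kernel \<alpha> z)) \<partial>lborel)"
      using e by (intro nn_integral_split_sign AE_lborel_inner_nonzero) auto
    also have "(\<integral>\<^sup>+z. indicator {0<..} (z \<bullet> e) * (f (z \<bullet> e) * ennreal (levy_kernel \<alpha> z)) \<partial>lborel)
        = ennreal B * (\<integral>\<^sup>+x. indicator {0<..} x * f x * ennreal (\<bar>x\<bar> powr (- (1 + 2 * \<alpha>))) \<partial>lborel)"
      using half[OF e, of f] by (simp add: mult.assoc)
    also have "(\<integral>\<^sup>+z. indicator {0<..} (- (z \<bullet> e)) * (f (z \<bullet> e) * ennreal (levy_kernel \<alpha> z)) \<partial>lborel)
        = ennreal B * (\<integral>\<^sup>+x. indicator {0<..} x * f (- x) * ennreal (\<bar>x\<bar> powr (- (1 + 2 * \<alpha>))) \<partial>lborel)"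
      using half[OF e', of "\<lambda>x. f (- x)"] by (simp add: mult.assoc)
    also have "(\<integral>\<^sup>+x. indicator {0<..} x * f (- x) * ennreal (\<bar>x\<bar> powr (- (1 + 2 * \<alpha>))) \<partial>lborel)
        = (\<integral>\<^sup>+x. indicator {0<..} (- x) * (f x * ennreal (\<bar>x\<bar> powr (- (1 + 2 * \<alpha>)))) \<partial>lborel)"
      by (subst nn_integral_real_affine[where t = 0 and c = "-1"]) (auto simp: mult.assoc)
    also have "ennreal B * (\<integral>\<^sup>+x. indicator {0<..} x * f x * ennreal (\<bar>x\<bar> powr (- (1 + 2 * \<alpha>))) \<partial>lborel)
         + ennreal B * (\<integral>\<^sup>+x. indicator {0<..} (- x) * (f x * ennreal (\<bar>x\<bar> powr (- (1 + 2 * \<alpha>)))) \<partial>lborel)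
       = ennreal B * (\<integral>\<^sup>+x. f x * ennreal (\<bar>x\<bar> powr (- (1 + 2 * \<alpha>))) \<partial>lborel)"
      by (subst nn_integral_split_sign[of "\<lambda>x. x" "\<lambda>x. f x * ennreal (\<bar>x\<bar> powr (- (1 + 2 * \<alpha>)))"])
         (auto simp: distrib_left mult.assoc AE_lborel_singleton)
    finally show ?thesis .
  qed
  with Bpos show ?thesis using that by blast
qed

section \<open>Fourier coefficients of periodic functions\<close>

lemma column_mat_1: "column i (mat 1) = (axis i 1 :: real^'n)"
  by (simp add: column_def mat_def axis_def vec_eq_iff)

lemma periodic_mat_1: "periodic (mat 1) F \<longleftrightarrow> (\<forall>y i. F (y + axis i 1) = F y)"
  by (simp add: periodic_def column_mat_1)

text \<open>Composition with \<open>P\<close> turns the given lattice into the integer lattice, so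
  all arguments on cells can be made in the unit cube.\<close>

lemma periodic_pullback:
  assumes "periodic P f" shows "periodic (mat 1) (\<lambda>y. f (P *v y))"
  unfolding periodic_mat_1 matrix_vector_right_distrib matrix_vector_mult_basis
  using assms by (simp add: periodic_def)

lemma periodic_int_axis:
  fixes F :: "real^'n \<Rightarrow> 'b"
  assumes "periodic (mat 1) F"
  shows "F (y + of_int k *\<^sub>R axis i 1) = F y"
proof -
  have nat: "F (y + real n *\<^sub>R axis i 1) = F y" for n y
  proof (induction n arbitrary: y)
    case (Suc n)
    have "F (y + real (Suc n) *\<^sub>R axis i 1) = F ((y + real n *\<^sub>R axis i 1) + axis i 1)"
      by (simp add: algebra_simps)
    also have "\<dots> = F y" using assms Suc by (simp add: periodic_mat_1)
    finally show ?case .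
  qed simp
  show ?thesis
  proof (cases "k \<ge> 0")
    case True
    then show ?thesis using nat[of y "nat k"] by simp
  next
    case False
    then show ?thesis using nat[of "y + of_int k *\<^sub>R axis i 1" "nat (- k)"] by simp
  qed
qed

lemma vec_eq_sum_axis: "(a::real^'n) = (\<Sum>i\<in>UNIV. (a $ i) *\<^sub>R axis i 1)"
  using basis_expansion[of a] by (simp add: scalar_mult_eq_scaleR)

lemma periodic_int_vec:
  fixes F :: "real^'n \<Rightarrow> 'b"
  assumes F: "periodic (mat 1) F" and m: "\<And>i. m $ i \<in> \<int>"
  shows "F (y + m) = F y"
proof -
  have "F (y + (\<Sum>i\<in>S. (m $ i) *\<^sub>R axis i 1)) = F y" if "finite S" for S
    using that
  proof (induction S)
    case (insert i S)
    obtain k where "m $ i = of_int k" using m[of i] by (auto elim: Ints_cases)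
    then show ?case
      using insert periodic_int_axis[OF F, of "y + (\<Sum>i\<in>S. (m $ i) *\<^sub>R axis i 1)" k i]
      by (simp add: add_ac)
  qed simp
  from this[of UNIV] show ?thesis by (simp flip: vec_eq_sum_axis)
qed

lemma unit_cell_representative:
  fixes y :: "real^'n"
  obtains m where "\<And>i. m $ i \<in> \<int>" "y - m \<in> cbox 0 1"
proof
  show "(\<chi> i. of_int \<lfloor>y $ i\<rfloor>) $ i \<in> \<int>" for i by simp
  show "y - (\<chi> i. of_int \<lfloor>y $ i\<rfloor>) \<in> cbox 0 1"
    by (simp add: mem_box_cart less_imp_le frac_lt_1 flip: frac_def)
qed

lemma periodic_range_unit_cell:
  fixes F :: "real^'n \<Rightarrow> 'b"
  assumes F: "periodic (mat 1) F"
  shows "range F = F ` cbox 0 1"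
proof -
  have "F y \<in> F ` cbox 0 1" for y
  proof -
    obtain m where "\<And>i. m $ i \<in> \<int>" "y - m \<in> cbox 0 1" using unit_cell_representative by blast
    then show ?thesis using periodic_int_vec[OF F, of m "y - m"] by (metis diff_add_cancel imageI)
  qed
  then show ?thesis by auto
qed

lemma continuous_pullback:
  fixes P :: "real^'n^'n" and f :: "real^'n \<Rightarrow> 'b::topological_space"
  assumes "continuous_on UNIV f"
  shows "continuous_on UNIV (\<lambda>y. f (P *v y))"
  using assms continuous_on_compose2[of UNIV f UNIV "\<lambda>y. P *v y"]
  by (simp add: matrix_vector_mult_linear_continuous_on)

lemma invertible_vec_mult_surj:
  fixes P :: "real^'n^'n"
  assumes "invertible P"
  obtains y where "x = P *v y"
proof -
  obtain Q where "P ** Q = mat 1" using assms unfolding invertible_def by blast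
  then show ?thesis using that[of "Q *v x"] by (simp add: matrix_vector_mul_assoc)
qed

lemma periodic_range_compact:
  fixes P :: "real^'n^'n" and f :: "real^'n \<Rightarrow> 'b::topological_space"
  assumes P: "invertible P" and f: "continuous_on UNIV f" "periodic P f"
  shows "compact (range f)"
proof -
  have "range f = range (\<lambda>y. f (P *v y))"
  proof (intro equalityI subsetI)
    fix z assume "z \<in> range f"
    then obtain x where "z = f x" by auto
    moreover obtain y where "x = P *v y" by (rule invertible_vec_mult_surj[OF P])
    ultimately show "z \<in> range (\<lambda>y. f (P *v y))" by auto
  qed auto
  also have "\<dots> = (\<lambda>y. f (P *v y)) ` cbox 0 1"
    by (rule periodic_range_unit_cell[OF periodic_pullback[OF f(2)]])
  also have "compact \<dots>"
    by (intro compact_continuous_image continuous_on_subset[OF continuous_pullback[OF f(1)]]) auto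
  finally show ?thesis .
qed

lemma periodic_bounded:
  fixes P :: "real^'n^'n" and f :: "real^'n \<Rightarrow> 'b::real_normed_vector"
  assumes P: "invertible P" and f: "continuous_on UNIV f" "periodic P f"
  obtains M where "M > 0" "\<And>x. norm (f x) \<le> M"
  using compact_imp_bounded[OF periodic_range_compact[OF assms]]
  by (auto simp: bounded_pos)

section \<open>Integrals over the unit cell and their Fourier modes\<close>

text \<open>After removal of the integer part of \<open>t\<close>, the shifted cube is cut at
  coordinate 1; the overhanging slab moves back by one period and fills the gap at the other
  end.\<close>

lemma unit_cell_integral_axis_shift:
  fixes F :: "real^'n \<Rightarrow> 'b::euclidean_space"
  assumes F: "periodic (mat 1) F" "continuous_on UNIV F"
  shows "integral (cbox 0 1) (\<lambda>y. F (y + t *\<^sub>R axis i 1)) = integral (cbox 0 1) F"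
proof -
  let ?b = "axis i 1 :: real^'n"
  have b: "?b \<in> Basis" by simp
  have int: "F integrable_on cbox u v" for u v
    by (intro integrable_continuous continuous_on_subset[OF F(2)]) auto
  have all_split: "(\<forall>j. Q j) \<longleftrightarrow> Q i \<and> (\<forall>j. j \<noteq> i \<longrightarrow> Q j)" for Q :: "'n \<Rightarrow> bool" by metis
  have mem: "x \<in> cbox (p + u *\<^sub>R ?b) (q + v *\<^sub>R ?b) \<longleftrightarrow>
      (p $ i + u \<le> x $ i \<and> x $ i \<le> q $ i + v) \<and> (\<forall>j. j \<noteq> i \<longrightarrow> p $ j \<le> x $ j \<and> x $ j \<le> q $ j)" for x p q u v
    unfolding mem_box_cart by (subst all_split) (simp add: axis_def)
  have split: "integral (cbox u v) F = integral (cbox u v \<inter> {x. x \<bullet> ?b \<le> c}) F + integral (cbox u v \<inter> {x. x \<bullet> ?b \<ge> c}) F" for u v c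
    by (intro integral_unique has_integral_split[OF _ _ b] integrable_integral)
       (auto simp: interval_split[OF b] int)
  have shift: "integral (cbox u v) (\<lambda>y. F (y + c)) = integral (cbox (u + c) (v + c)) F" for u v c
    using has_integral_shift_cbox_iff[of F c "integral (cbox (u + c) (v + c)) F" u v] int
    by (intro integral_unique) (auto simp: o_def add.commute)
  have *: "integral (cbox 0 1) (\<lambda>y. F (y + s *\<^sub>R ?b)) = integral (cbox 0 1) F" if s: "0 \<le> s" "s \<le> 1" for s
  proof -
    have "integral (cbox 0 1) (\<lambda>y. F (y + s *\<^sub>R ?b)) = integral (cbox (0 + s *\<^sub>R ?b) (1 + s *\<^sub>R ?b)) F"
      by (rule shift)
    also have "\<dots> = integral (cbox (0 + s *\<^sub>R ?b) (1 + s *\<^sub>R ?b) \<inter> {x. x \<bullet> ?b \<le> 1}) F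
                 + integral (cbox (0 + s *\<^sub>R ?b) (1 + s *\<^sub>R ?b) \<inter> {x. x \<bullet> ?b \<ge> 1}) F"
      by (rule split)
    also have "cbox (0 + s *\<^sub>R ?b) (1 + s *\<^sub>R ?b) \<inter> {x. x \<bullet> ?b \<le> 1} = cbox 0 1 \<inter> {x. x \<bullet> ?b \<ge> s}"
      unfolding set_eq_iff Int_iff mem using mem[of _ 0 0 1 0] s by (auto simp: inner_axis)
    also have "cbox (0 + s *\<^sub>R ?b) (1 + s *\<^sub>R ?b) \<inter> {x. x \<bullet> ?b \<ge> 1} = cbox (0 + ?b) ((1 - (1 - s) *\<^sub>R ?b) + ?b)"
    proof -
      have "1 - (1 - s) *\<^sub>R ?b + ?b = 1 + s *\<^sub>R ?b" "0 + ?b = 0 + 1 *\<^sub>R ?b" by (simp_all add: algebra_simps)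
      then show ?thesis unfolding set_eq_iff Int_iff by (simp only: mem) (use s in \<open>auto simp: inner_axis\<close>)
    qed
    also have "integral (cbox (0 + ?b) ((1 - (1 - s) *\<^sub>R ?b) + ?b)) F = integral (cbox 0 (1 - (1 - s) *\<^sub>R ?b)) (\<lambda>y. F (y + ?b))"
      by (rule shift[symmetric])
    also have "\<dots> = integral (cbox 0 (1 - (1 - s) *\<^sub>R ?b)) F"
      using F(1) by (simp add: periodic_mat_1)
    also have "cbox 0 (1 - (1 - s) *\<^sub>R ?b) = cbox 0 1 \<inter> {x. x \<bullet> ?b \<le> s}"
    proof -
      have "1 - (1 - s) *\<^sub>R ?b = 1 + (s - 1) *\<^sub>R ?b" by (simp add: algebra_simps)
      then have "x \<in> cbox 0 (1 - (1 - s) *\<^sub>R ?b) \<longleftrightarrow> x \<in> cbox (0 + 0 *\<^sub>R ?b) (1 + (s - 1) *\<^sub>R ?b)" for x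
        by (metis add_0 scaleR_zero_left)
      then show ?thesis unfolding set_eq_iff Int_iff mem
        using mem[of _ 0 0 1 0] s by (auto simp: inner_axis)
    qed
    also have "integral (cbox 0 1 \<inter> {x. x \<bullet> ?b \<ge> s}) F + integral (cbox 0 1 \<inter> {x. x \<bullet> ?b \<le> s}) F = integral (cbox 0 1) F"
      using split[of 0 1 s] by simp
    finally show ?thesis .
  qed
  have "F (y + t *\<^sub>R ?b) = F (y + frac t *\<^sub>R ?b)" for y
    using periodic_int_axis[OF F(1), of "y + frac t *\<^sub>R ?b" "\<lfloor>t\<rfloor>" i]
    by (simp add: frac_def algebra_simps)
  then show ?thesis using *[of "frac t"] by (simp add: frac_ge_0 less_imp_le[OF frac_lt_1])
qed

lemma periodic_translate:
  assumes "periodic P F" shows "periodic P (\<lambda>y. F (y + a))"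
  unfolding periodic_def
proof (intro allI)
  fix y i
  have "F ((y + a) + column i P) = F (y + a)" using assms by (simp add: periodic_def)
  then show "F (y + column i P + a) = F (y + a)" by (simp add: add_ac)
qed

lemma continuous_translate:
  fixes F :: "'a::real_normed_vector \<Rightarrow> 'b::topological_space"
  assumes "continuous_on UNIV F"
  shows "continuous_on UNIV (\<lambda>y. F (y + a))"
  by (rule continuous_on_compose2[OF assms]) (auto intro!: continuous_intros)

lemma unit_cell_integral_shift:
  fixes F :: "real^'n \<Rightarrow> 'b::euclidean_space"
  assumes F: "periodic (mat 1) F" "continuous_on UNIV F"
  shows "integral (cbox 0 1) (\<lambda>y. F (y + a)) = integral (cbox 0 1) F"
proof -
  have "integral (cbox 0 1) (\<lambda>y. F (y + (\<Sum>i\<in>S. (a $ i) *\<^sub>R axis i 1))) = integral (cbox 0 1) F" if "finite S" for S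
    using that
  proof (induction S)
    case (insert i S)
    let ?a = "\<Sum>i\<in>S. (a $ i) *\<^sub>R axis i 1"
    have 1: "integral (cbox 0 1) (\<lambda>y. F ((y + (a $ i) *\<^sub>R axis i 1) + ?a)) = integral (cbox 0 1) (\<lambda>y. F (y + ?a))"
      by (rule unit_cell_integral_axis_shift[OF periodic_translate[OF F(1)] continuous_translate[OF F(2)]])
    have 2: "y + (\<Sum>i\<in>insert i S. (a $ i) *\<^sub>R axis i 1) = (y + (a $ i) *\<^sub>R axis i 1) + ?a" for y
      using insert.hyps by (simp add: add.assoc)
    show ?case unfolding 2 1 by (rule insert.IH)
  qed simp
  from this[of UNIV] show ?thesis by (simp flip: vec_eq_sum_axis)
qed

lemma set_integral_unit_cell:
  fixes F :: "real^'n \<Rightarrow> 'b::euclidean_space"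
  assumes "continuous_on UNIV F"
  shows "set_integrable lborel (cbox 0 1) F" "(LINT y:cbox 0 1|lborel. F y) = integral (cbox 0 1) F"
proof -
  show "set_integrable lborel (cbox 0 1) F"
    unfolding set_integrable_def
    by (intro borel_integrable_compact continuous_on_subset[OF assms]) auto
  then show "(LINT y:cbox 0 1|lborel. F y) = integral (cbox 0 1) F"
    by (rule set_borel_integral_eq_integral)
qed

text \<open>
  If \<open>h y\<^sub>0 > 0\<close>, then the powers of a trigonometric polynomial that exceeds 1 only near
  \<open>y\<^sub>0\<close> make the integral against \<open>h\<close> arbitrarily large.
\<close>

lemma trig_orthogonal_imp_nonpos:
  fixes h :: "real^'n \<Rightarrow> real"
  assumes h: "continuous_on UNIV h"
    and orth: "\<And>m. (\<And>i. m $ i \<in> \<int>) \<Longrightarrow> integral (cbox 0 1) (\<lambda>y. complex_of_real (h y) * cis (2 * pi * (m \<bullet> y))) = 0"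
    and y0: "y0 \<in> box 0 1"
  shows "h y0 \<le> 0"
proof (rule ccontr)
  assume "\<not> h y0 \<le> 0"
  then have h0: "h y0 > 0" by simp
  define n where "n = real CARD('n)"
  have n: "n > 0" by (simp add: n_def)
  have n1: "n \<ge> 1" by (simp add: n_def Suc_leI)
  have "\<forall>e>0. \<exists>d>0. \<forall>y. dist y y0 < d \<longrightarrow> dist (h y) (h y0) < e"
    using h by (simp add: continuous_on_iff)
  from this[rule_format, of "h y0 / 2"] h0
  obtain d where d: "d > 0" "\<And>y. dist y y0 < d \<Longrightarrow> dist (h y) (h y0) < h y0 / 2" by auto
  \<comment> \<open>The number \<delta> is small enough for four purposes: the cube of half-side
    \<delta> about \<open>y0\<close> lies in the unit cell; \<open>h\<close> exceeds half its value
    at \<open>y0\<close> there (the l1 norm costs the factor \<open>n\<close>); its points are at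
    distance below \<open>d\<close>; and the cosine is decreasing up to
    \<open>2 * pi * \<delta>\<close>.\<close>
  define D where "D = {1/2, d / (2 * n)} \<union> (range (\<lambda>i. y0 $ i) \<union> range (\<lambda>i. 1 - y0 $ i))"
  have D: "finite D" "D \<noteq> {}" by (auto simp: D_def)
  define \<delta> where "\<delta> = Min D"
  have \<delta>: "\<delta> > 0" "\<delta> \<le> 1/2" "\<delta> \<le> d / (2 * n)" "\<And>i. \<delta> \<le> y0 $ i" "\<And>i. \<delta> \<le> 1 - y0 $ i"
    unfolding \<delta>_def Min_gr_iff[OF D]
    by (rule Min_le[OF D(1)] | use y0 d n in \<open>force simp: D_def mem_box_cart\<close>)+
  have near: "h y \<ge> h y0 / 2" if "\<And>i. \<bar>y $ i - y0 $ i\<bar> \<le> \<delta>" for y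
  proof -
    have "norm (y - y0) \<le> (\<Sum>i\<in>UNIV. \<bar>(y - y0) $ i\<bar>)" by (rule norm_le_l1_cart)
    also have "\<dots> \<le> (\<Sum>i\<in>(UNIV::'n set). \<delta>)" using that by (intro sum_mono) simp
    also have "\<dots> = n * \<delta>" by (simp add: n_def)
    also have "\<dots> \<le> n * (d / (2 * n))" using \<delta>(3) n by (intro mult_left_mono) auto
    also have "\<dots> < d" using n d by simp
    finally have "dist y y0 < d" by (simp add: dist_norm)
    from d(2)[OF this] show ?thesis unfolding dist_real_def by linarith
  qed
  \<comment> \<open>Chosen so that \<open>q\<close> is at most 1 as soon as one coordinate leaves
    the \<delta>-cube: one cosine is then at most \<open>cos (2 * pi * \<delta>)\<close>, the other
    \<open>n - 1\<close> are at most 1, and the sum is exactly compensated.\<close>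
  define \<kappa> where "\<kappa> = (1 - cos (2 * pi * \<delta>)) / n"
  have "cos (2 * pi * \<delta>) < cos 0" using \<delta> by (intro cos_monotone_0_pi) auto
  then have \<kappa>: "\<kappa> > 0" using n by (simp add: \<kappa>_def)
  define q where "q y = \<kappa> + (\<Sum>i\<in>UNIV. cos (2 * pi * (y $ i - y0 $ i))) / n" for y :: "real^'n"
  have q_cont: "continuous_on UNIV q" unfolding q_def[abs_def] using n by (intro continuous_intros) auto
  have q_ge: "q y \<ge> -1" for y
  proof -
    have "- n \<le> (\<Sum>i\<in>UNIV. cos (2 * pi * (y $ i - y0 $ i)))"
      using sum_mono[of UNIV "\<lambda>_. -1::real" "\<lambda>i. cos (2 * pi * (y $ i - y0 $ i))"] by (simp add: n_def)
    then have "-1 \<le> (\<Sum>i\<in>UNIV. cos (2 * pi * (y $ i - y0 $ i))) / n" using n by (simp add: field_simps)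
    then show ?thesis using \<kappa> by (simp add: q_def)
  qed
  have q_far: "h y \<ge> h y0 / 2" if y: "y \<in> cbox 0 1" and q1: "q y > 1" for y
  proof (rule near, rule ccontr)
    fix i assume "\<not> \<bar>y $ i - y0 $ i\<bar> \<le> \<delta>"
    \<comment> \<open>Since \<open>y0\<close> keeps distance \<delta> from the faces,
      \<open>y\<close> cannot be close to \<open>y0\<close> modulo 1 through an opposite
      face.\<close>
    moreover have "\<bar>y $ i - y0 $ i\<bar> \<le> 1 - \<delta>"
      using y \<delta>(4)[of i] \<delta>(5)[of i] by (auto simp: mem_box_cart abs_le_iff dest!: spec[of _ i])
    ultimately have a: "\<delta> \<le> \<bar>y $ i - y0 $ i\<bar>" "\<bar>y $ i - y0 $ i\<bar> \<le> 1 - \<delta>" by auto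
    have "cos (2 * pi * (y $ i - y0 $ i)) = cos (2 * pi * \<bar>y $ i - y0 $ i\<bar>)"
      by (cases "y $ i - y0 $ i \<ge> 0") (auto simp: abs_if right_diff_distrib cos_diff)
    also have "\<dots> \<le> cos (2 * pi * \<delta>)"
    proof (cases "\<bar>y $ i - y0 $ i\<bar> \<le> 1/2")
      case True
      then show ?thesis using a \<delta> by (intro cos_monotone_0_pi_le) auto
    next
      case False
      have "cos (2 * pi * \<bar>y $ i - y0 $ i\<bar>) = cos (2 * pi * (1 - \<bar>y $ i - y0 $ i\<bar>))"
        by (simp add: right_diff_distrib cos_diff)
      also have "\<dots> \<le> cos (2 * pi * \<delta>)" using a \<delta> False by (intro cos_monotone_0_pi_le) auto
      finally show ?thesis .
    qed
    finally have ci: "cos (2 * pi * (y $ i - y0 $ i)) \<le> cos (2 * pi * \<delta>)" .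
    have "(\<Sum>i\<in>UNIV. cos (2 * pi * (y $ i - y0 $ i)))
        = cos (2 * pi * (y $ i - y0 $ i)) + (\<Sum>j\<in>UNIV - {i}. cos (2 * pi * (y $ j - y0 $ j)))"
      by (subst sum.remove[of _ i]) auto
    also have "\<dots> \<le> cos (2 * pi * \<delta>) + (\<Sum>j\<in>UNIV - {i}. 1)"
      using ci by (intro add_mono sum_mono) auto
    also have "(\<Sum>j\<in>UNIV - {i}. 1) = n - 1" using n1 by (simp add: n_def card_Diff_singleton of_nat_diff Suc_leI)
    finally have "\<kappa> + (\<Sum>i\<in>UNIV. cos (2 * pi * (y $ i - y0 $ i))) / n \<le> \<kappa> + (cos (2 * pi * \<delta>) + (n - 1)) / n"
      using n by (intro add_left_mono divide_right_mono) auto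
    also have "\<dots> = 1" unfolding \<kappa>_def using n by (simp add: field_simps)
    finally have "q y \<le> 1" unfolding q_def .
    then show False using q1 by simp
  qed
  obtain M where M: "M > 0" "\<And>y. y \<in> cbox 0 1 \<Longrightarrow> \<bar>h y\<bar> \<le> M"
    using compact_imp_bounded[OF compact_continuous_image[OF continuous_on_subset[OF h] compact_cbox[of "0::real^'n" 1]]]
    by (auto simp: bounded_pos)
  \<comment> \<open>A bound uniform in \<open>N\<close>: where \<open>q > 1\<close> the integrand is
    nonnegative, and elsewhere the modulus of \<open>q\<close> is at most 1.\<close>
  have lower: "h y * q y ^ N \<ge> - M" if y: "y \<in> cbox 0 1" for y N
  proof (cases "q y > 1")
    case True
    then have "0 \<le> h y * q y ^ N" using q_far[OF y True] h0 by (intro mult_nonneg_nonneg) auto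
    then show ?thesis using M by linarith
  next
    case False
    then have "\<bar>q y\<bar> ^ N \<le> 1" using q_ge[of y] by (intro power_le_one) auto
    then have "\<bar>h y * q y ^ N\<bar> \<le> M * 1"
      unfolding abs_mult power_abs using M(2)[OF y] by (intro mult_mono) auto
    then show ?thesis by (simp add: abs_le_iff)
  qed
  \<comment> \<open>On the smaller cube each cosine is at least \<open>1 - \<kappa> / 2\<close>,
    hence \<open>q\<close> is at least \<open>1 + \<kappa> / 2\<close> and its powers grow
    geometrically.\<close>
  have "\<exists>r>0. r \<le> \<delta> \<and> (\<forall>t. \<bar>t\<bar> \<le> r \<longrightarrow> cos (2 * pi * t) \<ge> 1 - \<kappa> / 2)"
  proof -
    have "isCont (\<lambda>t. cos (2 * pi * t)) 0" by (intro continuous_intros)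
    then have "\<forall>e>0. \<exists>d>0. \<forall>t. dist t 0 < d \<longrightarrow> dist (cos (2 * pi * t)) (cos (2 * pi * 0)) < e"
      unfolding continuous_at_eps_delta .
    from this[rule_format, OF half_gt_zero[OF \<kappa>]]
    obtain r where r: "r > 0" "\<And>t. \<bar>t\<bar> < r \<Longrightarrow> \<bar>cos (2 * pi * t) - 1\<bar> < \<kappa> / 2"
      by (auto simp: dist_real_def)
    have "cos (2 * pi * t) \<ge> 1 - \<kappa> / 2" if "\<bar>t\<bar> < r" for t using r(2)[OF that] by linarith
    then show ?thesis using \<delta> r(1) by (intro exI[of _ "min \<delta> (r / 2)"]) (auto simp: less_imp_le)
  qed
  then obtain r where r: "r > 0" "r \<le> \<delta>" "\<And>t. \<bar>t\<bar> \<le> r \<Longrightarrow> cos (2 * pi * t) \<ge> 1 - \<kappa> / 2" by blast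
  define A where "A = cbox (\<chi> i. y0 $ i - r) (\<chi> i. y0 $ i + r)"
  have AQ: "A \<subseteq> cbox 0 1" unfolding A_def
  proof
    fix y assume y: "y \<in> cbox (\<chi> i. y0 $ i - r) (\<chi> i. y0 $ i + r)"
    show "y \<in> cbox 0 1" unfolding mem_box_cart
    proof
      fix i
      have "y0 $ i - r \<le> y $ i" "y $ i \<le> y0 $ i + r" using y by (auto simp: mem_box_cart)
      then show "0 $ i \<le> y $ i \<and> y $ i \<le> 1 $ i" using \<delta>(4)[of i] \<delta>(5)[of i] r(2) by simp
    qed
  qed
  have q_near: "h y * q y ^ N \<ge> h y0 / 2 * (1 + \<kappa> / 2) ^ N" if y: "y \<in> A" for y N
  proof -
    have yi: "\<bar>y $ i - y0 $ i\<bar> \<le> r" for i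
      using y unfolding A_def by (auto simp: mem_box_cart abs_le_iff dest!: spec[of _ i])
    have "n * (1 - \<kappa> / 2) \<le> (\<Sum>i\<in>UNIV. cos (2 * pi * (y $ i - y0 $ i)))"
      using sum_mono[of UNIV "\<lambda>_. 1 - \<kappa> / 2" "\<lambda>i. cos (2 * pi * (y $ i - y0 $ i))"] r(3)[OF yi] by (simp add: n_def)
    then have "1 + \<kappa> / 2 \<le> q y" unfolding q_def using n by (simp add: field_simps)
    moreover have "h y0 / 2 \<le> h y" by (rule near) (use yi r(2) in \<open>auto intro: order_trans\<close>)
    ultimately show ?thesis using h0 \<kappa> by (intro mult_mono power_mono) auto
  qed
  have hq: "continuous_on UNIV (\<lambda>y. h y * q y ^ N)" for N by (intro continuous_intros h q_cont)
  have hq_int: "(\<lambda>y. h y * q y ^ N) integrable_on cbox 0 1" for N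
    by (rule integrable_continuous[OF continuous_on_subset[OF hq subset_UNIV]])
  \<comment> \<open>Multiplication by a cosine of the i-th coordinate shifts the frequency by plus
    or minus \<open>axis i 1\<close>, so the induction on the power must run over all integer
    frequencies at once.\<close>
  have zero: "integral (cbox 0 1) (\<lambda>y. complex_of_real (h y * q y ^ N) * cis (2 * pi * (m \<bullet> y))) = 0"
    if "\<And>i. m $ i \<in> \<int>" for N m
    using that
  proof (induction N arbitrary: m)
    case 0
    then show ?case using orth by simp
  next
    case (Suc N)
    let ?G = "\<lambda>m y. complex_of_real (h y * q y ^ N) * cis (2 * pi * (m \<bullet> y))"
    have "continuous_on (cbox 0 1) (\<lambda>y::real^'n. cis (2 * pi * (m \<bullet> y)))" for m
      unfolding cis_conv_exp by (intro continuous_intros)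
    then have Gi: "?G m integrable_on cbox 0 1" for m
      by (intro integrable_continuous continuous_on_mult continuous_on_of_real
            continuous_on_subset[OF hq subset_UNIV])
    have e: "complex_of_real (h y * q y ^ Suc N) * cis (2 * pi * (m \<bullet> y))
      = complex_of_real \<kappa> * ?G m y + (\<Sum>i\<in>UNIV. cis (- (2 * pi * y0 $ i)) / (2 * n) * ?G (m + axis i 1) y + cis (2 * pi * y0 $ i) / (2 * n) * ?G (m - axis i 1) y)" for y
    proof -
      have "complex_of_real (cos (2 * pi * (y $ i - y0 $ i))) * cis (2 * pi * (m \<bullet> y))
          = (cis (- (2 * pi * y0 $ i)) * cis (2 * pi * ((m + axis i 1) \<bullet> y)) + cis (2 * pi * y0 $ i) * cis (2 * pi * ((m - axis i 1) \<bullet> y))) / 2" for i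
      proof -
        let ?t = "2 * pi * (y $ i - y0 $ i)"
        have "complex_of_real (cos ?t) = (cis ?t + cis (- ?t)) / 2" by (simp add: complex_eq_iff)
        then have "complex_of_real (cos ?t) * cis (2 * pi * (m \<bullet> y)) = (cis (?t + 2 * pi * (m \<bullet> y)) + cis (- ?t + 2 * pi * (m \<bullet> y))) / 2"
          by (simp only: times_divide_eq_left distrib_right cis_mult)
        also have "?t + 2 * pi * (m \<bullet> y) = - (2 * pi * y0 $ i) + 2 * pi * ((m + axis i 1) \<bullet> y)"
          by (simp add: inner_simps inner_axis' algebra_simps)
        also have "- ?t + 2 * pi * (m \<bullet> y) = (2 * pi * y0 $ i) + 2 * pi * ((m - axis i 1) \<bullet> y)"
          by (simp add: inner_simps inner_axis' algebra_simps)
        finally show ?thesis by (simp add: cis_mult)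
      qed
      note cos_shift = this
      have alg: "A * B * C / complex_of_real n = p / complex_of_real (2 * n) * (A * X) + r / complex_of_real (2 * n) * (A * Y)"
        if "B * C = (p * X + r * Y) / 2" for A B C p r X Y :: complex
        using that by (simp add: mult.assoc distrib_left add_divide_distrib mult_ac)
      have *: "complex_of_real (h y * q y ^ N) * complex_of_real (cos (2 * pi * (y $ i - y0 $ i))) * cis (2 * pi * (m \<bullet> y)) / n
         = cis (- (2 * pi * y0 $ i)) / (2 * n) * ?G (m + axis i 1) y + cis (2 * pi * y0 $ i) / (2 * n) * ?G (m - axis i 1) y" for i
        by (rule alg[OF cos_shift])
      have "complex_of_real (h y * q y ^ Suc N) * cis (2 * pi * (m \<bullet> y))
        = complex_of_real \<kappa> * ?G m y + (\<Sum>i\<in>UNIV. complex_of_real (h y * q y ^ N) * complex_of_real (cos (2 * pi * (y $ i - y0 $ i))) * cis (2 * pi * (m \<bullet> y)) / n)"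
        by (simp add: q_def[of y] algebra_simps sum_distrib_left sum_distrib_right sum_divide_distrib)
      then show ?thesis unfolding * .
    qed
    have I: "integral (cbox 0 1) (?G m') = 0" if "\<And>i. m' $ i \<in> \<int>" for m' using Suc.IH that by blast
    have "((\<lambda>y. complex_of_real \<kappa> * ?G m y + (\<Sum>i\<in>UNIV. cis (- (2 * pi * y0 $ i)) / (2 * n) * ?G (m + axis i 1) y + cis (2 * pi * y0 $ i) / (2 * n) * ?G (m - axis i 1) y))
       has_integral (complex_of_real \<kappa> * 0 + (\<Sum>i\<in>(UNIV::'n set). cis (- (2 * pi * y0 $ i)) / (2 * n) * 0 + cis (2 * pi * y0 $ i) / (2 * n) * 0))) (cbox 0 1)"
    proof (intro has_integral_add has_integral_sum has_integral_mult_right finite)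
      have *: "(?G m' has_integral 0) (cbox 0 1)" if "\<And>i. m' $ i \<in> \<int>" for m'
        using integrable_integral[OF Gi[of m']] I[OF that] by simp
      show "(?G m has_integral 0) (cbox 0 1)" using Suc.prems by (rule *)
      show "(?G (m + axis i 1) has_integral 0) (cbox 0 1)" "(?G (m - axis i 1) has_integral 0) (cbox 0 1)" for i
        by (rule *; use Suc.prems in \<open>auto intro!: Ints_add Ints_diff simp: axis_def\<close>)+
    qed
    then show ?case unfolding e by (simp add: integral_unique)
  qed
  have real_zero: "integral (cbox 0 1) (\<lambda>y. h y * q y ^ N) = 0" for N
  proof -
    have "((\<lambda>y. complex_of_real (h y * q y ^ N)) has_integral complex_of_real (integral (cbox 0 1) (\<lambda>y. h y * q y ^ N))) (cbox 0 1)"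
      using has_integral_linear[OF integrable_integral[OF hq_int] bounded_linear_of_real] by (simp add: o_def)
    then show ?thesis using zero[of 0 N] by (simp add: integral_unique)
  qed
  have bound: "h y0 / 2 * (1 + \<kappa> / 2) ^ N * measure lborel A \<le> M" for N
  proof -
    let ?c = "h y0 / 2 * (1 + \<kappa> / 2) ^ N"
    have c0: "?c \<ge> 0" using h0 \<kappa> by simp
    have one: "((\<lambda>y::real^'n. M) has_integral M) (cbox 0 1)"
      using has_integral_const[of M "0::real^'n" 1] interval_ne_empty_cart(1)[of "0::real^'n" 1] by (simp add: content_cbox_if_cart)
    have "((\<lambda>y. ?c) has_integral measure lborel A *\<^sub>R ?c) A" unfolding A_def by (rule has_integral_const)
    then have "((\<lambda>y. if y \<in> A then ?c else 0) has_integral measure lborel A *\<^sub>R ?c) (cbox 0 1)"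
      using AQ by (simp add: has_integral_restrict)
    from has_integral_diff[OF this one]
    have 1: "((\<lambda>y. (if y \<in> A then ?c else 0) - M) has_integral measure lborel A *\<^sub>R ?c - M) (cbox 0 1)" .
    have 2: "((\<lambda>y. h y * q y ^ N) has_integral 0) (cbox 0 1)"
      using integrable_integral[OF hq_int[of N]] unfolding real_zero .
    have "measure lborel A *\<^sub>R ?c - M \<le> 0"
    proof (rule has_integral_le[OF 1 2])
      fix y :: "real^'n" assume y: "y \<in> cbox 0 1"
      show "(if y \<in> A then ?c else 0) - M \<le> h y * q y ^ N"
        using q_near[of y N] lower[OF y, of N] M(1) by auto
    qed
    then show ?thesis by (simp add: mult.commute)
  qed
  have cA: "measure lborel A > 0" unfolding A_def using r(1)
    by (simp add: content_cbox_if_cart interval_eq_empty_cart not_le prod_pos)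
  then obtain N where "M / (h y0 / 2 * measure lborel A) < (1 + \<kappa> / 2) ^ N"
    using real_arch_pow[of "1 + \<kappa> / 2"] \<kappa> by auto
  then have "M < h y0 / 2 * (1 + \<kappa> / 2) ^ N * measure lborel A"
    using cA h0 by (simp add: field_simps)
  then show False using bound[of N] by simp
qed

text \<open>The one-sided statement is applied to \<open>h\<close> and to \<open>- h\<close> in the
  open cell; continuity carries the zero to the faces and periodicity to the whole space.\<close>

proposition trig_orthogonal_imp_zero:
  fixes h :: "real^'n \<Rightarrow> real"
  assumes h: "continuous_on UNIV h" "periodic (mat 1) h"
    and orth: "\<And>m. (\<And>i. m $ i \<in> \<int>) \<Longrightarrow> integral (cbox 0 1) (\<lambda>y. complex_of_real (h y) * cis (2 * pi * (m \<bullet> y))) = 0"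
  shows "h y = 0"
proof -
  have box: "h z = 0" if "z \<in> box 0 1" for z
  proof (rule antisym)
    show "h z \<le> 0" by (rule trig_orthogonal_imp_nonpos[OF h(1) orth that])
    have "integral (cbox 0 1) (\<lambda>y. complex_of_real (- h y) * cis (2 * pi * (m \<bullet> y))) = 0" if "\<And>i. m $ i \<in> \<int>" for m
      using orth[OF that] by simp
    then have "- h z \<le> 0"
      using trig_orthogonal_imp_nonpos[of "\<lambda>y. - h y", OF _ _ that] h(1) continuous_on_minus by blast
    then show "0 \<le> h z" by simp
  qed
  have "closure (box 0 1) = (cbox 0 1 :: (real^'n) set)"
    by (rule closure_box) (auto simp: interval_ne_empty_cart)
  then have cbox: "h z = 0" if "z \<in> cbox 0 1" for z
    using continuous_constant_on_closure[of "box 0 1" h 0 z] continuous_on_subset[OF h(1)] box that by auto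
  have "h y \<in> h ` cbox 0 1" using periodic_range_unit_cell[OF h(2)] by auto
  then show ?thesis using cbox by auto
qed

section \<open>The fractional Laplacian as a singular integral\<close>

text \<open>The marginal formula in the direction of \<open>k\<close> leaves an integral over the
  line, from which scaling extracts the power of \<open>norm k\<close>. On the line the jump density
  is itself the Levy kernel of dimension one, so the same scaling lemma applies.\<close>

lemma levy_symbol:
  fixes k :: "'a::euclidean_space"
  assumes \<alpha>: "0 < \<alpha>"
    and B: "B > 0" "\<And>(e::'a) f. norm e = 1 \<Longrightarrow> f \<in> borel_measurable borel \<Longrightarrow>
       (\<integral>\<^sup>+z. f (z \<bullet> e) * ennreal (levy_kernel \<alpha> z) \<partial>lborel)
       = ennreal B * (\<integral>\<^sup>+x. f x * ennreal (\<bar>x\<bar> powr (- (1 + 2 * \<alpha>))) \<partial>lborel)"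
    and A: "A > 0" "(\<integral>\<^sup>+x. ennreal (1 - cos x) * ennreal (\<bar>x\<bar> powr (- (1 + 2 * \<alpha>))) \<partial>lborel) = ennreal A"
  shows "has_bochner_integral lborel (\<lambda>z. (1 - cos (k \<bullet> z)) * levy_kernel \<alpha> z) (B * A * norm k powr (2 * \<alpha>))"
proof (rule has_bochner_integral_nn_integral)
  show "(\<integral>\<^sup>+z. ennreal ((1 - cos (k \<bullet> z)) * levy_kernel \<alpha> z) \<partial>lborel) = ennreal (B * A * norm k powr (2 * \<alpha>))"
  proof (cases "k = 0")
    case False
    define r where "r = norm k"
    define e where "e = k /\<^sub>R r"
    have r: "r > 0" and e: "norm e = 1" and k: "k = r *\<^sub>R e" using False by (auto simp: r_def e_def)
    have "(\<integral>\<^sup>+z. ennreal ((1 - cos (k \<bullet> z)) * levy_kernel \<alpha> z) \<partial>lborel)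
        = (\<integral>\<^sup>+z. ennreal (1 - cos (r * (z \<bullet> e))) * ennreal (levy_kernel \<alpha> z) \<partial>lborel)"
      by (simp add: k ennreal_mult' inner_commute)
    also have "\<dots> = ennreal B * (\<integral>\<^sup>+x. ennreal (1 - cos (r * x)) * ennreal (\<bar>x\<bar> powr (- (1 + 2 * \<alpha>))) \<partial>lborel)"
      by (rule B(2)[OF e]) measurable
    also have "(\<integral>\<^sup>+x. ennreal (1 - cos (r * x)) * ennreal (\<bar>x\<bar> powr (- (1 + 2 * \<alpha>))) \<partial>lborel)
        = ennreal (r powr (2 * \<alpha>)) * ennreal A"
      using nn_integral_levy_scaleR[of "\<lambda>x::real. ennreal (1 - cos x)" r \<alpha>] r A(2)
      by (simp add: levy_kernel_def)
    finally show ?thesis using A(1) B(1) by (simp add: r_def ennreal_mult[symmetric] mult_ac)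
  qed simp
qed (use A(1) B(1) in auto)

lemma cosine_integral_positive:
  "(\<integral>\<^sup>+x. ennreal (1 - cos x) * ennreal (\<bar>x\<bar> powr (- (1 + 2 * \<alpha>))) \<partial>lborel) > 0"
proof (rule ccontr)
  assume "\<not> ?thesis"
  then have "AE x in lborel. ennreal (1 - cos x) * ennreal (\<bar>x\<bar> powr (- (1 + 2 * \<alpha>))) = 0"
    by (subst (asm) not_gr_zero, subst (asm) nn_integral_0_iff_AE) auto
  moreover have "ennreal (1 - cos x) * ennreal (\<bar>x\<bar> powr (- (1 + 2 * \<alpha>))) \<noteq> 0" if "x \<in> {0<..<pi}" for x
    using that cos_monotone_0_pi[of 0 x] by (auto simp: ennreal_eq_0_iff)
  ultimately have "AE x in lborel. x \<notin> {0<..<pi}" by (auto elim!: eventually_mono)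
  then have "{0<..<pi} \<in> null_sets lborel" by (subst (asm) AE_iff_null_sets[symmetric]) auto
  then show False by (auto simp: null_sets_def)
qed

text \<open>Minus one half of the symmetric second difference. With this sign its Fourier symbol is
  \<open>1 - cos (k \<bullet> z)\<close>, and the cancellation of the first-order terms lets the
  singular integral converge absolutely, without a principal value.\<close>

definition second_diff :: "('a::real_vector \<Rightarrow> real) \<Rightarrow> 'a \<Rightarrow> 'a \<Rightarrow> real" where
  "second_diff f x z = f x - f (x + z) / 2 - f (x - z) / 2"

lemma continuous_second_diff:
  fixes f :: "'a::euclidean_space \<Rightarrow> real"
  assumes "continuous_on UNIV f"
  shows "continuous_on UNIV (\<lambda>x. second_diff f x z)" "continuous_on UNIV (second_diff f x)"
  unfolding second_diff_def[abs_def]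
  by (intro continuous_intros continuous_on_compose2[OF assms]; simp)+

lemma levy_moment_integrable:
  assumes "0 < \<alpha>" "\<alpha> < 1"
  shows "integrable lborel (\<lambda>z::'a::euclidean_space. min 1 ((norm z)\<^sup>2) * levy_kernel \<alpha> z)"
  by (rule integrableI_nonneg) (use nn_integral_levy_moment_finite[OF assms, where 'a='a] in auto)

lemma second_diff_levy_integrable:
  fixes f :: "'a::euclidean_space \<Rightarrow> real"
  assumes \<alpha>: "0 < \<alpha>" "\<alpha> < 1" and f: "continuous_on UNIV f"
    and C: "\<And>x z. \<bar>second_diff f x z\<bar> \<le> C * min 1 ((norm z)\<^sup>2)"
  shows "integrable lborel (\<lambda>z. second_diff f x z * levy_kernel \<alpha> z)"
proof (rule Bochner_Integration.integrable_bound[OF integrable_mult_right[OF levy_moment_integrable[OF \<alpha>], of C]])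
  have [measurable]: "second_diff f x \<in> borel_measurable borel"
    by (rule borel_measurable_continuous_onI[OF continuous_second_diff(2)[OF f]])
  show "(\<lambda>z. second_diff f x z * levy_kernel \<alpha> z) \<in> borel_measurable lborel" by measurable
  show "AE z in lborel. norm (second_diff f x z * levy_kernel \<alpha> z) \<le> norm (C * (min 1 ((norm z)\<^sup>2) * levy_kernel \<alpha> z))"
  proof (intro always_eventually allI)
    fix z
    have "norm (second_diff f x z * levy_kernel \<alpha> z) \<le> C * min 1 ((norm z)\<^sup>2) * levy_kernel \<alpha> z"
      using mult_right_mono[OF C[of x z] levy_kernel_nonneg[of \<alpha> z]] by (simp add: abs_mult)
    then show "norm (second_diff f x z * levy_kernel \<alpha> z) \<le> norm (C * (min 1 ((norm z)\<^sup>2) * levy_kernel \<alpha> z))"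
      by (simp add: mult.assoc)
  qed
qed

lemma continuous_levy_operator:
  fixes f :: "'a::euclidean_space \<Rightarrow> real"
  assumes \<alpha>: "0 < \<alpha>" "\<alpha> < 1" and f: "continuous_on UNIV f"
    and C: "\<And>x z. \<bar>second_diff f x z\<bar> \<le> C * min 1 ((norm z)\<^sup>2)"
  shows "continuous_on UNIV (\<lambda>x. LINT z|lborel. second_diff f x z * levy_kernel \<alpha> z)"
  unfolding continuous_on_sequentially
proof (intro ballI allI impI)
  fix u :: "nat \<Rightarrow> 'a" and a assume u: "(\<forall>n. u n \<in> UNIV) \<and> u \<longlonglongrightarrow> a"
  have [measurable]: "second_diff f x \<in> borel_measurable borel" for x
    by (rule borel_measurable_continuous_onI[OF continuous_second_diff(2)[OF f]])
  show "((\<lambda>x. LINT z|lborel. second_diff f x z * levy_kernel \<alpha> z) \<circ> u) \<longlonglongrightarrow> (LINT z|lborel. second_diff f a z * levy_kernel \<alpha> z)"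
    unfolding o_def
  proof (rule integral_dominated_convergence[where w = "\<lambda>z. C * (min 1 ((norm z)\<^sup>2) * levy_kernel \<alpha> z)"])
    show "integrable lborel (\<lambda>z::'a. C * (min 1 ((norm z)\<^sup>2) * levy_kernel \<alpha> z))"
      by (intro integrable_mult_right levy_moment_integrable \<alpha>)
    show "AE z in lborel. (\<lambda>n. second_diff f (u n) z * levy_kernel \<alpha> z) \<longlonglongrightarrow> second_diff f a z * levy_kernel \<alpha> z"
      using u by (intro always_eventually allI tendsto_mult tendsto_const
        continuous_on_tendsto_compose[OF continuous_second_diff(1)[OF f]]) auto
    show "AE z in lborel. norm (second_diff f (u n) z * levy_kernel \<alpha> z) \<le> C * (min 1 ((norm z)\<^sup>2) * levy_kernel \<alpha> z)" for n
      using mult_right_mono[OF C levy_kernel_nonneg] by (intro always_eventually allI) (simp add: abs_mult mult.assoc)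
  qed measurable
qed

section \<open>Fourier coefficients of the singular integral\<close>

lemma wave_vector_periodic:
  fixes P :: "real^'n^'n" and f :: "real^'n \<Rightarrow> real"
  assumes k: "k \<in> wave_vectors P" and f: "periodic P f"
  shows "periodic (mat 1) (\<lambda>y. complex_of_real (f (P *v y)) * cis (- (k \<bullet> (P *v y))))"
  unfolding periodic_mat_1
proof (intro allI)
  fix y i
  obtain m where m: "k \<bullet> column i P / (2 * pi) = of_int m"
    using k unfolding wave_vectors_def by (auto elim: Ints_cases)
  have c: "cis (- (k \<bullet> column i P)) = 1"
  proof -
    have "- (k \<bullet> column i P) = 2 * pi * of_int (- m)" using m by (simp add: field_simps)
    then show ?thesis by (metis Ints_of_int cis_multiple_2pi)
  qed
  have "cis (- (k \<bullet> (P *v y + column i P))) = cis (- (k \<bullet> (P *v y))) * cis (- (k \<bullet> column i P))"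
    by (simp add: cis_mult inner_add_right)
  then show "complex_of_real (f (P *v (y + axis i 1))) * cis (- (k \<bullet> (P *v (y + axis i 1)))) =
        complex_of_real (f (P *v y)) * cis (- (k \<bullet> (P *v y)))"
    using f c by (simp add: matrix_vector_right_distrib matrix_vector_mult_basis periodic_def)
qed

lemma continuous_fourier_integrand:
  fixes P :: "real^'n^'n" and f :: "real^'n \<Rightarrow> real"
  assumes "continuous_on UNIV f"
  shows "continuous_on UNIV (\<lambda>y. complex_of_real (f (P *v y)) * cis (- (k \<bullet> (P *v y))))"
  unfolding cis_conv_exp
  by (intro continuous_intros continuous_pullback assms matrix_vector_mult_linear_continuous_on)

lemma fourier_coeff_eq_integral:
  fixes P :: "real^'n^'n" and f :: "real^'n \<Rightarrow> real"
  assumes "continuous_on UNIV f"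
  shows "fourier_coeff P f k = integral (cbox 0 1) (\<lambda>y. complex_of_real (f (P *v y)) * cis (- (k \<bullet> (P *v y))))"
  unfolding fourier_coeff_def by (rule set_integral_unit_cell(2)[OF continuous_fourier_integrand[OF assms]])

lemma fourier_coeff_translate:
  fixes P :: "real^'n^'n" and f :: "real^'n \<Rightarrow> real"
  assumes P: "invertible P" and f: "continuous_on UNIV f" "periodic P f" and k: "k \<in> wave_vectors P"
  shows "fourier_coeff P (\<lambda>x. f (x + z)) k = cis (k \<bullet> z) * fourier_coeff P f k"
proof -
  obtain a where a: "z = P *v a" by (rule invertible_vec_mult_surj[OF P])
  let ?F = "\<lambda>y. complex_of_real (f (P *v y)) * cis (- (k \<bullet> (P *v y)))"
  have "complex_of_real (f (P *v y + z)) * cis (- (k \<bullet> (P *v y))) = cis (k \<bullet> z) * ?F (y + a)" for y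
    by (simp add: a matrix_vector_right_distrib inner_add_right cis_mult mult.left_commute)
  then have "fourier_coeff P (\<lambda>x. f (x + z)) k = integral (cbox 0 1) (\<lambda>y. cis (k \<bullet> z) * ?F (y + a))"
    by (subst fourier_coeff_eq_integral[OF continuous_translate[OF f(1)]]) simp
  also have "\<dots> = cis (k \<bullet> z) * integral (cbox 0 1) (\<lambda>y. ?F (y + a))" by simp
  also have "integral (cbox 0 1) (\<lambda>y. ?F (y + a)) = integral (cbox 0 1) ?F"
    by (rule unit_cell_integral_shift[OF wave_vector_periodic[OF k f(2)] continuous_fourier_integrand[OF f(1)]])
  also have "\<dots> = fourier_coeff P f k" by (rule fourier_coeff_eq_integral[OF f(1), symmetric])
  finally show ?thesis .
qed

lemma fourier_coeff_second_diff:
  fixes P :: "real^'n^'n" and f :: "real^'n \<Rightarrow> real"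
  assumes P: "invertible P" and f: "continuous_on UNIV f" "periodic P f" and k: "k \<in> wave_vectors P"
  shows "fourier_coeff P (\<lambda>x. second_diff f x z) k = complex_of_real (1 - cos (k \<bullet> z)) * fourier_coeff P f k"
proof -
  let ?E = "\<lambda>y. cis (- (k \<bullet> (P *v y)))"
  note int = continuous_fourier_integrand[THEN set_integral_unit_cell(1)]
  have tr: "continuous_on UNIV (\<lambda>x. f (x + a))" for a by (rule continuous_translate[OF f(1)])
  have "fourier_coeff P (\<lambda>x. second_diff f x z) k
      = (LINT y:cbox 0 1|lborel. (complex_of_real (f (P *v y)) * ?E y - complex_of_real (f (P *v y + z)) * ?E y / 2 - complex_of_real (f (P *v y + (- z))) * ?E y / 2))"
    unfolding fourier_coeff_def second_diff_def by (simp add: algebra_simps)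
  also have "\<dots> = fourier_coeff P f k - fourier_coeff P (\<lambda>x. f (x + z)) k / 2 - fourier_coeff P (\<lambda>x. f (x + - z)) k / 2"
    unfolding fourier_coeff_def
    using int[OF f(1), of P k] int[OF tr, of P z k] int[OF tr, of P "-z" k]
    by (subst set_integral_diff; (subst set_integral_diff)?) (auto intro!: set_integral_diff set_integrable_divide)
  also have "\<dots> = complex_of_real (1 - cos (k \<bullet> z)) * fourier_coeff P f k"
  proof -
    have "complex_of_real (1 - cos (k \<bullet> z)) = 1 - cis (k \<bullet> z) / 2 - cis (k \<bullet> (- z)) / 2"
      by (simp add: complex_eq_iff)
    then show ?thesis
      by (simp only: fourier_coeff_translate[OF P f k] left_diff_distrib times_divide_eq_left mult_1)
  qed
  finally show ?thesis .
qed

text \<open>The bound by \<open>C * min 1 ((norm z)\<^sup>2)\<close> is uniform in \<open>x\<close>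
  and integrable against the kernel, so the double integral over cell and space converges
  absolutely. Fubini reduces the claim to the symbol of a single second difference.\<close>

lemma fourier_coeff_levy_operator:
  fixes P :: "real^'n^'n" and f :: "real^'n \<Rightarrow> real"
  assumes \<alpha>: "0 < \<alpha>" "\<alpha> < 1" and P: "invertible P" and f: "continuous_on UNIV f" "periodic P f"
    and C: "\<And>x z. \<bar>second_diff f x z\<bar> \<le> C * min 1 ((norm z)\<^sup>2)"
    and k: "k \<in> wave_vectors P"
    and symb: "has_bochner_integral lborel (\<lambda>z. (1 - cos (k \<bullet> z)) * levy_kernel \<alpha> z) s"
  shows "fourier_coeff P (\<lambda>x. LINT z|lborel. second_diff f x z * levy_kernel \<alpha> z) k = complex_of_real s * fourier_coeff P f k"
proof -
  let ?E = "\<lambda>y. cis (- (k \<bullet> (P *v y)))"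
  let ?Q = "cbox 0 1 :: (real^'n) set"
  let ?K = "levy_kernel \<alpha> :: real^'n \<Rightarrow> real"
  define F where "F = (\<lambda>(y, z). indicator ?Q y *\<^sub>R (complex_of_real (second_diff f (P *v y) z * ?K z) * ?E y))"
  have C0: "0 \<le> C" using order_trans[OF abs_ge_zero C[of 0 "axis undefined 1"]] by simp
  have [measurable]: "f \<in> borel_measurable borel" by (rule borel_measurable_continuous_onI[OF f(1)])
  have [measurable]: "(\<lambda>y. P *v y) \<in> borel_measurable borel"
    by (rule borel_measurable_continuous_onI[OF matrix_vector_mult_linear_continuous_on])
  have [measurable]: "?E \<in> borel_measurable borel"
    by (rule borel_measurable_continuous_onI) (auto simp: cis_conv_exp intro!: continuous_intros matrix_vector_mult_linear_continuous_on)
  have [measurable]: "F \<in> borel_measurable (lborel \<Otimes>\<^sub>M lborel)"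
    unfolding F_def second_diff_def by measurable
  have norm_F: "norm (F (y, z)) \<le> indicator ?Q y * (C * (min 1 ((norm z)\<^sup>2) * ?K z))" for y z
    using mult_right_mono[OF C levy_kernel_nonneg] by (auto simp: F_def norm_mult abs_mult indicator_def mult.assoc)
  have bound_int: "integrable lborel (\<lambda>z. C * (min 1 ((norm z)\<^sup>2) * ?K z))"
    by (intro integrable_mult_right levy_moment_integrable \<alpha>)
  have F1: "integrable lborel (\<lambda>z. F (y, z))" for y
    by (rule Bochner_Integration.integrable_bound[OF integrable_mult_right[OF bound_int, of "indicator ?Q y"]])
       (use norm_F[of y] C0 in \<open>auto intro!: order_trans[OF _ abs_ge_self]\<close>)
  have Fint: "integrable (lborel \<Otimes>\<^sub>M lborel) F"
  proof (rule lborel_pair.Fubini_integrable)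
    show "AE y in lborel. integrable lborel (\<lambda>z. F (y, z))" using F1 by simp
    let ?I = "LINT z|lborel. C * (min 1 ((norm z)\<^sup>2) * ?K z)"
    show "integrable lborel (\<lambda>y. LINT z|lborel. norm (F (y, z)))"
    proof (rule Bochner_Integration.integrable_bound)
      show "integrable lborel (\<lambda>y. indicator ?Q y * ?I)"
        by (intro integrable_mult_left) (simp add: emeasure_lborel_cbox_eq)
      show "AE y in lborel. norm (LINT z|lborel. norm (F (y, z))) \<le> norm (indicator ?Q y * ?I)"
      proof (intro always_eventually allI)
        fix y
        have "(LINT z|lborel. norm (F (y, z))) \<le> (LINT z|lborel. indicator ?Q y * (C * (min 1 ((norm z)\<^sup>2) * ?K z)))"
          by (intro integral_mono norm_F integrable_norm F1 integrable_mult_right bound_int)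
        then show "norm (LINT z|lborel. norm (F (y, z))) \<le> norm (indicator ?Q y * ?I)"
          by (simp add: integral_nonneg_AE order_trans[OF _ abs_ge_self])
      qed
    qed measurable
  qed measurable
  have L: "complex_of_real (LINT z|lborel. second_diff f x z * ?K z) = (LINT z|lborel. complex_of_real (second_diff f x z * ?K z))" for x
    by (rule integral_complex_of_real[symmetric])
  have "fourier_coeff P (\<lambda>x. LINT z|lborel. second_diff f x z * ?K z) k = (LINT y|lborel. LINT z|lborel. F (y, z))"
    unfolding fourier_coeff_def set_lebesgue_integral_def F_def prod.case L
    by (intro Bochner_Integration.integral_cong refl) (simp add: indicator_def)
  also have "\<dots> = (LINT z|lborel. LINT y|lborel. F (y, z))"
    using lborel_pair.Fubini_integral[of "\<lambda>y z. F (y, z)"] Fint by simp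
  also have "\<dots> = (LINT z|lborel. complex_of_real ((1 - cos (k \<bullet> z)) * ?K z) * fourier_coeff P f k)"
  proof (intro Bochner_Integration.integral_cong refl)
    fix z
    have "(LINT y|lborel. F (y, z)) = (LINT y|lborel. complex_of_real (?K z) * (indicator ?Q y *\<^sub>R (complex_of_real (second_diff f (P *v y) z) * ?E y)))"
      unfolding F_def by (intro Bochner_Integration.integral_cong refl) (simp add: indicator_def)
    also have "\<dots> = complex_of_real (?K z) * fourier_coeff P (\<lambda>x. second_diff f x z) k"
      unfolding fourier_coeff_def set_lebesgue_integral_def by (rule integral_mult_right_zero)
    finally show "(LINT y|lborel. F (y, z)) = complex_of_real ((1 - cos (k \<bullet> z)) * ?K z) * fourier_coeff P f k"
      unfolding fourier_coeff_second_diff[OF P f k] by simp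
  qed
  also have "\<dots> = complex_of_real s * fourier_coeff P f k"
    using symb by (subst integral_mult_left_zero, subst integral_complex_of_real) (simp add: has_bochner_integral_integral_eq)
  finally show ?thesis .
qed

text \<open>The dual lattice consists of the vectors 2 pi times the inverse transpose of
  \<open>P\<close> applied to integer vectors. The minus sign in the witness matches the sign
  convention of \<open>fourier_coeff\<close>.\<close>

lemma wave_vector_of_int_vec:
  fixes P :: "real^'n^'n"
  assumes P: "invertible P" and m: "\<And>i. m $ i \<in> \<int>"
  obtains k where "k \<in> wave_vectors P" "\<And>y. - (k \<bullet> (P *v y)) = 2 * pi * (m \<bullet> y)"
proof -
  obtain Q where Q: "Q ** P = mat 1" using P unfolding invertible_def by blast
  define k where "k = (- 2 * pi) *\<^sub>R (m v* Q)"
  have kP: "k \<bullet> (P *v y) = - (2 * pi * (m \<bullet> y))" for y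
  proof -
    have "(m v* Q) \<bullet> (P *v y) = m \<bullet> (Q *v (P *v y))" by (rule dot_lmul_matrix)
    then show ?thesis by (simp add: k_def matrix_vector_mul_assoc Q)
  qed
  have "k \<bullet> column i P / (2 * pi) = - (m $ i)" for i
    using kP[of "axis i 1"] by (simp add: matrix_vector_mult_basis inner_axis)
  then have "k \<in> wave_vectors P" using m by (simp add: wave_vectors_def)
  with kP show ?thesis using that by simp
qed

lemma fourier_coeff_inject:
  fixes P :: "real^'n^'n" and f g :: "real^'n \<Rightarrow> real"
  assumes P: "invertible P" and f: "continuous_on UNIV f" "periodic P f" and g: "continuous_on UNIV g" "periodic P g"
    and eq: "\<And>k. k \<in> wave_vectors P \<Longrightarrow> fourier_coeff P f k = fourier_coeff P g k"
  shows "f = g"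
proof
  fix x
  obtain y where y: "x = P *v y" by (rule invertible_vec_mult_surj[OF P])
  have "f (P *v y) - g (P *v y) = 0"
  proof (rule trig_orthogonal_imp_zero[of "\<lambda>y. f (P *v y) - g (P *v y)"])
    show "continuous_on UNIV (\<lambda>y. f (P *v y) - g (P *v y))"
      by (intro continuous_intros continuous_pullback f g)
    show "periodic (mat 1) (\<lambda>y. f (P *v y) - g (P *v y))"
      using periodic_pullback[OF f(2)] periodic_pullback[OF g(2)] by (simp add: periodic_mat_1)
    fix m :: "real^'n" assume m: "\<And>i. m $ i \<in> \<int>"
    obtain k where k: "k \<in> wave_vectors P" "\<And>y. - (k \<bullet> (P *v y)) = 2 * pi * (m \<bullet> y)"
      using wave_vector_of_int_vec[OF P m] by blast
    have int: "(\<lambda>y. complex_of_real (u (P *v y)) * cis (2 * pi * (m \<bullet> y))) integrable_on cbox 0 1"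
      if "continuous_on UNIV u" for u :: "real^'n \<Rightarrow> real"
      using integrable_continuous[OF continuous_on_subset[OF continuous_fourier_integrand[OF that, of P k] subset_UNIV]]
      unfolding k(2) .
    have "integral (cbox 0 1) (\<lambda>y. complex_of_real (f (P *v y) - g (P *v y)) * cis (2 * pi * (m \<bullet> y)))
        = fourier_coeff P f k - fourier_coeff P g k"
      unfolding fourier_coeff_eq_integral[OF f(1)] fourier_coeff_eq_integral[OF g(1)] k(2)
      by (subst integral_diff[OF int[OF f(1)] int[OF g(1)], symmetric]) (simp add: left_diff_distrib)
    then show "integral (cbox 0 1) (\<lambda>y. complex_of_real (f (P *v y) - g (P *v y)) * cis (2 * pi * (m \<bullet> y))) = 0"
      using eq[OF k(1)] by simp
  qed
  then show "f x = g x" by (simp add: y)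
qed

lemma fourier_coeff_cmult: "fourier_coeff P (\<lambda>x. a * f x) k = complex_of_real a * fourier_coeff P f k"
  unfolding fourier_coeff_def set_lebesgue_integral_def
  by (subst integral_mult_right_zero[symmetric]) (intro Bochner_Integration.integral_cong refl, simp add: mult.assoc scaleR_conv_of_real mult.left_commute)

text \<open>The singular integral is continuous, periodic and has the prescribed Fourier
  coefficients; injectivity of the coefficients identifies it as the function described in
  \<open>frac_laplacian\<close>. The constant \<open>A\<close> is whatever normalisation the symbol
  has.\<close>

proposition frac_laplacian_eq_levy:
  fixes P :: "real^'n^'n" and f :: "real^'n \<Rightarrow> real"
  assumes \<alpha>: "0 < \<alpha>" "\<alpha> < 1" and P: "invertible P" and f: "continuous_on UNIV f" "periodic P f"
    and C: "\<And>x z. \<bar>second_diff f x z\<bar> \<le> C * min 1 ((norm z)\<^sup>2)"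
    and A: "A > 0" and symb: "\<And>k::real^'n. has_bochner_integral lborel (\<lambda>z. (1 - cos (k \<bullet> z)) * levy_kernel \<alpha> z) (A * norm k powr (2 * \<alpha>))"
  shows "frac_laplacian P \<alpha> f x = 1 / A * (LINT z|lborel. second_diff f x z * levy_kernel \<alpha> z)"
proof -
  define g where "g = (\<lambda>x. 1 / A * (LINT z|lborel. second_diff f x z * levy_kernel \<alpha> z))"
  have g: "continuous_on UNIV g" unfolding g_def
    by (intro continuous_intros continuous_levy_operator[OF \<alpha> f(1) C]) (use A in auto)
  have "second_diff f (x + column i P) z = second_diff f x z" for x z i
    using periodic_translate[OF f(2), of z] periodic_translate[OF f(2), of "- z"] f(2)
    by (simp add: second_diff_def periodic_def)
  then have gp: "periodic P g" by (simp add: periodic_def g_def)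
  have gk: "fourier_coeff P g k = complex_of_real (norm k powr (2 * \<alpha>)) * fourier_coeff P f k" if k: "k \<in> wave_vectors P" for k
    unfolding g_def fourier_coeff_cmult fourier_coeff_levy_operator[OF \<alpha> P f C k symb] using A by simp
  have "frac_laplacian P \<alpha> f = g"
    unfolding frac_laplacian_def
  proof (rule the_equality)
    fix h assume h: "continuous_on UNIV h \<and> periodic P h \<and> (\<forall>k\<in>wave_vectors P.
           fourier_coeff P h k = complex_of_real (norm k powr (2 * \<alpha>)) * fourier_coeff P f k)"
    then show "h = g" using gk by (intro fourier_coeff_inject[OF P _ _ g gp]) auto
  qed (use g gp gk in auto)
  then show ?thesis by (simp add: g_def)
qed

section \<open>The dissipative term at a touching point\<close>

definition levy_measure :: "real \<Rightarrow> 'a::euclidean_space measure" where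
  "levy_measure \<alpha> = density lborel (\<lambda>z. ennreal (levy_kernel \<alpha> z))"

lemma sets_levy_measure [simp, measurable_cong]: "sets (levy_measure \<alpha>) = sets borel"
  by (simp add: levy_measure_def)

lemma space_levy_measure [simp]: "space (levy_measure \<alpha>) = UNIV"
  by (simp add: levy_measure_def)

lemma levy_measure_integrable_iff:
  fixes f :: "'a::euclidean_space \<Rightarrow> real"
  assumes "f \<in> borel_measurable borel"
  shows "integrable (levy_measure \<alpha>) f \<longleftrightarrow> integrable lborel (\<lambda>z. f z * levy_kernel \<alpha> z)"
  unfolding levy_measure_def using assms by (subst integrable_density) (auto simp: mult.commute)

lemma levy_measure_integral:
  fixes f :: "'a::euclidean_space \<Rightarrow> real"
  assumes "f \<in> borel_measurable borel"
  shows "(LINT z|levy_measure \<alpha>. f z) = (LINT z|lborel. f z * levy_kernel \<alpha> z)"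
  unfolding levy_measure_def using assms by (subst integral_density) (auto simp: mult.commute)

lemma levy_measure_nn_integral:
  assumes "f \<in> borel_measurable borel"
  shows "(\<integral>\<^sup>+z. f z \<partial>levy_measure \<alpha>) = (\<integral>\<^sup>+z. f z * ennreal (levy_kernel \<alpha> z) \<partial>lborel)"
  unfolding levy_measure_def using assms by (subst nn_integral_density) (auto simp: mult.commute)

lemma orthogonal_transformation_measurable:
  fixes T :: "'a::euclidean_space \<Rightarrow> 'a"
  shows "orthogonal_transformation T \<Longrightarrow> T \<in> borel_measurable borel"
  by (simp add: borel_measurable_continuous_onI linear_continuous_on linear_linear orthogonal_transformation)

lemma levy_measure_distr_orthogonal:
  fixes T :: "'a::euclidean_space \<Rightarrow> 'a"
  assumes T: "orthogonal_transformation T"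
  shows "distr (levy_measure \<alpha>) borel T = levy_measure \<alpha>"
proof (rule measure_eqI)
  fix A assume "A \<in> sets (distr (levy_measure \<alpha>) borel T)"
  then have [measurable]: "A \<in> sets borel" by simp
  note [measurable] = orthogonal_transformation_measurable[OF T]
  have "emeasure (distr (levy_measure \<alpha>) borel T) A = (\<integral>\<^sup>+z. indicator A z \<partial>distr (levy_measure \<alpha>) borel T)" by simp
  also have "\<dots> = (\<integral>\<^sup>+z. indicator A (T z) \<partial>levy_measure \<alpha>)" by (rule nn_integral_distr) auto
  also have "\<dots> = (\<integral>\<^sup>+z. indicator A (T z) * ennreal (levy_kernel \<alpha> z) \<partial>lborel)"
    by (rule levy_measure_nn_integral) measurable
  also have "\<dots> = (\<integral>\<^sup>+z. indicator A z * ennreal (levy_kernel \<alpha> z) \<partial>lborel)"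
    by (rule nn_integral_levy_orthogonal[OF T]) measurable
  also have "\<dots> = (\<integral>\<^sup>+z. indicator A z \<partial>levy_measure \<alpha>)"
    by (rule levy_measure_nn_integral[symmetric]) measurable
  finally show "emeasure (distr (levy_measure \<alpha>) borel T) A = emeasure (levy_measure \<alpha>) A" by simp
qed simp

lemma levy_measure_orthogonal:
  fixes T :: "'a::euclidean_space \<Rightarrow> 'a" and f :: "'a \<Rightarrow> real"
  assumes T: "orthogonal_transformation T" and [measurable]: "f \<in> borel_measurable borel"
  shows "integrable (levy_measure \<alpha>) (\<lambda>z. f (T z)) \<longleftrightarrow> integrable (levy_measure \<alpha>) f"
    and "(LINT z|levy_measure \<alpha>. f (T z)) = (LINT z|levy_measure \<alpha>. f z)"
proof -
  note [measurable] = orthogonal_transformation_measurable[OF T]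
  show "integrable (levy_measure \<alpha>) (\<lambda>z. f (T z)) \<longleftrightarrow> integrable (levy_measure \<alpha>) f"
    using integrable_distr_eq[of T "levy_measure \<alpha>" borel f] by (simp add: levy_measure_distr_orthogonal[OF T])
  show "(LINT z|levy_measure \<alpha>. f (T z)) = (LINT z|levy_measure \<alpha>. f z)"
    using integral_distr[of T "levy_measure \<alpha>" borel f] by (simp add: levy_measure_distr_orthogonal[OF T])
qed

lemma orthogonal_transformation_uminus: "orthogonal_transformation (uminus :: 'a::euclidean_space \<Rightarrow> 'a)"
  by (simp add: orthogonal_transformation_neg orthogonal_transformation_id)

lemma lborel_translate:
  fixes f :: "'a::euclidean_space \<Rightarrow> real"
  assumes [measurable]: "f \<in> borel_measurable borel"
  shows "integrable lborel (\<lambda>z. f (c + z)) \<longleftrightarrow> integrable lborel f"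
    and "(LINT z|lborel. f (c + z)) = (LINT z|lborel. f z)"
  using integrable_distr_eq[of "(+) c" lborel borel f] integral_distr[of "(+) c" lborel borel f]
  by (auto simp: lborel_distr_plus)

lemma levy_measure_bounded_integrable:
  fixes f :: "'a::euclidean_space \<Rightarrow> real"
  assumes \<alpha>: "0 < \<alpha>" "\<alpha> < 1" and [measurable]: "f \<in> borel_measurable borel"
    and r: "r > 0" and f: "\<And>z. \<bar>f z\<bar> \<le> M" "\<And>z. norm z < r \<Longrightarrow> f z = 0"
  shows "integrable (levy_measure \<alpha>) f"
proof (rule Bochner_Integration.integrable_bound)
  have M: "0 \<le> M" using f(1)[of 0] by linarith
  show "integrable (levy_measure \<alpha>) (\<lambda>z::'a. M * max 1 (1 / r\<^sup>2) * min 1 ((norm z)\<^sup>2))"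
    by (intro integrable_mult_right) (subst levy_measure_integrable_iff, auto intro: levy_moment_integrable[OF \<alpha>])
  show "AE z in levy_measure \<alpha>. norm (f z) \<le> norm (M * max 1 (1 / r\<^sup>2) * min 1 ((norm z)\<^sup>2))"
  proof (intro always_eventually allI)
    fix z :: 'a
    have "1 \<le> max 1 (1 / r\<^sup>2) * min 1 ((norm z)\<^sup>2)" if "r \<le> norm z"
    proof (cases "norm z \<ge> 1")
      case True
      then show ?thesis by (simp add: min_absorb1 one_le_power)
    next
      case False
      then have "min 1 ((norm z)\<^sup>2) = (norm z)\<^sup>2" by (simp add: min_absorb2 power_le_one)
      moreover have "r\<^sup>2 \<le> (norm z)\<^sup>2" using that r by (intro power_mono) auto
      ultimately have "1 \<le> 1 / r\<^sup>2 * min 1 ((norm z)\<^sup>2)" using r by (simp add: field_simps)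
      also have "\<dots> \<le> max 1 (1 / r\<^sup>2) * min 1 ((norm z)\<^sup>2)" by (intro mult_right_mono) auto
      finally show ?thesis .
    qed
    then have "\<bar>f z\<bar> \<le> M * (max 1 (1 / r\<^sup>2) * min 1 ((norm z)\<^sup>2))"
    proof (cases "r \<le> norm z")
      case True
      then have "M * 1 \<le> M * (max 1 (1 / r\<^sup>2) * min 1 ((norm z)\<^sup>2))"
        using \<open>r \<le> norm z \<Longrightarrow> _\<close> M by (intro mult_left_mono) auto
      then show ?thesis using f(1)[of z] by linarith
    qed (use f(2)[of z] M in auto)
    then show "norm (f z) \<le> norm (M * max 1 (1 / r\<^sup>2) * min 1 ((norm z)\<^sup>2))" by (simp add: mult.assoc)
  qed
qed measurable

lemma reflection_inner: "norm e = 1 \<Longrightarrow> reflection e z \<bullet> e = - (z \<bullet> e)"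
  by (simp add: reflection_def inner_simps norm_eq_1)

lemma reflection_reflection: "norm e = 1 \<Longrightarrow> reflection e (reflection e z) = z"
  by (simp add: reflection_def inner_simps norm_eq_1)

lemma reflection_minus: "reflection e (- z) = - reflection e z"
  by (simp add: reflection_def)

text \<open>
  Jumps \<open>z\<close> of \<open>x\<close> are coupled with the reflected jumps of \<open>y\<close>, except that
  a jump across the hyperplane of symmetry is matched with a jump of the other point to the same
  place. The latter part of the coupling appears here as the comparison of \<open>h\<close> with its translate, whose
  kernel is smaller by radial monotonicity.
\<close>

lemma levy_coupling:
  fixes f :: "'a::euclidean_space \<Rightarrow> real" and w :: "real \<Rightarrow> real"
  assumes \<alpha>: "0 < \<alpha>" "\<alpha> < 1" and f: "continuous_on UNIV f"
    and C: "\<And>x z. \<bar>second_diff f x z\<bar> \<le> C * min 1 ((norm z)\<^sup>2)"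
    and \<xi>: "\<xi> > 0" and e: "norm e = 1" and xy: "x = y + \<xi> *\<^sub>R e"
    and w[measurable]: "w \<in> borel_measurable borel" and wM: "\<And>s. \<bar>w s\<bar> \<le> M"
    and fw: "\<And>p q. f p - f q \<le> w (norm (p - q))" and m: "f x - f y = w \<xi>" and fM: "\<And>p q. \<bar>f p - f q\<bar> \<le> M"
    and a_nonneg: "\<And>t. 0 \<le> t \<Longrightarrow> t \<le> \<xi> / 2 \<Longrightarrow> 0 \<le> 2 * w \<xi> - w (\<xi> + 2 * t) - w (\<xi> - 2 * t)"
    and b_nonneg: "\<And>t. t > \<xi> / 2 \<Longrightarrow> 0 \<le> 2 * w \<xi> - w (2 * t + \<xi>) + w (2 * t - \<xi>)"
  defines "a \<equiv> \<lambda>z. indicator {z. \<bar>z \<bullet> e\<bar> \<le> \<xi> / 2} z * ((2 * w \<xi> - w (\<xi> + 2 * (z \<bullet> e)) - w (\<xi> - 2 * (z \<bullet> e))) / 2)"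
    and "b \<equiv> \<lambda>z. indicator {z. z \<bullet> e > \<xi> / 2} z * (2 * w \<xi> - w (2 * (z \<bullet> e) + \<xi>) + w (2 * (z \<bullet> e) - \<xi>))"
  shows "integrable (levy_measure \<alpha>) a" "integrable (levy_measure \<alpha>) b" "\<And>z. 0 \<le> a z" "\<And>z. 0 \<le> b z"
    "(LINT z|levy_measure \<alpha>. a z) + (LINT z|levy_measure \<alpha>. b z)
      \<le> (LINT z|lborel. second_diff f x z * levy_kernel \<alpha> z) - (LINT z|lborel. second_diff f y z * levy_kernel \<alpha> z)"
proof -
  let ?\<nu> = "levy_measure \<alpha> :: 'a measure"
  let ?R = "reflection e"
  have R: "orthogonal_transformation ?R" by (rule orthogonal_transformation_reflection[OF e])
  have [measurable]: "f \<in> borel_measurable borel" by (rule borel_measurable_continuous_onI[OF f])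
  have [measurable]: "?R \<in> borel_measurable borel" by (rule orthogonal_transformation_measurable[OF R])
  have [measurable]: "second_diff f p \<in> borel_measurable borel" for p
    by (rule borel_measurable_continuous_onI[OF continuous_second_diff(2)[OF f]])
  define S where "S = {z::'a. \<bar>z \<bullet> e\<bar> \<le> \<xi> / 2}"
  define Tp where "Tp = {z::'a. z \<bullet> e > \<xi> / 2}"
  define Tm where "Tm = {z::'a. - z \<in> Tp}"
  have [measurable]: "S \<in> sets borel" "Tp \<in> sets borel" "Tm \<in> sets borel"
    unfolding S_def Tp_def Tm_def by measurable
  \<comment> \<open>After mirror-coupled jumps the two points differ by
    \<open>(\<xi> + 2 * (z \<bullet> e)) *\<^sub>R e\<close>. Thus \<open>h\<close> is the slack in
    the modulus, nonnegative as long as the points do not change order, and \<open>s\<close> is the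
    loss averaged over the jumps \<open>z\<close> and \<open>- z\<close>.\<close>
  define g where "g z = f (x + z) - f (y + ?R z)" for z
  define h where "h z = w (\<xi> + 2 * (z \<bullet> e)) - g z" for z
  define s where "s z = w \<xi> - g z / 2 - g (- z) / 2" for z
  have [measurable]: "g \<in> borel_measurable borel" unfolding g_def[abs_def] by measurable
  have [measurable]: "h \<in> borel_measurable borel" unfolding h_def[abs_def] by measurable
  have [measurable]: "s \<in> borel_measurable borel" unfolding s_def[abs_def] by measurable
  have [measurable]: "a \<in> borel_measurable borel" "b \<in> borel_measurable borel"
    unfolding a_def b_def S_def[symmetric] Tp_def[symmetric] by measurable
  have gM: "\<bar>g z\<bar> \<le> M" for z unfolding g_def by (rule fM)
  have gw: "g z \<le> w \<bar>\<xi> + 2 * (z \<bullet> e)\<bar>" for z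
  proof -
    have "(x + z) - (y + ?R z) = (\<xi> + 2 * (z \<bullet> e)) *\<^sub>R e"
      by (simp add: xy reflection_def algebra_simps)
    then show ?thesis using fw[of "x + z" "y + ?R z"] e by (simp add: g_def)
  qed
  have h_nonneg: "0 \<le> h z" if "z \<bullet> e \<ge> - \<xi> / 2" for z
    using gw[of z] that by (simp add: h_def)
  have a_eq: "a z = indicator S z * ((2 * w \<xi> - w (\<xi> + 2 * (z \<bullet> e)) - w (\<xi> - 2 * (z \<bullet> e))) / 2)" for z
    by (simp add: a_def S_def)
  have b_eq: "b z = indicator Tp z * (2 * w \<xi> - w (2 * (z \<bullet> e) + \<xi>) + w (2 * (z \<bullet> e) - \<xi>))" for z
    by (simp add: b_def Tp_def)
  show a0: "0 \<le> a z" for z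
  proof (cases "z \<in> S")
    case True
    then have "0 \<le> 2 * w \<xi> - w (\<xi> + 2 * \<bar>z \<bullet> e\<bar>) - w (\<xi> - 2 * \<bar>z \<bullet> e\<bar>)" by (intro a_nonneg) (auto simp: S_def)
    then show ?thesis using True by (cases "z \<bullet> e \<ge> 0") (auto simp: a_eq abs_if)
  qed (simp add: a_eq)
  show b0: "0 \<le> b z" for z
    using b_nonneg[of "z \<bullet> e"] by (auto simp: b_eq Tp_def indicator_def)
  \<comment> \<open>The outer region avoids a ball about the singularity of the kernel, so there
    every bounded function is integrable and integrals may be split freely.\<close>
  have norm_Tp: "z \<notin> Tp" if "norm z < \<xi> / 2" for z
    using that norm_cauchy_schwarz[of z e] e by (simp add: Tp_def)
  have Tp_int: "integrable ?\<nu> (\<lambda>z. indicator Tp z * u z)" if [measurable]: "u \<in> borel_measurable borel" and "\<And>z. \<bar>u z\<bar> \<le> N" for u and N :: real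
  proof (rule levy_measure_bounded_integrable[OF \<alpha>, of _ "\<xi> / 2" N])
    have "0 \<le> N" using that(2)[of 0] by linarith
    then show "\<bar>indicator Tp z * u z\<bar> \<le> N" for z using that(2)[of z] by (simp add: indicator_def)
  qed (use \<xi> norm_Tp in auto)
  have wM4: "\<bar>2 * w \<xi> - w t + w t'\<bar> \<le> 4 * M" for t t'
    using wM[of \<xi>] wM[of t] wM[of t'] by linarith
  show b_int: "integrable ?\<nu> b"
    unfolding b_eq[abs_def] by (rule Tp_int[OF _ wM4]) measurable
  have sd_int: "integrable ?\<nu> (second_diff f p)" for p
    by (subst levy_measure_integrable_iff) (auto intro: second_diff_levy_integrable[OF \<alpha> f C])
  have s_eq: "s z = second_diff f x z - second_diff f y (?R z)" for z
    by (simp add: s_def g_def second_diff_def reflection_minus m[symmetric] field_simps)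
  have sdR: "integrable ?\<nu> (\<lambda>z. second_diff f y (?R z))" "(LINT z|?\<nu>. second_diff f y (?R z)) = (LINT z|?\<nu>. second_diff f y z)"
    using levy_measure_orthogonal[OF R, of "second_diff f y" \<alpha>] sd_int by auto
  have s_int: "integrable ?\<nu> s" unfolding s_eq[abs_def] by (intro Bochner_Integration.integrable_diff sd_int sdR)
  have diff: "(LINT z|lborel. second_diff f x z * levy_kernel \<alpha> z) - (LINT z|lborel. second_diff f y z * levy_kernel \<alpha> z) = (LINT z|?\<nu>. s z)"
    unfolding s_eq using sd_int sdR by (simp add: Bochner_Integration.integral_diff levy_measure_integral)
  have restr: "integrable ?\<nu> (\<lambda>z. indicator A z * u z)" if "integrable ?\<nu> u" "A \<in> sets borel" for A and u :: "'a \<Rightarrow> real"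
    using integrable_mult_indicator[of A ?\<nu> u] that by simp
  note U = orthogonal_transformation_uminus[where 'a='a]
  have sS: "indicator S z * s z = a z + indicator S z * ((h z + h (- z)) / 2)" for z
    by (simp add: a_eq s_def h_def indicator_def field_simps)
  have hS: "0 \<le> indicator S z * h z" "0 \<le> indicator S z * h (- z)" for z
    using h_nonneg[of z] h_nonneg[of "- z"] by (auto simp: S_def indicator_def)
  \<comment> \<open>On the slab, which contains the singularity, only \<open>s\<close> is known to
    be integrable. Since \<open>s\<close> is there a sum of nonnegative terms, it dominates
    \<open>a\<close> and, up to the factor 2, \<open>h\<close>.\<close>
  show a_int: "integrable ?\<nu> a"
  proof (rule Bochner_Integration.integrable_bound[OF restr[OF s_int, of S]])
    show "AE z in ?\<nu>. norm (a z) \<le> norm (indicator S z * s z)"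
    proof (intro always_eventually allI)
      fix z
      show "norm (a z) \<le> norm (indicator S z * s z)"
        unfolding sS using a0[of z] hS[of z] by (simp add: distrib_left add_divide_distrib)
    qed
  qed auto
  have hS_int: "integrable ?\<nu> (\<lambda>z. indicator S z * h z)"
  proof (rule Bochner_Integration.integrable_bound[OF integrable_mult_right[OF restr[OF s_int, of S], of 2]])
    show "AE z in ?\<nu>. norm (indicator S z * h z) \<le> norm (2 * (indicator S z * s z))"
    proof (intro always_eventually allI)
      fix z
      show "norm (indicator S z * h z) \<le> norm (2 * (indicator S z * s z))"
        unfolding sS using a0[of z] hS[of z] by (simp add: distrib_left add_divide_distrib)
    qed
  qed auto
  have indS: "indicator S (- z) = (indicator S z :: real)" for z by (simp add: S_def indicator_def)
  have hS_int': "integrable ?\<nu> (\<lambda>z. indicator S z * h (- z))"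
    and hS_eq: "(LINT z|?\<nu>. indicator S z * h (- z)) = (LINT z|?\<nu>. indicator S z * h z)"
    using levy_measure_orthogonal[OF U, of "\<lambda>z. indicator S z * h z" \<alpha>] hS_int by (auto simp: indS)
  have slab: "(LINT z|?\<nu>. indicator S z * s z) = (LINT z|?\<nu>. a z) + (LINT z|?\<nu>. indicator S z * h z)"
  proof -
    have "(LINT z|?\<nu>. indicator S z * s z) = (LINT z|?\<nu>. a z + (1/2 * (indicator S z * h z) + 1/2 * (indicator S z * h (- z))))"
      unfolding sS by (simp add: algebra_simps add_divide_distrib)
    also have "\<dots> = (LINT z|?\<nu>. a z) + (1/2 * (LINT z|?\<nu>. indicator S z * h z) + 1/2 * (LINT z|?\<nu>. indicator S z * h (- z)))"
      using a_int hS_int hS_int'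
      by (simp only: Bochner_Integration.integral_add Bochner_Integration.integrable_add integrable_mult_right integral_mult_right_zero)
    finally show ?thesis by (simp add: hS_eq)
  qed
  have s_even: "s (- z) = s z" for z by (simp add: s_def)
  have indTm: "indicator Tp (- z) = (indicator Tm z :: real)" for z by (simp add: Tm_def indicator_def)
  have Tm_eq: "(LINT z|?\<nu>. indicator Tm z * s z) = (LINT z|?\<nu>. indicator Tp z * s z)"
    using levy_measure_orthogonal(2)[OF U, of "\<lambda>z. indicator Tp z * s z" \<alpha>] by (simp add: indTm s_even)
  have "s z = indicator S z * s z + indicator Tp z * s z + indicator Tm z * s z" for z
    by (auto simp: S_def Tp_def Tm_def indicator_def abs_le_iff \<xi>; use \<xi> in linarith)
  then have "(LINT z|?\<nu>. s z) = (LINT z|?\<nu>. indicator S z * s z + indicator Tp z * s z + indicator Tm z * s z)"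
    by presburger
  also have "\<dots> = (LINT z|?\<nu>. indicator S z * s z) + (LINT z|?\<nu>. indicator Tp z * s z) + (LINT z|?\<nu>. indicator Tm z * s z)"
    using restr[OF s_int] by (subst Bochner_Integration.integral_add; (subst Bochner_Integration.integral_add)?) auto
  finally have total: "(LINT z|?\<nu>. s z) = (LINT z|?\<nu>. a z) + (LINT z|?\<nu>. indicator S z * h z) + 2 * (LINT z|?\<nu>. indicator Tp z * s z)"
    unfolding slab Tm_eq by simp
  let ?h' = "\<lambda>z. h (z - \<xi> *\<^sub>R e)"
  \<comment> \<open>Reflecting a crossing jump exchanges the roles of the two points:
    \<open>x + ?R z\<close> and \<open>y + z\<close> are the positions reached from \<open>y\<close>
    and \<open>x\<close> by a jump shifted by \<xi>. This produces the term
    \<open>w (2 * (z \<bullet> e) - \<xi>)\<close> in \<open>b\<close> and the translate of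
    \<open>h\<close>.\<close>
  have g_refl: "g (- (- ?R z)) = - g (z - \<xi> *\<^sub>R e)" for z
  proof -
    have "?R (z - \<xi> *\<^sub>R e) = ?R z + \<xi> *\<^sub>R e"
      using e by (simp add: reflection_def inner_simps norm_eq_1 algebra_simps flip: scaleR_add_left)
    then show ?thesis by (simp add: g_def xy reflection_reflection[OF e] algebra_simps)
  qed
  have R': "orthogonal_transformation (\<lambda>z. - ?R z)" using R by (simp add: orthogonal_transformation_neg)
  have indR: "indicator Tp (- ?R z) = (indicator Tp z :: real)" for z
    by (simp add: Tp_def indicator_def reflection_inner[OF e])
  have Tg: "integrable ?\<nu> (\<lambda>z. indicator Tp z * g z)" "integrable ?\<nu> (\<lambda>z. indicator Tp z * g (- z))"
    "integrable ?\<nu> (\<lambda>z. indicator Tp z * g (z - \<xi> *\<^sub>R e))" "integrable ?\<nu> (\<lambda>z. indicator Tp z * w \<xi>)"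
    by (rule Tp_int[OF _ gM], measurable)+ (rule Tp_int[OF _ wM], measurable)
  have g_cross: "(LINT z|?\<nu>. indicator Tp z * g (- z)) = - (LINT z|?\<nu>. indicator Tp z * g (z - \<xi> *\<^sub>R e))"
  proof -
    have "(LINT z|?\<nu>. indicator Tp z * g (- z)) = (LINT z|?\<nu>. indicator Tp (- ?R z) * g (- (- ?R z)))"
      by (rule levy_measure_orthogonal(2)[OF R', symmetric]) measurable
    then show ?thesis unfolding indR g_refl by simp
  qed
  have hM: "\<bar>h z\<bar> \<le> 2 * M" for z using gM[of z] wM[of "\<xi> + 2 * (z \<bullet> e)"] unfolding h_def by linarith
  have Th: "integrable ?\<nu> (\<lambda>z. indicator Tp z * h z)" "integrable ?\<nu> (\<lambda>z. indicator Tp z * ?h' z)"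
    by (rule Tp_int[OF _ hM], measurable)+
  have "2 * (LINT z|?\<nu>. indicator Tp z * s z) = (LINT z|?\<nu>. 2 * (indicator Tp z * w \<xi>) - indicator Tp z * g z - indicator Tp z * g (- z))"
    by (subst integral_mult_right_zero[symmetric]) (simp add: s_def algebra_simps)
  also have "\<dots> = 2 * (LINT z|?\<nu>. indicator Tp z * w \<xi>) - (LINT z|?\<nu>. indicator Tp z * g z) + (LINT z|?\<nu>. indicator Tp z * g (z - \<xi> *\<^sub>R e))"
    using Tg by (simp only: Bochner_Integration.integral_diff Bochner_Integration.integrable_diff integrable_mult_right integral_mult_right_zero g_cross)
  also have "\<dots> = (LINT z|?\<nu>. 2 * (indicator Tp z * w \<xi>) - indicator Tp z * g z + indicator Tp z * g (z - \<xi> *\<^sub>R e))"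
    using Tg by (simp only: Bochner_Integration.integral_diff Bochner_Integration.integrable_diff Bochner_Integration.integral_add integrable_mult_right integral_mult_right_zero)
  also have "\<dots> = (LINT z|?\<nu>. b z + indicator Tp z * h z - indicator Tp z * ?h' z)"
  proof (intro Bochner_Integration.integral_cong refl)
    fix z
    have "w (\<xi> + 2 * ((z - \<xi> *\<^sub>R e) \<bullet> e)) = w (2 * (z \<bullet> e) - \<xi>)"
      using e by (intro arg_cong[of _ _ w]) (simp add: inner_simps norm_eq_1)
    then show "2 * (indicator Tp z * w \<xi>) - indicator Tp z * g z + indicator Tp z * g (z - \<xi> *\<^sub>R e) = b z + indicator Tp z * h z - indicator Tp z * ?h' z"
      by (simp add: b_eq h_def indicator_def add.commute)
  qed
  also have "\<dots> = (LINT z|?\<nu>. b z) + (LINT z|?\<nu>. indicator Tp z * h z) - (LINT z|?\<nu>. indicator Tp z * ?h' z)"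
    using Th b_int by (simp only: Bochner_Integration.integral_diff Bochner_Integration.integrable_add Bochner_Integration.integral_add)
  finally have outer: "2 * (LINT z|?\<nu>. indicator Tp z * s z)
    = (LINT z|?\<nu>. b z) + (LINT z|?\<nu>. indicator Tp z * h z) - (LINT z|?\<nu>. indicator Tp z * ?h' z)" .
  \<comment> \<open>Translated back by \<open>\<xi> *\<^sub>R e\<close>, the region
    \<open>Tp\<close> becomes the half-space \<open>z \<bullet> e > - \<xi> / 2\<close>, contained
    in the union of \<open>S\<close> and \<open>Tp\<close>. There \<open>h\<close> is nonnegative
    and the translation moves points away from the origin, so the kernel only decreases.\<close>
  have "(LINT z|?\<nu>. indicator Tp z * ?h' z) \<le> (LINT z|?\<nu>. indicator S z * h z) + (LINT z|?\<nu>. indicator Tp z * h z)"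
  proof -
    let ?H = "\<lambda>z. indicator Tp z * ?h' z * levy_kernel \<alpha> z"
    let ?G = "\<lambda>z. (indicator S z * h z + indicator Tp z * h z) * levy_kernel \<alpha> z"
    have i1: "integrable lborel (\<lambda>z. ?H (\<xi> *\<^sub>R e + z))"
      using Th(2) by (subst lborel_translate(1)) (auto simp: levy_measure_integrable_iff)
    have i2: "integrable lborel ?G"
      using hS_int Th(1) by (subst levy_measure_integrable_iff[symmetric]) auto
    have "(LINT z|?\<nu>. indicator Tp z * ?h' z) = (LINT z|lborel. ?H z)" by (rule levy_measure_integral) measurable
    also have "\<dots> = (LINT z|lborel. ?H (\<xi> *\<^sub>R e + z))" by (rule lborel_translate(2)[symmetric]) measurable
    also have "\<dots> \<le> (LINT z|lborel. ?G z)"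
    proof (rule integral_mono_AE[OF i1 i2])
      have "AE z in lborel. z \<noteq> (0::'a)" by (rule AE_lborel_singleton)
      then show "AE z in lborel. ?H (\<xi> *\<^sub>R e + z) \<le> ?G z"
      proof eventually_elim
        fix z :: 'a assume z: "z \<noteq> 0"
        show "?H (\<xi> *\<^sub>R e + z) \<le> ?G z"
        proof (cases "\<xi> *\<^sub>R e + z \<in> Tp")
          case True
          then have ze: "z \<bullet> e > - \<xi> / 2" using e by (simp add: Tp_def inner_simps norm_eq_1)
          have "(norm z)\<^sup>2 \<le> (norm (\<xi> *\<^sub>R e + z))\<^sup>2"
          proof -
            have "(norm (\<xi> *\<^sub>R e + z))\<^sup>2 = (norm z)\<^sup>2 + \<xi> * (\<xi> + 2 * (z \<bullet> e))"
              using e by (simp add: power2_norm_eq_inner inner_simps norm_eq_1 inner_commute algebra_simps)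
            moreover have "0 \<le> \<xi> * (\<xi> + 2 * (z \<bullet> e))" using ze \<xi> by (intro mult_nonneg_nonneg) auto
            ultimately show ?thesis by simp
          qed
          then have "norm z \<le> norm (\<xi> *\<^sub>R e + z)" by (rule power2_le_imp_le) simp
          then have "levy_kernel \<alpha> (\<xi> *\<^sub>R e + z) \<le> levy_kernel \<alpha> z"
            by (rule levy_kernel_antimono[OF \<alpha>(1) z])
          moreover have "0 \<le> h z" using ze by (intro h_nonneg) auto
          moreover have "indicator S z + indicator Tp z = (1::real)"
            using ze by (auto simp: S_def Tp_def indicator_def abs_le_iff)
          ultimately have "h z * levy_kernel \<alpha> (\<xi> *\<^sub>R e + z) \<le> (indicator S z + indicator Tp z) * h z * levy_kernel \<alpha> z"
            by (simp add: mult_left_mono)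
          then show ?thesis using True by (simp only: distrib_right) simp
        next
          case False
          have "0 \<le> indicator Tp z * h z" using h_nonneg[of z] \<xi> by (auto simp: Tp_def indicator_def)
          then show ?thesis using False hS[of z] by simp
        qed
      qed
    qed
    also have "\<dots> = (LINT z|?\<nu>. indicator S z * h z + indicator Tp z * h z)" by (rule levy_measure_integral[symmetric]) measurable
    also have "\<dots> = (LINT z|?\<nu>. indicator S z * h z) + (LINT z|?\<nu>. indicator Tp z * h z)"
      using hS_int Th(1) by (rule Bochner_Integration.integral_add)
    finally show ?thesis .
  qed
  then show "(LINT z|?\<nu>. a z) + (LINT z|?\<nu>. b z)
      \<le> (LINT z|lborel. second_diff f x z * levy_kernel \<alpha> z) - (LINT z|lborel. second_diff f y z * levy_kernel \<alpha> z)"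
    unfolding diff total outer by linarith
qed

lemma nn_integral_even:
  fixes f :: "real \<Rightarrow> ennreal"
  assumes [measurable]: "f \<in> borel_measurable borel" and even: "\<And>x. f (- x) = f x"
  shows "(\<integral>\<^sup>+x. f x \<partial>lborel) = 2 * (\<integral>\<^sup>+x. indicator {0<..} x * f x \<partial>lborel)"
proof -
  have "(\<integral>\<^sup>+x. indicator {0<..} x * f x \<partial>lborel) = (\<integral>\<^sup>+x. indicator {0<..} (- x) * f x \<partial>lborel)"
    by (subst nn_integral_real_affine[where t = 0 and c = "-1"]) (auto simp: even)
  then show ?thesis
    using nn_integral_split_sign[of "\<lambda>x. x" f] by (simp add: AE_lborel_singleton mult_2)
qed

section \<open>Concavity inequalities for moduli and the dissipation estimate\<close>

lemma modulus_midpoint: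
  assumes W: "modulus_of_continuity W" and t: "0 \<le> t" "2 * t \<le> \<xi>"
  shows "W (\<xi> + 2 * t) + W (\<xi> - 2 * t) \<le> 2 * W \<xi>"
proof -
  have "concave_on {0..} W" using W by (simp add: modulus_of_continuity_def)
  then have "W ((1 - 1/2) *\<^sub>R (\<xi> + 2 * t) + (1/2) *\<^sub>R (\<xi> - 2 * t)) \<ge> (1 - 1/2) * W (\<xi> + 2 * t) + 1/2 * W (\<xi> - 2 * t)"
    using t by (intro concave_onD) auto
  then show ?thesis by (simp add: field_simps)
qed

text \<open>Concavity on the segment from 0 to \<open>u\<close>, together with
  \<open>W 0 = 0\<close>.\<close>

lemma modulus_ratio_antimono:
  assumes W: "modulus_of_continuity W" and s: "0 < s" "s \<le> u"
  shows "W u / u \<le> W s / s"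
proof -
  have "concave_on {0..} W" and W0: "W 0 = 0" using W by (auto simp: modulus_of_continuity_def)
  then have "W ((1 - s / u) *\<^sub>R 0 + (s / u) *\<^sub>R u) \<ge> (1 - s / u) * W 0 + s / u * W u"
    using s by (intro concave_onD) auto
  then show ?thesis using s W0 by (simp add: field_simps)
qed

lemma modulus_subadditive:
  assumes W: "modulus_of_continuity W" and "0 \<le> u" "0 \<le> v"
  shows "W (u + v) \<le> W u + W v"
proof (cases "u = 0 \<or> v = 0")
  case True
  moreover have "W 0 = 0" using W by (simp add: modulus_of_continuity_def)
  ultimately show ?thesis by auto
next
  case False
  then have uv: "u > 0" "v > 0" using assms by auto
  have "u * (W (u + v) / (u + v)) \<le> W u" "v * (W (u + v) / (u + v)) \<le> W v"
    using modulus_ratio_antimono[OF W, of u "u + v"] modulus_ratio_antimono[OF W, of v "u + v"] uv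
    by (auto simp: field_simps)
  moreover have "W (u + v) = u * (W (u + v) / (u + v)) + v * (W (u + v) / (u + v))"
    using uv by (subst distrib_right[symmetric]) simp
  ultimately show ?thesis by linarith
qed

text \<open>Subadditivity is used twice: an increment over a length \<open>2 * \<xi>\<close> is at
  most \<open>W (2 * \<xi>)\<close>, which is at most \<open>2 * W \<xi>\<close>. This is the sign
  of the second integrand in the dissipation term.\<close>

lemma modulus_far_increment:
  assumes W: "modulus_of_continuity W" and t: "0 \<le> \<xi>" "\<xi> \<le> 2 * t"
  shows "W (2 * t + \<xi>) - W (2 * t - \<xi>) \<le> 2 * W \<xi>"
proof -
  have "W ((2 * t - \<xi>) + 2 * \<xi>) \<le> W (2 * t - \<xi>) + W (2 * \<xi>)" "W (\<xi> + \<xi>) \<le> W \<xi> + W \<xi>"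
    using t by (intro modulus_subadditive[OF W]; simp)+
  moreover have "(2 * t - \<xi>) + 2 * \<xi> = 2 * t + \<xi>" "\<xi> + \<xi> = 2 * \<xi>" by auto
  ultimately show ?thesis by simp
qed

text \<open>The coupling bounds the difference of the two singular integrals below, the marginal
  reduces that bound to integrals over the line, and normalising by \<open>B * A1\<close> leaves the
  factor \<open>1 / A1\<close>, which is at least \<open>c\<close>.\<close>

proposition frac_laplacian_dissipation:
  fixes P :: "real^'n^'n" and f :: "real^'n \<Rightarrow> real"
  assumes \<alpha>: "0 < \<alpha>" "\<alpha> < 1" and c: "kernel_constant \<alpha> c" and P: "invertible P"
    and f: "continuous_on UNIV f" "periodic P f"
    and C: "\<And>x z. \<bar>second_diff f x z\<bar> \<le> C * min 1 ((norm z)\<^sup>2)"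
    and W: "modulus_of_continuity W" and fW: "\<And>p q. \<bar>f p - f q\<bar> \<le> W (norm (p - q))"
    and xy: "x \<noteq> y" and touch: "f x - f y = W (norm (x - y))"
  shows "ereal (frac_laplacian P \<alpha> f y - frac_laplacian P \<alpha> f x) \<le> dissipation \<alpha> c W (norm (x - y))"
proof -
  define \<xi> where "\<xi> = norm (x - y)"
  define e where "e = (x - y) /\<^sub>R \<xi>"
  have \<xi>: "\<xi> > 0" and e: "norm e = 1" and x_eq: "x = y + \<xi> *\<^sub>R e"
    using xy by (auto simp: \<xi>_def e_def)
  have W_cont: "continuous_on {0..} W" and W_mono: "mono_on {0..} W" and W_nonneg: "\<And>s. s \<ge> 0 \<Longrightarrow> 0 \<le> W s"
    using W by (auto simp: modulus_of_continuity_def)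
  obtain N where N: "N > 0" "\<And>p. \<bar>f p\<bar> \<le> N" using periodic_bounded[OF P f] by auto
  define M where "M = 2 * N"
  have fM: "\<bar>f p - f q\<bar> \<le> M" for p q using N(2)[of p] N(2)[of q] unfolding M_def by linarith
  have WM: "W \<xi> \<le> M" using fM[of x y] touch unfolding \<xi>_def by linarith
  \<comment> \<open>The coupling needs a bounded modulus on the whole line. Truncation at
    \<open>M\<close>, which bounds the oscillation of \<open>f\<close>, preserves the modulus
    inequality and the value at \<xi>, and it can only enlarge the two concavity gaps.\<close>
  define w where "w s = min (W (max 0 s)) M" for s
  have w: "w s = min (W s) M" if "s \<ge> 0" for s using that by (simp add: w_def)
  have w\<xi>: "w \<xi> = W \<xi>" using \<xi> WM by (simp add: w)
  have "continuous_on UNIV w" unfolding w_def[abs_def]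
    by (intro continuous_on_min continuous_on_compose2[OF W_cont] continuous_intros) auto
  then have [measurable]: "w \<in> borel_measurable borel" by (rule borel_measurable_continuous_onI)
  have wM: "\<bar>w s\<bar> \<le> M" for s using W_nonneg[of "max 0 s"] N(1) by (auto simp: w_def M_def)
  have aW: "2 * W \<xi> - W (\<xi> + 2 * t) - W (\<xi> - 2 * t) \<le> 2 * w \<xi> - w (\<xi> + 2 * t) - w (\<xi> - 2 * t)"
    and aW0: "0 \<le> 2 * W \<xi> - W (\<xi> + 2 * t) - W (\<xi> - 2 * t)" if "0 \<le> t" "t \<le> \<xi> / 2" for t
    using modulus_midpoint[OF W, of t \<xi>] that \<xi> by (auto simp: w\<xi> w)
  have bW: "2 * W \<xi> - W (2 * t + \<xi>) + W (2 * t - \<xi>) \<le> 2 * w \<xi> - w (2 * t + \<xi>) + w (2 * t - \<xi>)"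
    and bW0: "0 \<le> 2 * W \<xi> - W (2 * t + \<xi>) + W (2 * t - \<xi>)" if "t > \<xi> / 2" for t
  proof -
    have "W (2 * t - \<xi>) \<le> W (2 * t + \<xi>)" using that \<xi> by (intro mono_onD[OF W_mono]) auto
    then show "2 * W \<xi> - W (2 * t + \<xi>) + W (2 * t - \<xi>) \<le> 2 * w \<xi> - w (2 * t + \<xi>) + w (2 * t - \<xi>)"
      unfolding w\<xi> using that \<xi> by (auto simp: w)
    show "0 \<le> 2 * W \<xi> - W (2 * t + \<xi>) + W (2 * t - \<xi>)"
      using modulus_far_increment[OF W, of \<xi> t] that \<xi> by simp
  qed
  have fw: "f p - f q \<le> w (norm (p - q))" for p q
    using fW[of p q] fM[of p q] by (simp add: w abs_le_iff)
  \<comment> \<open>The factor 1/2 compensates for both signs of \<open>t\<close>: this function is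
    even, whereas the first dissipation integral runs over positive arguments only.\<close>
  define a where "a t = indicator {t. \<bar>t\<bar> \<le> \<xi> / 2} t * ((2 * w \<xi> - w (\<xi> + 2 * t) - w (\<xi> - 2 * t)) / 2)" for t
  define b where "b t = indicator {t. t > \<xi> / 2} t * (2 * w \<xi> - w (2 * t + \<xi>) + w (2 * t - \<xi>))" for t
  have [measurable]: "a \<in> borel_measurable borel" "b \<in> borel_measurable borel"
    unfolding a_def[abs_def] b_def[abs_def] by measurable
  let ?L = "\<lambda>p. LINT z|lborel. second_diff f p z * levy_kernel \<alpha> z"
  let ?\<nu> = "levy_measure \<alpha> :: (real^'n) measure"
  have ind: "indicator {z. \<bar>z \<bullet> e\<bar> \<le> \<xi> / 2} z = (indicator {t. \<bar>t\<bar> \<le> \<xi> / 2} (z \<bullet> e) :: real)"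
    "indicator {z. z \<bullet> e > \<xi> / 2} z = (indicator {t. t > \<xi> / 2} (z \<bullet> e) :: real)" for z :: "real^'n"
    by (simp_all add: indicator_def)
  have touch_w: "f x - f y = w \<xi>" using touch w\<xi> by (simp only: \<xi>_def)
  note coupling = levy_coupling[OF \<alpha> f(1) C \<xi> e x_eq \<open>w \<in> borel_measurable borel\<close> wM fw touch_w fM
      order_trans[OF aW0 aW] order_trans[OF bW0 bW]]
  have cpl: "integrable ?\<nu> (\<lambda>z. a (z \<bullet> e))" "integrable ?\<nu> (\<lambda>z. b (z \<bullet> e))"
    "\<And>z. 0 \<le> a (z \<bullet> e)" "\<And>z. 0 \<le> b (z \<bullet> e)"
    "(LINT z|?\<nu>. a (z \<bullet> e)) + (LINT z|?\<nu>. b (z \<bullet> e)) \<le> ?L x - ?L y"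
    unfolding a_def b_def ind[symmetric] by (rule coupling | assumption)+
  obtain B where B: "B > 0" and marg:
    "\<And>(e::real^'n) f. norm e = 1 \<Longrightarrow> f \<in> borel_measurable borel \<Longrightarrow>
       (\<integral>\<^sup>+z. f (z \<bullet> e) * ennreal (levy_kernel \<alpha> z) \<partial>lborel)
       = ennreal B * (\<integral>\<^sup>+x. f x * ennreal (\<bar>x\<bar> powr (- (1 + 2 * \<alpha>))) \<partial>lborel)"
    using levy_kernel_marginal[OF \<alpha>, where 'a="real^'n"] by blast
  define k where "k t = ennreal (\<bar>t\<bar> powr (- (1 + 2 * \<alpha>)))" for t :: real
  have [measurable]: "k \<in> borel_measurable borel" unfolding k_def[abs_def] by measurable
  have reduce: "ennreal (LINT z|?\<nu>. u (z \<bullet> e)) = ennreal B * (\<integral>\<^sup>+t. ennreal (u t) * k t \<partial>lborel)"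
    if [measurable]: "u \<in> borel_measurable borel" and "integrable ?\<nu> (\<lambda>z. u (z \<bullet> e))" "\<And>z. 0 \<le> u (z \<bullet> e)" for u
  proof -
    have "ennreal (LINT z|?\<nu>. u (z \<bullet> e)) = (\<integral>\<^sup>+z. ennreal (u (z \<bullet> e)) \<partial>?\<nu>)"
      using that by (intro nn_integral_eq_integral[symmetric]) auto
    also have "\<dots> = (\<integral>\<^sup>+z. ennreal (u (z \<bullet> e)) * ennreal (levy_kernel \<alpha> z) \<partial>lborel)"
      by (rule levy_measure_nn_integral) measurable
    also have "\<dots> = ennreal B * (\<integral>\<^sup>+t. ennreal (u t) * k t \<partial>lborel)"
      unfolding k_def by (rule marg[OF e]) measurable
    finally show ?thesis .
  qed
  define I1 where "I1 = (\<integral>\<^sup>+\<eta>\<in>{0..\<xi>/2}. ennreal (- ((W (\<xi> + 2 * \<eta>) + W (\<xi> - 2 * \<eta>) - 2 * W \<xi>) / \<eta> powr (1 + 2 * \<alpha>))) \<partial>lborel)"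
  define I2 where "I2 = (\<integral>\<^sup>+\<eta>\<in>{\<xi>/2..}. ennreal (- ((W (2 * \<eta> + \<xi>) - W (2 * \<eta> - \<xi>) - 2 * W \<xi>) / \<eta> powr (1 + 2 * \<alpha>))) \<partial>lborel)"
  have k_pos: "k t = ennreal (1 / t powr (1 + 2 * \<alpha>))" if "t > 0" for t
    using that unfolding k_def powr_minus_divide by simp
  have I1: "I1 \<le> (\<integral>\<^sup>+t. ennreal (a t) * k t \<partial>lborel)"
  proof -
    have "I1 \<le> (\<integral>\<^sup>+t. 2 * (indicator {0<..} t * (ennreal (a t) * k t)) \<partial>lborel)"
      unfolding I1_def
    proof (rule nn_integral_mono_AE, rule AE_mp[OF AE_lborel_singleton[of 0]], intro AE_I2 impI)
      fix t :: real assume t: "t \<noteq> 0"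
      show "ennreal (- ((W (\<xi> + 2 * t) + W (\<xi> - 2 * t) - 2 * W \<xi>) / t powr (1 + 2 * \<alpha>))) * indicator {0..\<xi> / 2} t
          \<le> 2 * (indicator {0<..} t * (ennreal (a t) * k t))"
      proof (cases "t \<in> {0..\<xi>/2}")
        case True
        then have t0: "t > 0" "t \<le> \<xi> / 2" using t by auto
        have at: "2 * a t = 2 * w \<xi> - w (\<xi> + 2 * t) - w (\<xi> - 2 * t)" using t0 by (simp add: a_def)
        have "- ((W (\<xi> + 2 * t) + W (\<xi> - 2 * t) - 2 * W \<xi>) / t powr (1 + 2 * \<alpha>))
            = (2 * W \<xi> - W (\<xi> + 2 * t) - W (\<xi> - 2 * t)) * (1 / t powr (1 + 2 * \<alpha>))"
          by (subst divide_inverse) (simp add: algebra_simps divide_inverse)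
        also have "\<dots> \<le> 2 * a t * (1 / t powr (1 + 2 * \<alpha>))"
          unfolding at using aW[of t] t0 by (intro mult_right_mono) auto
        finally have "ennreal (- ((W (\<xi> + 2 * t) + W (\<xi> - 2 * t) - 2 * W \<xi>) / t powr (1 + 2 * \<alpha>))) \<le> ennreal (2 * a t * (1 / t powr (1 + 2 * \<alpha>)))"
          by (rule ennreal_leI)
        also have "\<dots> = 2 * (ennreal (a t) * k t)"
          unfolding k_pos[OF t0(1)] mult.assoc by (subst ennreal_mult', simp, subst ennreal_mult'', simp, simp)
        finally show ?thesis using t0 by simp
      qed simp
    qed
    also have "\<dots> = 2 * (\<integral>\<^sup>+t. indicator {0<..} t * (ennreal (a t) * k t) \<partial>lborel)"
      by (rule nn_integral_cmult) measurable
    also have "\<dots> = (\<integral>\<^sup>+t. ennreal (a t) * k t \<partial>lborel)"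
    proof (rule nn_integral_even[symmetric])
      have "a (- t) = a t" for t by (auto simp: a_def indicator_def)
      then show "ennreal (a (- t)) * k (- t) = ennreal (a t) * k t" for t by (simp add: k_def)
    qed measurable
    finally show ?thesis .
  qed
  have I2: "I2 \<le> (\<integral>\<^sup>+t. ennreal (b t) * k t \<partial>lborel)"
    unfolding I2_def
  proof (rule nn_integral_mono_AE, rule AE_mp[OF AE_lborel_singleton[of "\<xi> / 2"]], intro AE_I2 impI)
    fix t :: real assume t: "t \<noteq> \<xi> / 2"
    show "ennreal (- ((W (2 * t + \<xi>) - W (2 * t - \<xi>) - 2 * W \<xi>) / t powr (1 + 2 * \<alpha>))) * indicator {\<xi> / 2..} t
        \<le> ennreal (b t) * k t"
    proof (cases "t \<in> {\<xi>/2..}")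
      case True
      then have t0: "t > 0" "t > \<xi> / 2" using t \<xi> by auto
      have bt: "b t = 2 * w \<xi> - w (2 * t + \<xi>) + w (2 * t - \<xi>)" using t0 by (simp add: b_def)
      have "- ((W (2 * t + \<xi>) - W (2 * t - \<xi>) - 2 * W \<xi>) / t powr (1 + 2 * \<alpha>))
          = (2 * W \<xi> - W (2 * t + \<xi>) + W (2 * t - \<xi>)) * (1 / t powr (1 + 2 * \<alpha>))"
        by (subst divide_inverse) (simp add: algebra_simps divide_inverse)
      also have "\<dots> \<le> b t * (1 / t powr (1 + 2 * \<alpha>))"
        unfolding bt using bW[of t] t0 by (intro mult_right_mono) auto
      finally have "ennreal (- ((W (2 * t + \<xi>) - W (2 * t - \<xi>) - 2 * W \<xi>) / t powr (1 + 2 * \<alpha>))) \<le> ennreal (b t * (1 / t powr (1 + 2 * \<alpha>)))"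
        by (rule ennreal_leI)
      also have "\<dots> = ennreal (b t) * k t"
        unfolding k_pos[OF t0(1)] by (rule ennreal_mult'') simp
      finally show ?thesis using True by simp
    qed simp
  qed
  have "ennreal B * (I1 + I2) \<le> ennreal B * (\<integral>\<^sup>+t. ennreal (a t) * k t \<partial>lborel) + ennreal B * (\<integral>\<^sup>+t. ennreal (b t) * k t \<partial>lborel)"
    unfolding distrib_left by (intro add_mono mult_left_mono I1 I2) auto
  also have "\<dots> = ennreal (LINT z|?\<nu>. a (z \<bullet> e)) + ennreal (LINT z|?\<nu>. b (z \<bullet> e))"
    using cpl by (subst (1 2) reduce) auto
  also have "\<dots> = ennreal ((LINT z|?\<nu>. a (z \<bullet> e)) + (LINT z|?\<nu>. b (z \<bullet> e)))"
    using cpl by (intro ennreal_plus[symmetric] integral_nonneg_AE) auto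
  also have "\<dots> \<le> ennreal (?L x - ?L y)" using cpl(5) by (rule ennreal_leI)
  finally have BI: "ennreal B * (I1 + I2) \<le> ennreal (?L x - ?L y)" .
  have "0 \<le> (LINT z|?\<nu>. a (z \<bullet> e))" "0 \<le> (LINT z|?\<nu>. b (z \<bullet> e))"
    using cpl(3,4) by (auto intro!: integral_nonneg_AE)
  then have L0: "0 \<le> ?L x - ?L y" using cpl(5) by linarith
  \<comment> \<open>The coupling inequality bounds these integrals by a finite quantity, so at a
    touching point the dissipation term is a real number.\<close>
  have "I1 + I2 < \<infinity>"
  proof (rule ccontr)
    assume "\<not> ?thesis"
    then have top: "I1 + I2 = top" unfolding infinity_ennreal_def using top.not_eq_extremum by blast
    show False using BI[unfolded top] B by (simp add: ennreal_mult_top top_unique)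
  qed
  then obtain J where J: "J \<ge> 0" "I1 + I2 = ennreal J" by (cases "I1 + I2") auto
  have BJ: "B * J \<le> ?L x - ?L y"
    using BI L0 B J by (simp add: J(2) ennreal_mult[symmetric])
  define Q where "Q = (\<integral>\<^sup>+x. ennreal (1 - cos x) * ennreal (\<bar>x\<bar> powr (- (1 + 2 * \<alpha>))) \<partial>lborel)"
  have c0: "c > 0" using c by (simp add: kernel_constant_def)
  have cQ: "ennreal c * Q \<le> 1" unfolding Q_def by (rule kernel_constant_le[OF \<alpha>(1) c])
  have "Q \<noteq> top" using cQ c0 by (auto simp: ennreal_mult_top top_unique)
  moreover have "Q > 0" unfolding Q_def by (rule cosine_integral_positive)
  ultimately obtain A1 where A1: "A1 > 0" "Q = ennreal A1" by (cases Q) auto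
  note A1' = A1(1) A1(2)[unfolded Q_def]
  have cA: "c * A1 \<le> 1"
  proof -
    have "ennreal c * ennreal A1 \<le> 1" using cQ unfolding A1(2) .
    then have "ennreal (c * A1) \<le> ennreal 1" using c0 A1(1) by (simp add: ennreal_mult)
    then show ?thesis by (subst (asm) ennreal_le_iff) auto
  qed
  have BA: "B * A1 > 0" using B A1 by simp
  \<comment> \<open>The unnormalised integral has symbol
    \<open>B * A1 * norm k powr (2 * \<alpha>)\<close>; the factor \<open>B\<close> also stands in
    front of \<open>J\<close> and drops out below.\<close>
  have lap: "frac_laplacian P \<alpha> f p = 1 / (B * A1) * ?L p" for p
    by (rule frac_laplacian_eq_levy[OF \<alpha> P f C BA levy_symbol[OF \<alpha>(1) B marg A1']])
  have "c * J \<le> 1 / A1 * J" using cA A1(1) J(1) by (intro mult_right_mono) (auto simp: field_simps)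
  also have "\<dots> = 1 / (B * A1) * (B * J)" using B by simp
  also have "\<dots> \<le> 1 / (B * A1) * (?L x - ?L y)" using BJ BA by (intro mult_left_mono) auto
  also have "\<dots> = frac_laplacian P \<alpha> f x - frac_laplacian P \<alpha> f y" by (simp add: lap right_diff_distrib)
  finally have "frac_laplacian P \<alpha> f y - frac_laplacian P \<alpha> f x \<le> - (c * J)" by simp
  moreover have "dissipation \<alpha> c W \<xi> = ereal (- (c * J))"
    unfolding dissipation_def I1_def[symmetric] I2_def[symmetric] J(2) using J(1) by (simp add: enn2ereal_ennreal)
  ultimately show ?thesis by (simp add: \<xi>_def)
qed

section \<open>The first breakthrough\<close>

lemma Ck_on_slice:
  fixes F :: "'a::euclidean_space \<times> real \<Rightarrow> 'b::real_normed_vector"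
  assumes "Ck_on k (UNIV \<times> {0..}) F" "t \<ge> 0"
  shows "Ck_on k UNIV (\<lambda>x. F (x, t))"
  using assms(1)
proof (induction k arbitrary: F)
  case 0
  then have "continuous_on (UNIV \<times> {0..}) F" by simp
  then have "continuous_on UNIV (\<lambda>x. F (x, t))"
    by (rule continuous_on_compose2) (use assms(2) in \<open>auto intro!: continuous_intros\<close>)
  then show ?case by simp
next
  case (Suc k)
  then obtain F' where F': "\<forall>z\<in>UNIV \<times> {0..}. (F has_derivative F' z) (at z within UNIV \<times> {0..})"
    "\<forall>v. Ck_on k (UNIV \<times> {0..}) (\<lambda>z. F' z v)" by auto
  have "((\<lambda>x. F (x, t)) has_derivative (\<lambda>v. F' (x, t) (v, 0))) (at x)" for x
  proof (rule has_derivative_in_compose[of "\<lambda>x. (x, t)" "\<lambda>v. (v, 0)" x UNIV F "F' (x, t)"])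
    show "((\<lambda>x. (x, t)) has_derivative (\<lambda>v. (v, 0))) (at x)"
      by (auto intro!: derivative_eq_intros)
    show "(F has_derivative F' (x, t)) (at (x, t) within range (\<lambda>x. (x, t)))"
      by (rule has_derivative_subset[of F _ _ "UNIV \<times> {0..}"]) (use F'(1) assms(2) in auto)
  qed
  moreover have "Ck_on k UNIV (\<lambda>x. F' (x, t) (v, 0))" for v
    using Suc.IH[of "\<lambda>z. F' z (v, 0)"] F'(2) by simp
  ultimately show ?case by (auto intro!: exI[of _ "\<lambda>x v. F' (x, t) (v, 0)"])
qed

lemma smooth_on_slice:
  fixes F :: "'a::euclidean_space \<times> real \<Rightarrow> 'b::real_normed_vector"
  assumes "smooth_on (UNIV \<times> {0..}) F" "t \<ge> 0"
  shows "smooth_on UNIV (\<lambda>x. F (x, t))"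
  using assms Ck_on_slice unfolding smooth_on_def by blast

lemma periodic_derivative:
  fixes f :: "real^'n \<Rightarrow> 'b::real_normed_vector"
  assumes f: "\<And>x. (f has_derivative f' x) (at x)" and "periodic P f"
  shows "periodic P f'"
  unfolding periodic_def
proof (intro allI)
  fix x i
  have "((\<lambda>x. f (x + column i P)) has_derivative f' (x + column i P)) (at x)"
    by (rule has_derivative_compose[of "\<lambda>x. x + column i P" "\<lambda>v. v" x UNIV f "f' (x + column i P)"])
       (auto intro!: derivative_eq_intros f)
  then have "(f has_derivative f' (x + column i P)) (at x)" using assms(2) by (simp add: periodic_def)
  then show "f' (x + column i P) = f' x" using f[of x] has_derivative_unique by blast
qed

lemma linear_norm_le_basis_sum:
  fixes g :: "'a::euclidean_space \<Rightarrow> 'b::real_normed_vector"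
  assumes "linear g"
  shows "norm (g v) \<le> norm v * (\<Sum>b\<in>Basis. norm (g b))"
proof -
  have "g v = g (\<Sum>b\<in>Basis. (v \<bullet> b) *\<^sub>R b)" by (simp add: euclidean_representation)
  also have "\<dots> = (\<Sum>b\<in>Basis. (v \<bullet> b) *\<^sub>R g b)" using assms by (simp add: linear_sum linear_scale)
  also have "norm \<dots> \<le> (\<Sum>b\<in>Basis. norm v * norm (g b))"
    by (intro sum_norm_le) (auto intro!: mult_right_mono Basis_le_norm)
  finally show ?thesis by (simp add: sum_distrib_left)
qed

text \<open>The second directional derivatives are continuous and inherit periodicity, hence are
  bounded. By linearity the finitely many pairs of basis directions suffice for a uniform
  constant.\<close>

lemma periodic_C2_Lipschitz_gradient:
  fixes f :: "real^'n \<Rightarrow> real" and P :: "real^'n^'n"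
  assumes P: "invertible P" and f: "Ck_on 2 UNIV f" "periodic P f" and f': "\<And>x. (f has_derivative f' x) (at x)"
  obtains L where "L \<ge> 0" "\<And>x y v. \<bar>f' x v - f' y v\<bar> \<le> L * norm (x - y) * norm v"
proof -
  have "Ck_on (Suc (Suc 0)) UNIV f" using f(1) by (simp add: numeral_2_eq_2)
  then obtain g' where g': "\<And>x. (f has_derivative g' x) (at x)" and C1: "\<And>v. Ck_on (Suc 0) UNIV (\<lambda>x. g' x v)"
    unfolding Ck_on.simps(2)[of "Suc 0"] by auto
  have [simp]: "g' = f'" using has_derivative_unique[OF g' f'] by auto
  from C1 have "\<forall>v. \<exists>f''. (\<forall>x. ((\<lambda>x. f' x v) has_derivative f'' x) (at x)) \<and> (\<forall>u. continuous_on UNIV (\<lambda>x. f'' x u))" by simp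
  then obtain f'' where f'': "\<And>v x. ((\<lambda>x. f' x v) has_derivative f'' v x) (at x)" "\<And>v u. continuous_on UNIV (\<lambda>x. f'' v x u)"
    by metis
  have per': "periodic P f'" by (rule periodic_derivative[OF f' f(2)])
  then have "periodic P (\<lambda>x. f' x v)" for v by (simp add: periodic_def)
  then have "periodic P (f'' v)" for v by (rule periodic_derivative[OF f''(1)])
  then have "periodic P (\<lambda>x. f'' v x u)" for v u by (simp add: periodic_def)
  then have "\<exists>N. \<forall>x. norm (f'' v x u) \<le> N" for v u using periodic_bounded[OF P f''(2)] by metis
  then obtain N where N: "\<And>v u x. norm (f'' v x u) \<le> N v u" by metis
  define L where "L = (\<Sum>v\<in>Basis. \<Sum>u\<in>Basis. N v u)"
  have N0: "0 \<le> N v u" for v u using order_trans[OF norm_ge_zero N] .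
  have lip: "\<bar>f' x v - f' y v\<bar> \<le> (\<Sum>u\<in>Basis. N v u) * norm (x - y)" for x y v
  proof -
    have "norm (f' x v - f' y v) \<le> (\<Sum>u\<in>Basis. N v u) * norm (x - y)"
    proof (rule differentiable_bound[of UNIV "\<lambda>x. f' x v" "f'' v"])
      fix z
      have "linear (f'' v z)" using has_derivative_linear[OF f''(1)] .
      then have "norm (f'' v z u) \<le> norm u * (\<Sum>b\<in>Basis. norm (f'' v z b))" for u
        by (rule linear_norm_le_basis_sum)
      also have "norm u * (\<Sum>b\<in>Basis. norm (f'' v z b)) \<le> norm u * (\<Sum>b\<in>Basis. N v b)" for u
        by (intro mult_left_mono sum_mono N) auto
      finally show "onorm (f'' v z) \<le> (\<Sum>u\<in>Basis. N v u)"
        by (intro onorm_le) (simp add: mult.commute)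
    qed (use f''(1) in auto)
    then show ?thesis by simp
  qed
  have "\<bar>f' x v - f' y v\<bar> \<le> L * norm (x - y) * norm v" for x y v
  proof -
    have "linear (\<lambda>v. f' x v - f' y v)"
      using has_derivative_linear[OF f'[of x]] has_derivative_linear[OF f'[of y]] by (rule linear_compose_sub)
    from linear_norm_le_basis_sum[OF this, of v]
    have "\<bar>f' x v - f' y v\<bar> \<le> norm v * (\<Sum>b\<in>Basis. \<bar>f' x b - f' y b\<bar>)" by simp
    also have "\<dots> \<le> norm v * (\<Sum>b\<in>Basis. (\<Sum>u\<in>Basis. N b u) * norm (x - y))"
      by (intro mult_left_mono sum_mono lip) auto
    also have "(\<Sum>b\<in>Basis. (\<Sum>u\<in>Basis. N b u) * norm (x - y)) = L * norm (x - y)"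
      unfolding L_def by (rule sum_distrib_right[symmetric])
    finally show ?thesis by (simp add: mult.commute)
  qed
  moreover have "L \<ge> 0" unfolding L_def by (intro sum_nonneg N0)
  ultimately show ?thesis using that by blast
qed

lemma derivative_along_line:
  fixes f :: "'a::real_normed_vector \<Rightarrow> real"
  assumes "\<And>x. (f has_derivative f' x) (at x)"
  shows "((\<lambda>s. f (x + s *\<^sub>R v)) has_real_derivative f' (x + s *\<^sub>R v) v) (at s)"
proof -
  have "((\<lambda>s. x + s *\<^sub>R v) has_derivative (\<lambda>r. r *\<^sub>R v)) (at s)"
    by (auto intro!: derivative_eq_intros)
  from has_derivative_compose[OF this assms]
  have "((\<lambda>s. f (x + s *\<^sub>R v)) has_derivative (\<lambda>r. f' (x + s *\<^sub>R v) (r *\<^sub>R v))) (at s)" .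
  moreover have "f' (x + s *\<^sub>R v) (r *\<^sub>R v) = f' (x + s *\<^sub>R v) v * r" for r
    using linear_scale[OF has_derivative_linear[OF assms]] by (simp add: mult.commute)
  ultimately show ?thesis by (simp add: has_field_derivative_def)
qed

lemma taylor_lower:
  fixes f :: "'a::real_normed_vector \<Rightarrow> real"
  assumes f': "\<And>x. (f has_derivative f' x) (at x)"
    and L: "\<And>x y v. \<bar>f' x v - f' y v\<bar> \<le> L * norm (x - y) * norm v" "L \<ge> 0" and d: "d > 0" and v: "norm v = 1"
  shows "f (x + d *\<^sub>R v) - f x \<ge> d * f' x v - L * d\<^sup>2"
proof -
  obtain s where s: "0 < s" "s < d" "f (x + d *\<^sub>R v) - f (x + 0 *\<^sub>R v) = (d - 0) * f' (x + s *\<^sub>R v) v"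
    using MVT2[OF d, of "\<lambda>s. f (x + s *\<^sub>R v)" "\<lambda>s. f' (x + s *\<^sub>R v) v"] derivative_along_line[OF f'] by blast
  have "\<bar>f' (x + s *\<^sub>R v) v - f' x v\<bar> \<le> L * s" using L(1)[of "x + s *\<^sub>R v" v x] s v by simp
  also have "\<dots> \<le> L * d" using s L(2) by (intro mult_left_mono) auto
  finally have "f' (x + s *\<^sub>R v) v \<ge> f' x v - L * d" by linarith
  then have "d * f' (x + s *\<^sub>R v) v \<ge> d * (f' x v - L * d)" using d by (intro mult_left_mono) auto
  then show ?thesis using s(3) by (simp add: algebra_simps power2_eq_square)
qed

lemma second_diff_quadratic:
  fixes f :: "'a::real_normed_vector \<Rightarrow> real"
  assumes f': "\<And>x. (f has_derivative f' x) (at x)"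
    and L: "\<And>x y v. \<bar>f' x v - f' y v\<bar> \<le> L * norm (x - y) * norm v" "L \<ge> 0"
  shows "\<bar>second_diff f x z\<bar> \<le> L * (norm z)\<^sup>2"
proof -
  have "((\<lambda>s. f (x + s *\<^sub>R z) + f (x + s *\<^sub>R (- z))) has_real_derivative (f' (x + s *\<^sub>R z) z + f' (x + s *\<^sub>R (- z)) (- z))) (at s)" for s
    by (intro DERIV_add derivative_along_line f')
  then obtain s where s: "0 < s" "s < 1"
    "(f (x + 1 *\<^sub>R z) + f (x + 1 *\<^sub>R (- z))) - (f (x + 0 *\<^sub>R z) + f (x + 0 *\<^sub>R (- z)))
       = (1 - 0) * (f' (x + s *\<^sub>R z) z + f' (x + s *\<^sub>R (- z)) (- z))"
    using MVT2[OF zero_less_one, of "\<lambda>s. f (x + s *\<^sub>R z) + f (x + s *\<^sub>R (- z))" "\<lambda>s. f' (x + s *\<^sub>R z) z + f' (x + s *\<^sub>R (- z)) (- z)"]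
    by blast
  have "f' p (- z) = - f' p z" for p using linear_neg[OF has_derivative_linear[OF f']] .
  then have "2 * second_diff f x z = - (f' (x + s *\<^sub>R z) z - f' (x + s *\<^sub>R (- z)) z)"
    using s(3) by (simp add: second_diff_def)
  then have "2 * \<bar>second_diff f x z\<bar> = \<bar>f' (x + s *\<^sub>R z) z - f' (x + s *\<^sub>R (- z)) z\<bar>"
    by linarith
  also have "\<dots> \<le> L * norm ((x + s *\<^sub>R z) - (x + s *\<^sub>R (- z))) * norm z" by (rule L(1))
  also have "(x + s *\<^sub>R z) - (x + s *\<^sub>R (- z)) = (2 * s) *\<^sub>R z" by (simp add: algebra_simps flip: scaleR_add_left)
  also have "L * norm ((2 * s) *\<^sub>R z) * norm z = 2 * (s * (L * (norm z)\<^sup>2))" using s by (simp add: power2_eq_square)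
  also have "\<dots> \<le> 2 * (1 * (L * (norm z)\<^sup>2))" using s L(2) by (intro mult_left_mono mult_right_mono) auto
  finally show ?thesis by simp
qed

text \<open>Combines the quadratic bound near 0 with boundedness far away into the form that is
  integrable against the Levy kernel.\<close>

lemma second_diff_bound:
  fixes f :: "'a::real_normed_vector \<Rightarrow> real"
  assumes "\<And>x z. \<bar>second_diff f x z\<bar> \<le> L * (norm z)\<^sup>2" "L \<ge> 0" "\<And>x. \<bar>f x\<bar> \<le> N"
  shows "\<bar>second_diff f x z\<bar> \<le> (L + 2 * N) * min 1 ((norm z)\<^sup>2)"
proof -
  have N: "0 \<le> N" using assms(3)[of x] by linarith
  have "\<bar>second_diff f x z\<bar> \<le> 2 * N"
    using assms(3)[of x] assms(3)[of "x + z"] assms(3)[of "x - z"] unfolding second_diff_def by linarith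
  moreover have "\<bar>second_diff f x z\<bar> \<le> (L + 2 * N) * (norm z)\<^sup>2"
  proof -
    have "0 \<le> 2 * N * (norm z)\<^sup>2" using N by simp
    then show ?thesis using assms(1)[of x z] unfolding distrib_right by linarith
  qed
  ultimately show ?thesis using assms(2) N by (simp add: min_def)
qed

section \<open>Moduli with infinitely negative second derivative at 0\<close>

text \<open>Near 0 the second derivative is below \<open>- 2 * K\<close>, so \<open>W\<close> plus
  \<open>K\<close> times the square has a nonincreasing derivative. The linear bound makes that
  derivative at most \<open>a\<close> in the limit at 0, hence everywhere nearby, and integration
  from 0 gives the gap. With \<open>K\<close> a bound from Taylor's formula, this excludes touching
  at distance 0.\<close>

lemma modulus_quadratic_gap:
  assumes W: "modulus_of_continuity W" "second_deriv_minus_infinity W"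
    and \<rho>: "\<rho> > 0" "\<And>d. 0 < d \<Longrightarrow> d < \<rho> \<Longrightarrow> W d \<le> a * d" and K: "K \<ge> 0"
  obtains d where "0 < d" "d < \<rho>" "W d \<le> a * d - K * d\<^sup>2"
proof -
  have "eventually (\<lambda>\<xi>. deriv (deriv W) \<xi> \<le> - 2 * K) (at_right 0)"
    using W(2) by (simp add: second_deriv_minus_infinity_def filterlim_at_bot)
  from eventually_conj[OF conjunct1[OF W(2)[unfolded second_deriv_minus_infinity_def]] this]
  have "eventually (\<lambda>\<xi>. (W differentiable (at \<xi>) \<and> deriv W differentiable (at \<xi>)) \<and> deriv (deriv W) \<xi> \<le> - 2 * K) (at_right 0)"
    .
  then obtain r where r: "r > 0" and ev: "\<And>\<xi>. 0 < \<xi> \<Longrightarrow> \<xi> < r \<Longrightarrow> W differentiable (at \<xi>) \<and> deriv W differentiable (at \<xi>) \<and> deriv (deriv W) \<xi> \<le> - 2 * K"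
    unfolding eventually_at_right_field by auto
  define q where "q s = W s + K * s\<^sup>2" for s
  define q' where "q' s = deriv W s + 2 * K * s" for s
  have dq: "(q has_real_derivative q' s) (at s)" if "0 < s" "s < r" for s
    unfolding q_def[abs_def] q'_def using ev[OF that] DERIV_deriv_iff_real_differentiable[of W s]
    by (auto intro!: derivative_eq_intros)
  have dq': "\<exists>y. (q' has_real_derivative y) (at s) \<and> y \<le> 0" if "0 < s" "s < r" for s
    unfolding q'_def[abs_def] using ev[OF that] DERIV_deriv_iff_real_differentiable[of "deriv W" s]
    by (intro exI[of _ "deriv (deriv W) s + 2 * K"]) (auto intro!: derivative_eq_intros)
  have q'_antimono: "q' u \<le> q' s" if "0 < s" "s \<le> u" "u < r" for s u
    using DERIV_nonpos_imp_nonincreasing[of s u q'] dq' that by force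
  have q0: "q 0 = 0" using W(1) by (simp add: q_def modulus_of_continuity_def)
  have q_cont: "continuous_on {0..} q" unfolding q_def[abs_def]
    using W(1) by (auto simp: modulus_of_continuity_def intro!: continuous_intros)
  have mean: "\<exists>\<eta>. 0 < \<eta> \<and> \<eta> < s \<and> q s = s * q' \<eta>" if s: "0 < s" "s < r" for s
  proof -
    have "continuous_on {0..s} q" using q_cont by (rule continuous_on_subset) auto
    moreover have "q differentiable (at u)" if "0 < u" "u < s" for u
      using dq[of u] that s by (auto simp: real_differentiable_def)
    ultimately obtain l \<eta> where l: "0 < \<eta>" "\<eta> < s" "(q has_real_derivative l) (at \<eta>)" "q s - q 0 = (s - 0) * l"
      using MVT[of 0 s q] s by blast
    then have "l = q' \<eta>" using DERIV_unique dq[of \<eta>] s by auto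
    then show ?thesis using l q0 by auto
  qed
  define d where "d = min r \<rho> / 2"
  have d: "0 < d" "d < r" "d < \<rho>" using r \<rho> by (auto simp: d_def)
  obtain \<eta> where \<eta>: "0 < \<eta>" "\<eta> < d" "q d = d * q' \<eta>" using mean[of d] d by auto
  \<comment> \<open>Mean value points arbitrarily close to 0 have derivative at most
    \<open>a + K * s\<close>; monotonicity transfers this to the fixed point \<eta>, and
    \<open>s\<close> is chosen to make the excess at most \<open>t\<close>.\<close>
  have "q' \<eta> \<le> a + t" if t: "t > 0" for t
  proof -
    define s where "s = min \<eta> (t / (K + 1))"
    have s: "0 < s" "s \<le> \<eta>" "s < r" "s < \<rho>" using \<eta> t K d by (auto simp: s_def)
    obtain \<eta>' where \<eta>': "0 < \<eta>'" "\<eta>' < s" "q s = s * q' \<eta>'" using mean[of s] s by auto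
    have "q' \<eta> \<le> q' \<eta>'" using q'_antimono[of \<eta>' \<eta>] \<eta>' s \<eta> d by auto
    moreover have "s * q' \<eta>' \<le> s * (a + K * s)" using \<rho>(2)[of s] s \<eta>'(3) by (simp add: q_def power2_eq_square algebra_simps)
    then have "q' \<eta>' \<le> a + K * s" using s by (simp add: mult_le_cancel_left_pos)
    moreover have "K * s \<le> t"
    proof -
      have "K * s \<le> (K + 1) * (t / (K + 1))" using K s t by (intro mult_mono) (auto simp: s_def)
      then show ?thesis using K by simp
    qed
    ultimately show ?thesis by linarith
  qed
  then have "q' \<eta> \<le> a" by (rule field_le_epsilon)
  then have "q d \<le> a * d" using \<eta>(3) d by (simp add: mult.commute)
  then show ?thesis using that[of d] d by (simp add: q_def)
qed

text \<open>If \<open>W\<close> vanished at \<open>s\<close> it would vanish on all of [0, s]; the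
  quadratic gap with slope 0 would then make it negative somewhere.\<close>

lemma modulus_pos:
  assumes W: "modulus_of_continuity W" "second_deriv_minus_infinity W" and s: "s > 0"
  shows "W s > 0"
proof (rule ccontr)
  assume "\<not> W s > 0"
  then have "W d \<le> 0 * d" if "0 < d" "d < s" for d
    using W(1) mono_onD[of "{0..}" W d s] that by (auto simp: modulus_of_continuity_def)
  then obtain d where "0 < d" "W d \<le> 0 * d - 1 * d\<^sup>2"
    using modulus_quadratic_gap[OF W s, of 0 1] by auto
  moreover have "0 \<le> W d" using W(1) \<open>0 < d\<close> by (simp add: modulus_of_continuity_def)
  moreover have "0 < d\<^sup>2" using \<open>0 < d\<close> by simp
  ultimately show False by linarith
qed

section \<open>Persistence of the modulus for a short time\<close>

lemma periodic_lattice_shift: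
  fixes P :: "real^'n^'n"
  assumes "periodic P f" "\<And>i. m $ i \<in> \<int>"
  shows "f (P *v y - P *v m) = f (P *v y)"
  using periodic_int_vec[OF periodic_pullback[OF assms(1)], of "- m" y] assms(2)
  by (simp add: matrix_vector_mult_diff_distrib matrix_vector_right_distrib)

text \<open>Lattice shifts bring a violation into a compact set. A close pair is moved by one common
  shift; the points of a distant pair are moved separately, which shortens their distance, so the
  monotone modulus is still violated. Separating direction and distance keeps a limiting direction
  when the distance tends to 0.\<close>

lemma violation_reduce:
  fixes P :: "real^'n^'n" and f :: "real^'n \<Rightarrow> real"
  assumes P: "invertible P" and f: "periodic P f"
    and W: "modulus_of_continuity W" "second_deriv_minus_infinity W"
    and R: "\<And>p q. p \<in> (*v) P ` cbox 0 1 \<Longrightarrow> q \<in> (*v) P ` cbox 0 1 \<Longrightarrow> norm (p - q) \<le> R"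
    and bad: "\<not> obeys f W"
  obtains x v r where "x \<in> (*v) P ` cbox 0 1" "norm v = 1" "0 < r" "r \<le> R" "f x - f (x - r *\<^sub>R v) \<ge> W r"
proof -
  obtain x y where xy: "x \<noteq> y" "f x - f y \<ge> W (norm (x - y))"
  proof -
    obtain x y where "x \<noteq> y" "\<not> \<bar>f x - f y\<bar> < W (norm (x - y))" using bad unfolding obeys_def by blast
    then show ?thesis using that[of x y] that[of y x] by (cases "f x \<ge> f y") (auto simp: norm_minus_commute)
  qed
  have "\<exists>p q. p \<in> (*v) P ` cbox 0 1 \<and> p \<noteq> q \<and> norm (p - q) \<le> R \<and> f p - f q \<ge> W (norm (p - q))"
  proof -
    obtain a where a: "x = P *v a" by (rule invertible_vec_mult_surj[OF P])
    obtain b where b: "y = P *v b" by (rule invertible_vec_mult_surj[OF P])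
    obtain m where m: "\<And>i. m $ i \<in> \<int>" "a - m \<in> cbox 0 1" using unit_cell_representative by blast
    obtain l where l: "\<And>i. l $ i \<in> \<int>" "b - l \<in> cbox 0 1" using unit_cell_representative by blast
    have x': "x - P *v m \<in> (*v) P ` cbox 0 1" and y': "y - P *v l \<in> (*v) P ` cbox 0 1"
      using m l by (auto simp: a b simp flip: matrix_vector_mult_diff_distrib)
    have fx: "f (x - P *v m) = f x" and fy: "f (y - P *v l) = f y" "f (y - P *v m) = f y"
      unfolding a b using periodic_lattice_shift[OF f] m l by auto
    show ?thesis
    proof (cases "norm (x - y) \<le> R")
      case True
      then show ?thesis using x' xy fx fy by (intro exI[of _ "x - P *v m"] exI[of _ "y - P *v m"]) auto
    next
      case False
      let ?p = "x - P *v m" and ?q = "y - P *v l"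
      have n: "norm (?p - ?q) \<le> R" using R x' y' by blast
      have "W (norm (?p - ?q)) \<le> W (norm (x - y))"
        using W(1) n False by (intro mono_onD[of "{0..}" W]) (auto simp: modulus_of_continuity_def)
      then have "W (norm (?p - ?q)) \<le> f ?p - f ?q" using xy fx fy by simp
      moreover have "?p \<noteq> ?q"
      proof
        assume "?p = ?q"
        then have "f x = f y" using fx fy by metis
        then show False using xy modulus_pos[OF W, of "norm (x - y)"] by simp
      qed
      ultimately show ?thesis using x' n by blast
    qed
  qed
  then obtain p q where pq: "p \<in> (*v) P ` cbox 0 1" "p \<noteq> q" "norm (p - q) \<le> R" "f p - f q \<ge> W (norm (p - q))" by blast
  have "p - norm (p - q) *\<^sub>R ((p - q) /\<^sub>R norm (p - q)) = q" using pq(2) by simp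
  then show ?thesis using that[of p "(p - q) /\<^sub>R norm (p - q)" "norm (p - q)"] pq by auto
qed

lemma smooth_space_derivative:
  fixes \<theta> :: "real^'n \<Rightarrow> real \<Rightarrow> real"
  assumes "smooth_on (UNIV \<times> {0..}) (\<lambda>(x, t). \<theta> x t)"
  obtains D where "\<And>x t. t \<ge> 0 \<Longrightarrow> ((\<lambda>x. \<theta> x t) has_derivative D x t) (at x)"
    "\<And>v. continuous_on (UNIV \<times> {0..}) (\<lambda>(x, t). D x t v)"
proof -
  let ?F = "\<lambda>(x, t). \<theta> x t"
  have "Ck_on (Suc 0) (UNIV \<times> {0..}) ?F" using assms unfolding smooth_on_def by blast
  then obtain F' where F': "\<And>z. z \<in> UNIV \<times> {0..} \<Longrightarrow> (?F has_derivative F' z) (at z within UNIV \<times> {0..})"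
    "\<And>v. continuous_on (UNIV \<times> {0..}) (\<lambda>z. F' z v)" by auto
  have "((\<lambda>x. ?F (x, t)) has_derivative (\<lambda>v. F' (x, t) (v, 0))) (at x)" if "t \<ge> 0" for x t
  proof (rule has_derivative_in_compose[of "\<lambda>x. (x, t)" "\<lambda>v. (v, 0)" x UNIV ?F "F' (x, t)"])
    show "((\<lambda>x. (x, t)) has_derivative (\<lambda>v. (v, 0))) (at x)"
      by (auto intro!: derivative_eq_intros)
    show "(?F has_derivative F' (x, t)) (at (x, t) within range (\<lambda>x. (x, t)))"
      by (rule has_derivative_subset[of ?F _ _ "UNIV \<times> {0..}"]) (use F'(1) that in auto)
  qed
  then show ?thesis using that[of "\<lambda>x t v. F' (x, t) (v, 0)"] F'(2) by (simp add: case_prod_beta')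
qed

text \<open>Violations at times decreasing to \<open>t0\<close> have a limit by compactness. At a
  positive limiting distance it contradicts the strict modulus at \<open>t0\<close>; at distance 0
  it yields a directional derivative that dominates the slope of the modulus, and the quadratic gap
  then contradicts the strict modulus at some small distance.\<close>

lemma obeys_persists:
  fixes P :: "real^'n^'n" and \<theta> :: "real^'n \<Rightarrow> real \<Rightarrow> real"
  assumes P: "invertible P"
    and smooth: "smooth_on (UNIV \<times> {0..}) (\<lambda>(x, t). \<theta> x t)"
    and per: "\<And>t. t \<ge> 0 \<Longrightarrow> periodic P (\<lambda>x. \<theta> x t)"
    and \<omega>_cont: "continuous_on ({0..} \<times> {0..}) (\<lambda>(\<xi>, t). \<omega> \<xi> t)"
    and mod: "\<And>t. t \<ge> 0 \<Longrightarrow> modulus_of_continuity (\<lambda>\<xi>. \<omega> \<xi> t)"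
    and snd: "\<And>t. t \<ge> 0 \<Longrightarrow> second_deriv_minus_infinity (\<lambda>\<xi>. \<omega> \<xi> t)"
    and t0: "t0 \<ge> 0" and ob: "obeys (\<lambda>x. \<theta> x t0) (\<lambda>\<xi>. \<omega> \<xi> t0)"
  shows "\<exists>\<epsilon>>0. \<forall>t. t0 \<le> t \<and> t < t0 + \<epsilon> \<longrightarrow> obeys (\<lambda>x. \<theta> x t) (\<lambda>\<xi>. \<omega> \<xi> t)"
proof (rule ccontr)
  assume contr: "\<not> ?thesis"
  define Cell where "Cell = (*v) P ` (cbox 0 1 :: (real^'n) set)"
  have compact: "compact Cell" unfolding Cell_def
    by (intro compact_continuous_image matrix_vector_mult_linear_continuous_on) auto
  then obtain N where N: "\<And>p. p \<in> Cell \<Longrightarrow> norm p \<le> N" using compact_imp_bounded bounded_iff by metis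
  define R where "R = 2 * N"
  have R: "norm (p - q) \<le> R" if "p \<in> Cell" "q \<in> Cell" for p q
    using norm_triangle_ineq4[of p q] N[OF that(1)] N[OF that(2)] by (simp add: R_def)
  have "\<exists>z t. z \<in> Cell \<times> (sphere 0 1 \<times> {0..R}) \<and> t0 \<le> t \<and> t < t0 + 1 / real (Suc n) \<and> snd (snd z) > 0
      \<and> \<theta> (fst z) t - \<theta> (fst z - snd (snd z) *\<^sub>R fst (snd z)) t \<ge> \<omega> (snd (snd z)) t" for n
  proof -
    obtain t where t: "t0 \<le> t" "t < t0 + 1 / real (Suc n)" "\<not> obeys (\<lambda>x. \<theta> x t) (\<lambda>\<xi>. \<omega> \<xi> t)"
      using contr zero_less_divide_1_iff[of "real (Suc n)"] by (metis of_nat_0_less_iff zero_less_Suc)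
    then have "t \<ge> 0" using t0 by simp
    obtain x v r where "x \<in> Cell" "norm v = 1" "0 < r" "r \<le> R" "\<theta> x t - \<theta> (x - r *\<^sub>R v) t \<ge> \<omega> r t"
      using violation_reduce[OF P per[OF \<open>t \<ge> 0\<close>] mod[OF \<open>t \<ge> 0\<close>] snd[OF \<open>t \<ge> 0\<close>] R[unfolded Cell_def] t(3)]
      unfolding Cell_def by blast
    then show ?thesis using t by (intro exI[of _ "(x, v, r)"] exI[of _ t]) auto
  qed
  then obtain z \<tau> where z: "\<And>n. z n \<in> Cell \<times> (sphere 0 1 \<times> {0..R})" and \<tau>: "\<And>n. t0 \<le> \<tau> n" "\<And>n. \<tau> n < t0 + 1 / real (Suc n)"
    and pos: "\<And>n. snd (snd (z n)) > 0"
    and viol: "\<And>n. \<theta> (fst (z n)) (\<tau> n) - \<theta> (fst (z n) - snd (snd (z n)) *\<^sub>R fst (snd (z n))) (\<tau> n) \<ge> \<omega> (snd (snd (z n))) (\<tau> n)"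
    by metis
  have "compact (Cell \<times> ((sphere 0 1 :: (real^'n) set) \<times> {0..R}))" using compact by (intro compact_Times) auto
  then obtain l \<sigma> where l: "l \<in> Cell \<times> (sphere 0 1 \<times> {0..R})" and \<sigma>: "strict_mono \<sigma>" and lim: "(z \<circ> \<sigma>) \<longlonglongrightarrow> l"
    using z unfolding compact_def by metis
  obtain x v r where lx: "l = (x, v, r)" by (cases l)
  define X where "X n = fst (z (\<sigma> n))" for n
  define V where "V n = fst (snd (z (\<sigma> n)))" for n
  define r' where "r' n = snd (snd (z (\<sigma> n)))" for n
  define T where "T n = \<tau> (\<sigma> n)" for n
  have X: "X \<longlonglongrightarrow> x" using tendsto_fst[OF lim] by (simp add: X_def[abs_def] lx o_def)
  have V: "V \<longlonglongrightarrow> v" using tendsto_fst[OF tendsto_snd[OF lim]] by (simp add: V_def[abs_def] lx o_def)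
  have r': "r' \<longlonglongrightarrow> r" using tendsto_snd[OF tendsto_snd[OF lim]] by (simp add: r'_def[abs_def] lx o_def)
  have "\<tau> \<longlonglongrightarrow> t0"
  proof (rule tendsto_sandwich[of "\<lambda>_. t0" _ _ "\<lambda>n. t0 + 1 / real (Suc n)"])
    show "(\<lambda>n. t0 + 1 / real (Suc n)) \<longlonglongrightarrow> t0"
      using tendsto_add[OF tendsto_const[of t0] LIMSEQ_Suc[OF lim_1_over_n]] by simp
  qed (use \<tau> in \<open>auto intro!: always_eventually less_imp_le\<close>)
  then have T: "T \<longlonglongrightarrow> t0" using LIMSEQ_subseq_LIMSEQ[OF _ \<sigma>] by (simp add: T_def[abs_def] o_def)
  have T0: "T n \<ge> 0" for n using \<tau>(1)[of "\<sigma> n"] t0 by (simp add: T_def)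
  have rpos: "r' n > 0" for n using pos by (simp add: r'_def)
  have vv: "norm v = 1" "r \<ge> 0" and VV: "norm (V n) = 1" for n
    using l z[of "\<sigma> n"] by (auto simp: lx V_def)
  have viol': "\<omega> (r' n) (T n) \<le> \<theta> (X n) (T n) - \<theta> (X n - r' n *\<^sub>R V n) (T n)" for n
    using viol by (simp add: r'_def T_def X_def V_def)
  have \<theta>_cont: "continuous_on (UNIV \<times> {0..}) (\<lambda>(x, t). \<theta> x t)"
    using smooth unfolding smooth_on_def by (metis Ck_on.simps(1))
  have \<theta>_lim: "(\<lambda>n. \<theta> (Y n) (T n)) \<longlonglongrightarrow> \<theta> y t0" if "Y \<longlonglongrightarrow> y" for Y y
    using continuous_on_tendsto_compose[OF \<theta>_cont tendsto_Pair[OF that T]] T0 t0 by simp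
  have \<omega>_lim: "(\<lambda>n. \<omega> (Y n) (T n)) \<longlonglongrightarrow> \<omega> y t0" if "Y \<longlonglongrightarrow> y" "\<And>n. Y n \<ge> 0" "y \<ge> 0" for Y y
    using continuous_on_tendsto_compose[OF \<omega>_cont tendsto_Pair[OF that(1) T]] T0 t0 that by simp
  show False
  proof (cases "r > 0")
    case True
    have "\<omega> r t0 \<le> \<theta> x t0 - \<theta> (x - r *\<^sub>R v) t0"
    proof (rule LIMSEQ_le)
      show "(\<lambda>n. \<omega> (r' n) (T n)) \<longlonglongrightarrow> \<omega> r t0" using r' rpos True by (intro \<omega>_lim) (auto simp: less_imp_le)
      show "(\<lambda>n. \<theta> (X n) (T n) - \<theta> (X n - r' n *\<^sub>R V n) (T n)) \<longlonglongrightarrow> \<theta> x t0 - \<theta> (x - r *\<^sub>R v) t0"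
        by (intro tendsto_diff \<theta>_lim tendsto_scaleR X V r')
    qed (use viol' in auto)
    moreover have "\<bar>\<theta> x t0 - \<theta> (x - r *\<^sub>R v) t0\<bar> < \<omega> (norm (x - (x - r *\<^sub>R v))) t0"
      using True vv by (intro ob[unfolded obeys_def, rule_format]) auto
    moreover have "norm (x - (x - r *\<^sub>R v)) = r" using True vv by auto
    ultimately show False by (simp only:)
  next
    case False
    then have r0: "r = 0" using vv by simp
    obtain D where D: "\<And>x t. t \<ge> 0 \<Longrightarrow> ((\<lambda>x. \<theta> x t) has_derivative D x t) (at x)"
      and Dc: "\<And>v. continuous_on (UNIV \<times> {0..}) (\<lambda>(x, t). D x t v)"
      using smooth_space_derivative[OF smooth] by blast
    have "\<exists>s. 0 < s \<and> s < r' n \<and> \<theta> (X n) (T n) - \<theta> (X n - r' n *\<^sub>R V n) (T n) = r' n * D (X n - s *\<^sub>R V n) (T n) (V n)" for n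
    proof -
      let ?y = "X n - r' n *\<^sub>R V n"
      obtain s where s: "0 < s" "s < r' n" "\<theta> (?y + r' n *\<^sub>R V n) (T n) - \<theta> (?y + 0 *\<^sub>R V n) (T n) = (r' n - 0) * D (?y + s *\<^sub>R V n) (T n) (V n)"
        using MVT2[OF rpos[of n], of "\<lambda>s. \<theta> (?y + s *\<^sub>R V n) (T n)" "\<lambda>s. D (?y + s *\<^sub>R V n) (T n) (V n)"]
          derivative_along_line[of "\<lambda>x. \<theta> x (T n)", OF D[OF T0]] by blast
      have y: "?y + s *\<^sub>R V n = X n - (r' n - s) *\<^sub>R V n" by (simp add: algebra_simps)
      show ?thesis using s(1,2) s(3)[unfolded y] by (intro exI[of _ "r' n - s"]) auto
    qed
    then obtain s where s: "\<And>n. 0 < s n" "\<And>n. s n < r' n"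
      "\<And>n. \<theta> (X n) (T n) - \<theta> (X n - r' n *\<^sub>R V n) (T n) = r' n * D (X n - s n *\<^sub>R V n) (T n) (V n)" by metis
    have s0: "s \<longlonglongrightarrow> 0"
      by (rule tendsto_sandwich[of "\<lambda>_. 0" _ _ r']) (use s r' r0 in \<open>auto intro!: always_eventually less_imp_le\<close>)
    define p where "p n = X n - s n *\<^sub>R V n" for n
    have p: "p \<longlonglongrightarrow> x"
      using tendsto_diff[OF X tendsto_scaleR[OF s0 V]] by (simp add: p_def[abs_def])
    \<comment> \<open>The derivative is jointly continuous in space and time only for each fixed
      direction, so the varying direction is expanded in the basis before passing to the
      limit.\<close>
    have D_sum: "D y t u = (\<Sum>b\<in>Basis. (u \<bullet> b) * D y t b)" if "t \<ge> 0" for y t u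
    proof -
      have "linear (D y t)" using has_derivative_linear[OF D[OF that]] .
      then have "D y t (\<Sum>b\<in>Basis. (u \<bullet> b) *\<^sub>R b) = (\<Sum>b\<in>Basis. (u \<bullet> b) * D y t b)" by (simp add: linear_sum linear_scale)
      then show ?thesis by (simp add: euclidean_representation)
    qed
    have D_lim: "(\<lambda>n. D (p n) (T n) (V n)) \<longlonglongrightarrow> D x t0 v"
    proof -
      have "(\<lambda>n. D (p n) (T n) b) \<longlonglongrightarrow> D x t0 b" for b
        using continuous_on_tendsto_compose[OF Dc tendsto_Pair[OF p T]] T0 t0 by simp
      then have "(\<lambda>n. \<Sum>b\<in>Basis. (V n \<bullet> b) * D (p n) (T n) b) \<longlonglongrightarrow> (\<Sum>b\<in>Basis. (v \<bullet> b) * D x t0 b)"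
        by (intro tendsto_sum tendsto_mult tendsto_inner V tendsto_const)
      moreover have "D (p n) (T n) (V n) = (\<Sum>b\<in>Basis. (V n \<bullet> b) * D (p n) (T n) b)" for n
        by (rule D_sum[OF T0])
      moreover have "D x t0 v = (\<Sum>b\<in>Basis. (v \<bullet> b) * D x t0 b)" by (rule D_sum[OF t0])
      ultimately show ?thesis by (simp only:)
    qed
    define a where "a = D x t0 v"
    \<comment> \<open>For fixed \<open>d\<close> the violating distance is eventually below
      \<open>d\<close>, and by concavity the chord slope at \<open>d\<close> is at most the one at
      that distance, hence at most the directional derivative given by the mean value
      theorem.\<close>
    have slope: "\<omega> d t0 \<le> a * d" if d: "d > 0" for d
    proof -
      have "\<omega> d t0 / d \<le> a" unfolding a_def
      proof (rule tendsto_le[OF _ D_lim])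
        show "(\<lambda>n. \<omega> d (T n) / d) \<longlonglongrightarrow> \<omega> d t0 / d"
          using d by (intro tendsto_divide \<omega>_lim tendsto_const) auto
        have "eventually (\<lambda>n. r' n < d) sequentially" using order_tendstoD(2)[OF r'] r0 d by simp
        then show "eventually (\<lambda>n. \<omega> d (T n) / d \<le> D (p n) (T n) (V n)) sequentially"
        proof eventually_elim
          case (elim n)
          have "\<omega> d (T n) / d \<le> \<omega> (r' n) (T n) / r' n"
            using modulus_ratio_antimono[OF mod[OF T0[of n]] rpos[of n], of d] elim by simp
          also have "\<dots> \<le> D (p n) (T n) (V n)"
            using viol'[of n] s(3)[of n] rpos[of n] by (simp add: p_def field_simps)
          finally show ?case .
        qed
      qed simp
      then show ?thesis using d by (simp add: field_simps)
    qed
    have "Ck_on 2 UNIV (\<lambda>x. (\<lambda>(x, t). \<theta> x t) (x, t0))"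
      using smooth_on_slice[OF smooth t0] unfolding smooth_on_def by blast
    then have C2: "Ck_on 2 UNIV (\<lambda>x. \<theta> x t0)" by simp
    obtain L where L: "L \<ge> 0" "\<And>x y v. \<bar>D x t0 v - D y t0 v\<bar> \<le> L * norm (x - y) * norm v"
      using periodic_C2_Lipschitz_gradient[OF P C2 per[OF t0] D[OF t0]] by blast
    obtain d where d: "0 < d" "\<omega> d t0 \<le> a * d - L * d\<^sup>2"
      using modulus_quadratic_gap[OF mod[OF t0] snd[OF t0] zero_less_one slope L(1)] by blast
    have "d * D x t0 v - L * d\<^sup>2 \<le> \<theta> (x + d *\<^sub>R v) t0 - \<theta> x t0"
      by (rule taylor_lower[of "\<lambda>x. \<theta> x t0" "\<lambda>x. D x t0", OF D[OF t0] L(2) L(1) d(1) vv(1)])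
    then have "\<omega> d t0 \<le> \<theta> (x + d *\<^sub>R v) t0 - \<theta> x t0" using d(2) by (simp add: a_def mult.commute)
    moreover have "\<bar>\<theta> (x + d *\<^sub>R v) t0 - \<theta> x t0\<bar> < \<omega> (norm (x + d *\<^sub>R v - x)) t0"
      using d vv by (intro ob[unfolded obeys_def, rule_format]) auto
    moreover have "norm (x + d *\<^sub>R v - x) = d" using d vv by auto
    ultimately show False by (simp only:)
  qed
qed

section \<open>Sup norm, one-sided derivatives and advection at the touching point\<close>

text \<open>A continuous function exceeds its essential supremum on an open null set, which must be
  empty.\<close>

lemma abs_le_esssup:
  fixes f :: "'a::euclidean_space \<Rightarrow> real"
  assumes f: "continuous_on UNIV f"
  shows "ereal \<bar>f x\<bar> \<le> esssup lborel (\<lambda>x. ereal \<bar>f x\<bar>)"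
proof (rule ccontr)
  let ?E = "esssup lborel (\<lambda>x. ereal \<bar>f x\<bar>)"
  let ?S = "{z. ?E < ereal \<bar>f z\<bar>}"
  assume "\<not> ?thesis"
  then have x: "x \<in> ?S" by simp
  have op: "open ?S" by (intro open_Collect_less continuous_intros f)
  have "AE z in lborel. z \<notin> ?S" using esssup_AE[of "\<lambda>x. ereal \<bar>f x\<bar>" lborel] by (auto simp: not_less)
  then have "?S \<in> null_sets lborel" using op by (subst (asm) AE_iff_null_sets[symmetric]) auto
  then have "negligible ?S" by (simp add: negligible_iff_null_sets null_sets_completionI)
  then show False using op x open_not_negligible by blast
qed

lemma left_derivative_at_max:
  fixes g :: "real \<Rightarrow> real"
  assumes "(g has_real_derivative D) (at_left t)" "s < t" "\<And>u. s < u \<Longrightarrow> u < t \<Longrightarrow> g u \<le> g t"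
  shows "D \<ge> 0"
proof -
  have "((\<lambda>u. (g u - g t) / (u - t)) \<longlongrightarrow> D) (at_left t)"
    using assms(1) by (simp add: has_field_derivative_iff)
  moreover have "eventually (\<lambda>u. (g u - g t) / (u - t) \<ge> 0) (at_left t)"
    using assms(2,3) unfolding eventually_at_left_field
    by (intro exI[of _ s]) (auto intro!: divide_nonpos_neg)
  ultimately show ?thesis by (intro tendsto_lowerbound[of _ D]) auto
qed

lemma right_derivative_at_min:
  fixes g :: "real \<Rightarrow> real"
  assumes "(g has_real_derivative D) (at_right t)" "\<And>u. t < u \<Longrightarrow> g t \<le> g u"
  shows "D \<ge> 0"
proof -
  have "((\<lambda>u. (g u - g t) / (u - t)) \<longlongrightarrow> D) (at_right t)"
    using assms(1) by (simp add: has_field_derivative_iff)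
  moreover have "eventually (\<lambda>u. (g u - g t) / (u - t) \<ge> 0) (at_right t)"
    using assms(2) unfolding eventually_at_right_field
    by (intro exI[of _ "t + 1"]) auto
  ultimately show ?thesis by (intro tendsto_lowerbound[of _ D]) auto
qed

lemma left_deriv_works:
  assumes "f differentiable (at_left x)"
  shows "(f has_real_derivative left_deriv f x) (at_left x)"
proof -
  obtain D where D: "(f has_real_derivative D) (at_left x)" using assms by (auto simp: real_differentiable_def)
  then show ?thesis unfolding left_deriv_def
    by (rule theI) (use D in \<open>auto intro: has_field_derivative_unique\<close>)
qed

lemma right_deriv_works:
  assumes "f differentiable (at_right x)"
  shows "(f has_real_derivative right_deriv f x) (at_right x)"
proof -
  obtain D where D: "(f has_real_derivative D) (at_right x)" using assms by (auto simp: real_differentiable_def)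
  then show ?thesis unfolding right_deriv_def
    by (rule theI) (use D in \<open>auto intro: has_field_derivative_unique\<close>)
qed

text \<open>Each point is moved for a time \<open>h > 0\<close> with its own velocity. Their
  distance grows at rate at most \<open>\<Omega>\<close>, so \<open>W (\<xi> + \<Omega> * h)\<close>
  still dominates the difference of values, with equality at \<open>h = 0\<close>; comparing right
  derivatives gives the claim.\<close>

lemma advection_bound:
  fixes f :: "'a::euclidean_space \<Rightarrow> real"
  assumes f': "\<And>x. (f has_derivative f' x) (at x)"
    and W: "mono_on {0..} W" "W differentiable (at_right \<xi>)" and \<xi>: "\<xi> = norm (x - y)" 
    and fW: "\<And>p q. \<bar>f p - f q\<bar> \<le> W (norm (p - q))" and touch: "f x - f y = W \<xi>"
    and uv: "norm (u - v) \<le> \<Omega>"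
  shows "f' x u - f' y v \<le> \<Omega> * right_deriv W \<xi>"
proof -
  have \<Omega>0: "\<Omega> \<ge> 0" using uv norm_ge_zero order_trans by blast
  have WD: "(W has_real_derivative right_deriv W \<xi>) (at_right \<xi>)" by (rule right_deriv_works[OF W(2)])
  have "((\<lambda>h. W (\<xi> + \<Omega> * h)) has_real_derivative \<Omega> * right_deriv W \<xi>) (at_right 0)"
  \<comment> \<open>For positive \<open>\<Omega>\<close> the affine map carries a right
    neighbourhood of 0 into one of \<xi>, which the chain rule for the right derivative needs; for
    \<open>\<Omega> = 0\<close> the function is constant.\<close>
  proof (cases "\<Omega> = 0")
    case False
    then have "\<Omega> > 0" using \<Omega>0 by simp
    have 1: "((\<lambda>h. \<xi> + \<Omega> * h) has_derivative (\<lambda>h. \<Omega> * h)) (at 0 within {0<..})"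
      by (auto intro!: derivative_eq_intros)
    have 2: "(W has_derivative (*) (right_deriv W \<xi>)) (at (\<xi> + \<Omega> * 0) within (\<lambda>h. \<xi> + \<Omega> * h) ` {0<..})"
      using WD \<open>\<Omega> > 0\<close> unfolding has_field_derivative_def
      by (auto intro!: has_derivative_subset[of W _ \<xi> "{\<xi><..}"])
    show ?thesis unfolding has_field_derivative_def
      by (rule has_derivative_eq_rhs[OF has_derivative_in_compose[OF 1 2]]) (simp add: fun_eq_iff)
  qed simp
  moreover have "((\<lambda>h. f (x + h *\<^sub>R u)) has_real_derivative f' x u) (at_right 0)"
    "((\<lambda>h. f (y + h *\<^sub>R v)) has_real_derivative f' y v) (at_right 0)"
    using derivative_along_line[OF f', of x u 0] derivative_along_line[OF f', of y v 0]
    by (auto intro: has_field_derivative_at_within)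
  ultimately have "((\<lambda>h. W (\<xi> + \<Omega> * h) - (f (x + h *\<^sub>R u) - f (y + h *\<^sub>R v))) has_real_derivative
      \<Omega> * right_deriv W \<xi> - (f' x u - f' y v)) (at_right 0)"
    by (intro DERIV_diff)
  then have "\<Omega> * right_deriv W \<xi> - (f' x u - f' y v) \<ge> 0"
  proof (rule right_derivative_at_min)
    fix h :: real assume h: "0 < h"
    have "norm ((x + h *\<^sub>R u) - (y + h *\<^sub>R v)) = norm ((x - y) + h *\<^sub>R (u - v))" by (simp add: algebra_simps)
    also have "\<dots> \<le> norm (x - y) + norm (h *\<^sub>R (u - v))" by (rule norm_triangle_ineq)
    also have "\<dots> \<le> \<xi> + \<Omega> * h" using uv h \<xi> by (simp add: mult.commute mult_right_mono)
    finally have "W (norm ((x + h *\<^sub>R u) - (y + h *\<^sub>R v))) \<le> W (\<xi> + \<Omega> * h)"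
      using h \<Omega>0 \<xi> by (intro mono_onD[OF W(1)]) auto
    then show "W (\<xi> + \<Omega> * 0) - (f (x + 0 *\<^sub>R u) - f (y + 0 *\<^sub>R v)) \<le> W (\<xi> + \<Omega> * h) - (f (x + h *\<^sub>R u) - f (y + h *\<^sub>R v))"
      using fW[of "x + h *\<^sub>R u" "y + h *\<^sub>R v"] touch by simp
  qed
  then show ?thesis by simp
qed

section \<open>Contradiction at the first touching time\<close>

theorem theorem2p2:
  fixes \<alpha> c :: real
    and P :: "real^'n^'n"
    and U :: "(real^'n \<Rightarrow> real) \<Rightarrow> real^'n \<Rightarrow> real^'n"
    and \<Omega> :: "(real \<Rightarrow> real) \<Rightarrow> real \<Rightarrow> real"
    and \<theta> :: "real^'n \<Rightarrow> real \<Rightarrow> real"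
    and \<theta>\<^sub>0 :: "real^'n \<Rightarrow> real"
    and \<omega> :: "real \<Rightarrow> real \<Rightarrow> real"
  assumes alpha: "0 < \<alpha>" "\<alpha> < 1"
    and c: "kernel_constant \<alpha> c"
    and P: "invertible P"
    and U_periodic: "\<And>f. smooth_on UNIV f \<Longrightarrow> periodic P f \<Longrightarrow> periodic P (U f)"
    and theta_smooth: "smooth_on (UNIV \<times> {0..}) (\<lambda>(x, t). \<theta> x t)"
    and theta_periodic: "\<And>t. t \<ge> 0 \<Longrightarrow> periodic P (\<lambda>x. \<theta> x t)"
    and equation: "\<And>x t. t > 0 \<Longrightarrow>
      ((\<lambda>s. \<theta> x s) has_real_derivative
         (frechet_derivative (\<lambda>y. \<theta> y t) (at x) (U (\<lambda>y. \<theta> y t) x)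
          - frac_laplacian P \<alpha> (\<lambda>y. \<theta> y t) x)) (at t)"
    and initial: "\<And>x. \<theta> x 0 = \<theta>\<^sub>0 x"
    and omega_cont: "continuous_on ({0..} \<times> {0..}) (\<lambda>(\<xi>, t). \<omega> \<xi> t)"
    and omega_C1_time: "\<And>\<xi>. \<xi> \<ge> 0 \<Longrightarrow> piecewise_C1_pos (\<lambda>t. \<omega> \<xi> t)"
    and omega_modulus: "\<And>t. t \<ge> 0 \<Longrightarrow> modulus_of_continuity (\<lambda>\<xi>. \<omega> \<xi> t)"
    and omega_second: "\<And>t. t \<ge> 0 \<Longrightarrow> second_deriv_minus_infinity (\<lambda>\<xi>. \<omega> \<xi> t)"
    and Omega: "\<And>t. t \<ge> 0 \<Longrightarrow> velocity_modulus P U (\<lambda>\<xi>. \<omega> \<xi> t) (\<Omega> (\<lambda>\<xi>. \<omega> \<xi> t))"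
    and theta0_obeys: "obeys \<theta>\<^sub>0 (\<lambda>\<xi>. \<omega> \<xi> 0)"
    and main: "\<And>\<xi> t. \<xi> > 0 \<Longrightarrow> t > 0 \<Longrightarrow>
      ereal (\<omega> \<xi> t) \<le> 2 * esssup lborel (\<lambda>x. ereal \<bar>\<theta> x t\<bar>) \<Longrightarrow>
      ereal (smaller_deriv (\<lambda>s. \<omega> \<xi> s) t) >
        ereal (\<Omega> (\<lambda>\<zeta>. \<omega> \<zeta> t) \<xi> * larger_deriv (\<lambda>\<zeta>. \<omega> \<zeta> t) \<xi>)
        + dissipation \<alpha> c (\<lambda>\<zeta>. \<omega> \<zeta> t) \<xi>"
  shows "\<forall>t>0. obeys (\<lambda>x. \<theta> x t) (\<lambda>\<xi>. \<omega> \<xi> t)"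
proof (rule ccontr)
  assume "\<not> ?thesis"
  then obtain T where T: "T > 0" "\<not> obeys (\<lambda>x. \<theta> x T) (\<lambda>\<xi>. \<omega> \<xi> T)" by blast
  define Bad where "Bad = {t. t \<ge> 0 \<and> \<not> obeys (\<lambda>x. \<theta> x t) (\<lambda>\<xi>. \<omega> \<xi> t)}"
  define t1 where "t1 = Inf Bad"
  have Bad: "T \<in> Bad" "bdd_below Bad" using T by (auto simp: Bad_def intro!: bdd_belowI[of _ 0])
  have t1_ge: "t1 \<ge> 0" unfolding t1_def using Bad by (intro cInf_greatest) (auto simp: Bad_def)
  have before: "obeys (\<lambda>x. \<theta> x s) (\<lambda>\<xi>. \<omega> \<xi> s)" if "0 \<le> s" "s < t1" for s
    using cInf_lower[OF _ Bad(2), of s] that by (force simp: Bad_def t1_def)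
  \<comment> \<open>The infimum is itself a bad time: otherwise the modulus would persist to the
    right of \<open>t1\<close>, and the bad times would be bounded below by a larger number.\<close>
  have bad_t1: "\<not> obeys (\<lambda>x. \<theta> x t1) (\<lambda>\<xi>. \<omega> \<xi> t1)"
  proof
    assume "obeys (\<lambda>x. \<theta> x t1) (\<lambda>\<xi>. \<omega> \<xi> t1)"
    then obtain \<epsilon> where \<epsilon>: "\<epsilon> > 0" "\<And>t. t1 \<le> t \<Longrightarrow> t < t1 + \<epsilon> \<Longrightarrow> obeys (\<lambda>x. \<theta> x t) (\<lambda>\<xi>. \<omega> \<xi> t)"
      using obeys_persists[OF P theta_smooth theta_periodic omega_cont omega_modulus omega_second t1_ge] by blast
    have "t1 + \<epsilon> \<le> s" if "s \<in> Bad" for s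
      using \<epsilon>(2)[of s] cInf_lower[OF that Bad(2)] that by (force simp: Bad_def t1_def)
    then have "t1 + \<epsilon> \<le> t1" unfolding t1_def using Bad(1) by (intro cInf_greatest) auto
    then show False using \<epsilon>(1) by simp
  qed
  have "t1 \<noteq> 0" using bad_t1 theta0_obeys initial by auto
  then have t1: "t1 > 0" using t1_ge by simp
  let ?f = "\<lambda>x. \<theta> x t1" and ?W = "\<lambda>\<xi>. \<omega> \<xi> t1"
  have W: "modulus_of_continuity ?W" by (rule omega_modulus[OF t1_ge])
  have theta_cont: "continuous_on (UNIV \<times> {0..}) (\<lambda>(x, t). \<theta> x t)"
    using theta_smooth unfolding smooth_on_def by (metis Ck_on.simps(1))
  \<comment> \<open>The strict inequalities at earlier times pass to the limit as a non-strict one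
    at \<open>t1\<close>; together with the violation this forces equality for some pair of
    points.\<close>
  have fW: "\<bar>?f p - ?f q\<bar> \<le> ?W (norm (p - q))" for p q
  proof (cases "p = q")
    case True
    then show ?thesis using W by (simp add: modulus_of_continuity_def)
  next
    case False
    define s where "s n = t1 - t1 / real (Suc n)" for n
    have s: "0 \<le> s n" "s n < t1" for n using t1 by (auto simp: s_def field_simps)
    have "s \<longlonglongrightarrow> t1 - 0" unfolding s_def
      by (intro tendsto_diff tendsto_const LIMSEQ_Suc[OF lim_const_over_n])
    then have slim: "s \<longlonglongrightarrow> t1" by simp
    have th: "(\<lambda>n. \<theta> z (s n)) \<longlonglongrightarrow> \<theta> z t1" for z
      using continuous_on_tendsto_compose[OF theta_cont tendsto_Pair[OF tendsto_const slim]] s t1 by simp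
    have om: "(\<lambda>n. \<omega> (norm (p - q)) (s n)) \<longlonglongrightarrow> \<omega> (norm (p - q)) t1"
      using continuous_on_tendsto_compose[OF omega_cont tendsto_Pair[OF tendsto_const slim]] s t1 by simp
    show ?thesis
    proof (rule LIMSEQ_le)
      show "(\<lambda>n. \<bar>\<theta> p (s n) - \<theta> q (s n)\<bar>) \<longlonglongrightarrow> \<bar>?f p - ?f q\<bar>" by (intro tendsto_rabs tendsto_diff th)
      show "(\<lambda>n. \<omega> (norm (p - q)) (s n)) \<longlonglongrightarrow> ?W (norm (p - q))" by (rule om)
      show "\<exists>N. \<forall>n\<ge>N. \<bar>\<theta> p (s n) - \<theta> q (s n)\<bar> \<le> \<omega> (norm (p - q)) (s n)"
        using before[OF s] False unfolding obeys_def by (meson less_imp_le)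
    qed
  qed
  obtain x y where xy: "x \<noteq> y" and touch: "?f x - ?f y = ?W (norm (x - y))"
  proof -
    obtain a b where ab: "a \<noteq> b" "\<bar>?f a - ?f b\<bar> = ?W (norm (a - b))"
      using bad_t1 fW unfolding obeys_def by (metis antisym_conv2)
    then show ?thesis using that[of a b] that[of b a]
      by (cases "?f a \<ge> ?f b") (auto simp: norm_minus_commute)
  qed
  define \<xi> where "\<xi> = norm (x - y)"
  have \<xi>: "\<xi> > 0" using xy by (simp add: \<xi>_def)
  have f_smooth: "smooth_on UNIV ?f" using smooth_on_slice[OF theta_smooth t1_ge] by simp
  have f_per: "periodic P ?f" by (rule theta_periodic[OF t1_ge])
  have f_cont: "continuous_on UNIV ?f" using f_smooth unfolding smooth_on_def by (metis Ck_on.simps(1))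
  obtain D where D: "\<And>z. (?f has_derivative D z) (at z)"
    using smooth_space_derivative[OF theta_smooth] t1_ge by metis
  obtain L where L: "L \<ge> 0" "\<And>x y v. \<bar>D x v - D y v\<bar> \<le> L * norm (x - y) * norm v"
    by (rule periodic_C2_Lipschitz_gradient[OF P _ f_per D]) (use f_smooth in \<open>simp_all add: smooth_on_def\<close>)
  have "bounded (range ?f)" by (rule compact_imp_bounded[OF periodic_range_compact[OF P f_cont f_per]])
  then obtain N where N: "\<And>z. \<bar>?f z\<bar> \<le> N" by (auto simp: bounded_iff)
  have C: "\<bar>second_diff ?f p z\<bar> \<le> (L + 2 * N) * min 1 ((norm z)\<^sup>2)" for p z
    by (rule second_diff_bound[OF second_diff_quadratic[OF D L(2) L(1)] L(1) N])
  let ?u = "U ?f" and ?\<Lambda> = "frac_laplacian P \<alpha> ?f"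
  have dissip: "ereal (?\<Lambda> y - ?\<Lambda> x) \<le> dissipation \<alpha> c ?W \<xi>"
    unfolding \<xi>_def by (rule frac_laplacian_dissipation[OF alpha c P f_cont f_per C W fW xy touch])
  have u: "norm (?u x - ?u y) \<le> \<Omega> ?W \<xi>"
    using Omega[OF t1_ge] f_smooth f_per fW unfolding velocity_modulus_def \<xi>_def by blast
  have "?W differentiable (at_right \<xi>)" using W \<xi> by (simp add: modulus_of_continuity_def piecewise_C1_pos_def)
  then have "D x (?u x) - D y (?u y) \<le> \<Omega> ?W \<xi> * right_deriv ?W \<xi>"
    using W touch by (intro advection_bound[OF D _ _ \<xi>_def fW _ u]) (auto simp: modulus_of_continuity_def \<xi>_def)
  also have "\<dots> \<le> \<Omega> ?W \<xi> * larger_deriv ?W \<xi>"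
    using order_trans[OF norm_ge_zero u] by (intro mult_left_mono) (auto simp: larger_deriv_def)
  finally have adv: "D x (?u x) - D y (?u y) \<le> \<Omega> ?W \<xi> * larger_deriv ?W \<xi>" .
  define E where "E = (D x (?u x) - ?\<Lambda> x) - (D y (?u y) - ?\<Lambda> y)"
  have "frechet_derivative ?f (at z) = D z" for z using frechet_derivative_at[OF D] by simp
  then have "((\<lambda>s. \<theta> x s - \<theta> y s) has_real_derivative E) (at t1)"
    unfolding E_def using equation[OF t1, of x] equation[OF t1, of y] by (intro DERIV_diff) simp_all
  then have dtheta: "((\<lambda>s. \<theta> x s - \<theta> y s) has_real_derivative E) (at_left t1)"
    by (rule has_field_derivative_at_within)
  \<comment> \<open>The strict inequality is known only before \<open>t1\<close>, so the comparison
    yields the left time derivative of \<omega>, which is at least the smaller one-sided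
    derivative.\<close>
  have "(\<lambda>s. \<omega> \<xi> s) differentiable (at_left t1)"
    using omega_C1_time[of \<xi>] \<xi> t1 by (simp add: piecewise_C1_pos_def)
  from DERIV_diff[OF dtheta left_deriv_works[OF this]]
  have "E - left_deriv (\<lambda>s. \<omega> \<xi> s) t1 \<ge> 0"
  proof (rule left_derivative_at_max[OF _ t1])
    fix s assume s: "0 < s" "s < t1"
    have "\<theta> x s - \<theta> y s < \<omega> \<xi> s" using before[of s] s xy unfolding obeys_def \<xi>_def by fastforce
    then show "\<theta> x s - \<theta> y s - \<omega> \<xi> s \<le> \<theta> x t1 - \<theta> y t1 - \<omega> \<xi> t1" using touch by (simp add: \<xi>_def)
  qed
  then have "smaller_deriv (\<lambda>s. \<omega> \<xi> s) t1 \<le> E" by (simp add: smaller_deriv_def)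
  then have "ereal (smaller_deriv (\<lambda>s. \<omega> \<xi> s) t1) \<le> ereal E" by simp
  also have "\<dots> = ereal (D x (?u x) - D y (?u y)) + ereal (?\<Lambda> y - ?\<Lambda> x)" by (simp add: E_def)
  also have "\<dots> \<le> ereal (\<Omega> ?W \<xi> * larger_deriv ?W \<xi>) + dissipation \<alpha> c ?W \<xi>"
    using adv dissip by (intro add_mono) auto
  also have "\<dots> < ereal (smaller_deriv (\<lambda>s. \<omega> \<xi> s) t1)"
  \<comment> \<open>A touching pair lies in the range where the differential inequality is assumed,
    because the modulus there equals a difference of two values of the solution.\<close>
  proof (rule main[OF \<xi> t1])
    have "ereal (\<omega> \<xi> t1) \<le> ereal \<bar>?f x\<bar> + ereal \<bar>?f y\<bar>" using touch by (simp add: \<xi>_def)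
    also have "\<dots> \<le> esssup lborel (\<lambda>x. ereal \<bar>?f x\<bar>) + esssup lborel (\<lambda>x. ereal \<bar>?f x\<bar>)"
      by (intro add_mono abs_le_esssup f_cont)
    also have "\<dots> = 2 * esssup lborel (\<lambda>x. ereal \<bar>?f x\<bar>)"
      by (cases "esssup lborel (\<lambda>x. ereal \<bar>?f x\<bar>)") auto
    finally show "ereal (\<omega> \<xi> t1) \<le> 2 * esssup lborel (\<lambda>x. ereal \<bar>\<theta> x t1\<bar>)" .
  qed
  finally show False by simp
qed

end
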